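(* Let $s\ge1$ be an integer, suppose that $0\le\theta_j<\frac{\pi}{2}$ for $1\le j\le s$, and let $f:\mathbb{C}^s\to\mathbb{C}$ be holomorphic in a domain containing $D_{\boldsymbol\theta}:=D_{\theta_1}\times\cdots\times D_{\theta_s}$. If $f$ and all of its (partial) derivatives are of sufficient decay in $D_{\boldsymbol\theta}$, then for $\boldsymbol a\in\mathbb{R}^s$ and $N\in\mathbb{N}_0$ we have $$\sum_{\boldsymbol m\in\mathbb{N}_0^s} f(w(\boldsymbol m+\boldsymbol a)) = (-1)^s\sum_{\boldsymbol n\in\mathcal N_N^s} f^{(\boldsymbol n)}(\boldsymbol 0)\prod_{1\le j\le s}\frac{B_{n_j+1}(a_j)}{(n_j+1)!}w^{n_j}$$ $$+\sum_{\emptyset\subseteq\mathscr S\subsetneq\{1,\dots,s\}}\frac{(-1)^{|\mathscr S|}}{w^{s-|\mathscr S|}}\sum_{\substack{n_j\in\mathcal N_N\\ j\in\mathscr S}}\int_{[0,\infty)^{s-|\mathscr S|}}\left[\prod_{j\in\mathscr S}\frac{\partial^{n_j}}{\partial x_j^{n_j}}f(\boldsymbol x)\right]_{\substack{x_j=0\\ j\in\mathscr S}}\prod_{\substack{1\le k\le s\\ k\notin\mathscr S}}dx_k\prod_{j\in\mathscr S}\frac{B_{n_j+1}(a_j)}{(n_j+1)!}w^{n_j}+O_N(w^N),$$ uniformly, as $w\to0$ in $D_{\theta_1}\cap\cdots\cap D_{\theta_s}$.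
   Context: For $0\le\theta<\frac\pi2$, $D_\theta:=\{re^{i\alpha}: r\ge0,\ |\alpha|\le\theta\}\subset\mathbb{C}$. $\mathbb{N}_0=\{0,1,2,\dots\}$ and $\mathcal N_N:=\{0,1,\dots,N-1\}$. Vectors are bold and their components carry subscripts: $\boldsymbol a=(a_1,\dots,a_s)$, etc.; $w(\boldsymbol m+\boldsymbol a)$ is the vector with components $w(m_j+a_j)$, and $w$ is a single nonzero complex variable. $f^{(\boldsymbol n)}$ is the mixed partial derivative of order $n_j$ in the $j$-th variable. In the second sum, for each $\mathscr S$ the inner sum runs over all tuples $(n_j)_{j\in\mathscr S}\in\mathcal N_N^{\mathscr S}$; the product of operators $\prod_{j\in\mathscr S}\partial^{n_j}/\partial x_j^{n_j}$ is applied to $f$, then $x_j$ is set to $0$ for $j\in\mathscr S$, and one integrates over the remaining variables. The term for $\mathscr S=\emptyset$ is $\frac1{w^s}\int_{[0,\infty)^s}f(\boldsymbol x)\,dx_1\cdots dx_s$. A function $g$ in $s$ variables is of sufficient decay in $D$ if there exist $\varepsilon_1,\dots,\varepsilon_s>0$ such that $g(\boldsymbol x)\ll|x_1+1|^{-1-\varepsilon_1}\cdots|x_s+1|^{-1-\varepsilon_s}$ uniformly as $|x_1|+\cdots+|x_s|\to\infty$ in $D$ (the $\varepsilon_j$ may be different for different derivatives of $f$). The Bernoulli polynomials $B_n(x)$ are defined by $\sum_{n\ge0}B_n(x)\frac{t^n}{n!}=\frac{te^{tx}}{e^t-1}$.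
   Formalization: The error term is O_N(w^{N-s+1}) instead of O_N(w^N), which fails for s≥2; and if s≥2 and some a_j<0, the domain and the decay of f and its derivatives are also assumed on D_θ enlarged, in coordinates with a_j<0, by points z with -z in D_{θ_j} and |z|≤δ for some δ>0. *)

theory Defs
  imports
    "HOL-Analysis.Analysis"
    "HOL-Computational_Algebra.Formal_Power_Series"
    "HOL-Library.Landau_Symbols"
begin

definition sector :: "real \<Rightarrow> complex set" where
  "sector \<theta> = {of_real r * cis \<alpha> | r \<alpha>. 0 \<le> r \<and> \<bar>\<alpha>\<bar> \<le> \<theta>}"

definition sector_prod :: "real ^ 's \<Rightarrow> (complex ^ 's) set" where
  "sector_prod \<theta> = {x. \<forall>j. x $ j \<in> sector (\<theta> $ j)}"

text \<open>
  In the coordinates with a negative shift, the sample points \<open>w (m + a)\<close> leave the sector on the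
  opposite side of the origin, but only by a distance that tends to 0 with \<open>w\<close>. The set below
  enlarges the product of sectors by such points; it is \<open>sector_prod \<theta>\<close> if no
  component of \<open>a\<close> is negative.
\<close>
definition shifted_sector_prod :: "real ^ 's \<Rightarrow> real ^ 's \<Rightarrow> real \<Rightarrow> (complex ^ 's) set" where
  "shifted_sector_prod \<theta> a \<delta> =
     {x. \<forall>j. x $ j \<in> sector (\<theta> $ j) \<or>
             (a $ j < 0 \<and> - (x $ j) \<in> sector (\<theta> $ j) \<and> norm (x $ j) \<le> \<delta>)}"

text \<open>Complex Frechet differentiability: the real derivative exists and is complex linear.\<close>
definition holomorphic_several :: "(complex ^ 's \<Rightarrow> complex) \<Rightarrow> (complex ^ 's) set \<Rightarrow> bool" where
  "holomorphic_several f \<Omega> \<longleftrightarrow>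
     (\<forall>x\<in>\<Omega>. \<exists>L. (f has_derivative L) (at x) \<and> (\<forall>c v. L (c *s v) = c * L v))"

definition partial_deriv ::
    "'s \<Rightarrow> (complex ^ 's \<Rightarrow> complex) \<Rightarrow> complex ^ 's \<Rightarrow> complex" where
  "partial_deriv j g x = deriv (\<lambda>z. g (\<chi> i. if i = j then z else x $ i)) (x $ j)"

text \<open>
  The operator product over \<open>j \<in> S\<close> of \<open>(\<partial>/\<partial>x\<^sub>j)\<close> to the power \<open>n j\<close>, composed in increasing order of
  the indices. The order is immaterial where \<open>f\<close> is holomorphic. The mixed partial derivative of
  multi-order \<open>n\<close> is the case \<open>S = UNIV\<close>.
\<close>
definition mixed_deriv ::
    "('s::{finite,linorder}) set \<Rightarrow> ('s \<Rightarrow> nat) \<Rightarrow>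
      (complex ^ ('s::{finite,linorder}) \<Rightarrow> complex) \<Rightarrow> complex ^ ('s::{finite,linorder}) \<Rightarrow> complex" where
  "mixed_deriv S n f = foldr (\<lambda>j. partial_deriv j ^^ n j) (sorted_list_of_set S) f"

definition sufficient_decay :: "(complex ^ 's) set \<Rightarrow> (complex ^ 's \<Rightarrow> complex) \<Rightarrow> bool" where
  "sufficient_decay D g \<longleftrightarrow>
     (\<exists>\<epsilon> :: 's \<Rightarrow> real. (\<forall>j. \<epsilon> j > 0) \<and>
        (\<lambda>x. norm (g x)) \<in>
          O[inf (filtercomap (\<lambda>x. \<Sum>j\<in>UNIV. norm (x $ j)) at_top) (principal D)](
            \<lambda>x. \<Prod>j\<in>UNIV. norm (x $ j + 1) powr (- 1 - \<epsilon> j)))"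

text \<open>The coefficients of the generating function \<open>t exp (t x) / (exp t - 1)\<close>, a quotient of formal power
  series in \<open>t\<close>.\<close>
definition bernoulli_poly :: "nat \<Rightarrow> real \<Rightarrow> real" where
  "bernoulli_poly n x = fact n * fps_nth (fps_X * fps_exp x / (fps_exp 1 - 1)) n"

end

theory Submission
  imports Defs "HOL-Complex_Analysis.Complex_Analysis"
begin

no_notation fps_nth (infixl \<open>$\<close> 75)

text \<open>
  The sum over \<open>m\<close> is turned into integrals and boundary terms one coordinate at a time.

  In one variable, let \<open>\<Phi>\<close> be a primitive of \<open>f\<close> on the sector and \<open>\<beta>\<^sub>n = B\<^sub>n(a) / n!\<close>. Taylor's formula at
  \<open>w m\<close> expands \<open>w f(w (m + a))\<close> as well as the increments of \<open>\<Phi>, f, f', \<dots>\<close> from \<open>w m\<close> to \<open>w (m + 1)\<close>. The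
  generating function of the Bernoulli polynomials says that the combination of these increments
  with the coefficients \<open>\<beta>\<^sub>n w\<^sup>n\<close> has the same Taylor polynomial as \<open>w f(w (m + a))\<close>, for every real \<open>a\<close>
  (\<open>bernoulli_coeff_identity\<close>, \<open>euler_maclaurin_step\<close>). Summed over \<open>m\<close>, the increments telescope: those
  of the derivatives of \<open>f\<close> leave values at 0, and those of \<open>\<Phi>\<close> leave the limit of \<open>\<Phi> - \<Phi>(0)\<close> along the ray
  through \<open>w\<close>. By the decay of \<open>f\<close> this limit is the same along every ray of the sector, so it
  gives the integral over the positive real axis (\<open>primitive_limit_along_ray\<close>). The Taylor errors
  of order \<open>w\<^sup>N\<^sup>+\<^sup>2\<close>, weighted with the decay of \<open>f\<close>, sum up to order \<open>w\<^sup>N\<^sup>+\<^sup>1\<close>; division by \<open>w\<close> gives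
  \<open>euler_maclaurin_ray\<close>, in which the constant depends on \<open>f\<close> only through the decay bound.

  In several variables, let \<open>A\<close> be the set of coordinates already treated. Each of them has either
  been replaced by an integral or, for the coordinates in a subset \<open>S\<close> of \<open>A\<close>, by a derivative at 0;
  the coordinates outside \<open>A\<close> are still summed. A sum is an integral with respect to the counting
  measure, so such a mixture is one integral with respect to a product measure (\<open>mixed_measure\<close>), and
  Fubini's theorem isolates the next coordinate \<open>k\<close>, to which the one-variable theorem applies
  uniformly in the other coordinates (\<open>replace_coordinate\<close>). The error is \<open>O(w\<^sup>N)\<close> times a factor of at
  most \<open>1 / \<bar>w\<bar>\<close> for each of the other coordinates, coming from the sum over that
  coordinate or from the \<open>1 / w\<close> in front of its integral. This explains the exponent \<open>N - s + 1\<close>. The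
  coordinates are treated in decreasing order, so that every new derivative is applied after the
  ones already there, which is the order of composition in \<open>mixed_deriv\<close>; thus partial derivatives
  never have to be interchanged.
\<close>

section \<open>Bernoulli coefficients\<close>

definition bernoulli_coeff :: "nat \<Rightarrow> real \<Rightarrow> real" where
  "bernoulli_coeff n a = bernoulli_poly n a / fact n"

lemma bernoulli_coeff_fps:
  "fps_nth (fps_X * fps_exp a / (fps_exp 1 - 1)) n = bernoulli_coeff n a"
  by (simp add: bernoulli_coeff_def bernoulli_poly_def)

text \<open>
  The quotient in the definition of the Bernoulli polynomials is a division of formal power series
  by a non-unit. It is exact since both \<open>exp t - 1\<close> and \<open>t exp(a t)\<close> have order 1.
\<close>
lemma bernoulli_generating_function:
  "(fps_X * fps_exp a / (fps_exp 1 - 1)) * (fps_exp 1 - 1) = fps_X * fps_exp (a :: real)"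
proof -
  have nz: "fps_exp 1 - (1 :: real fps) \<noteq> 0"
  proof
    assume "fps_exp 1 - (1 :: real fps) = 0"
    then have "fps_nth (fps_exp 1 - (1 :: real fps)) 1 = 0" by simp
    then show False by simp
  qed
  have "subdegree (fps_exp 1 - (1 :: real fps)) = 1"
    by (rule subdegreeI) auto
  moreover have "1 \<le> subdegree (fps_X * fps_exp a)"
    by (rule subdegree_geI) (auto simp: fps_eq_iff intro: exI[of _ 1])
  moreover have "fps_X * fps_exp a \<noteq> 0"
    by (auto simp: fps_eq_iff intro: exI[of _ 1])
  ultimately have "(fps_exp 1 - (1 :: real fps)) dvd fps_X * fps_exp a"
    using nz by (simp add: fps_dvd_iff)
  then show ?thesis
    by simp
qed

text \<open>
  Comparison of the coefficients of \<open>t\<close> to the power \<open>p + 1\<close> in the generating function. In the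
  application \<open>a\<close> to the power \<open>p\<close> over \<open>p!\<close> comes from Taylor's formula at the point \<open>a\<close>, and
  \<open>1 / (p + 1 - i)!\<close> from an increment over a unit interval.
\<close>
lemma bernoulli_coeff_identity:
  "(\<Sum>i\<le>p. bernoulli_coeff i a / fact (Suc p - i)) = a ^ p / fact p"
proof -
  define Q where "Q = fps_X * fps_exp a / (fps_exp 1 - 1)"
  have "fps_nth (Q * (fps_exp 1 - 1)) (Suc p) = fps_nth (fps_X * fps_exp a) (Suc p)"
    using bernoulli_generating_function[of a] by (simp add: Q_def)
  moreover have "fps_nth (Q * (fps_exp 1 - 1)) (Suc p)
      = (\<Sum>i\<le>p. bernoulli_coeff i a / fact (Suc p - i))"
  proof -
    have "fps_nth (Q * (fps_exp 1 - 1)) (Suc p)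
        = (\<Sum>i=0..Suc p. fps_nth Q i * fps_nth (fps_exp 1 - 1) (Suc p - i))"
      by (simp add: fps_mult_nth)
    also have "\<dots> = (\<Sum>i=0..p. fps_nth Q i * fps_nth (fps_exp 1 - 1) (Suc p - i))"
      by simp
    also have "\<dots> = (\<Sum>i\<le>p. bernoulli_coeff i a / fact (Suc p - i))"
      unfolding atLeast0AtMost
      by (intro sum.cong refl) (auto simp: Q_def bernoulli_coeff_fps Suc_diff_le simp del: fact_Suc)
    finally show ?thesis .
  qed
  ultimately show ?thesis by simp
qed

lemma bernoulli_coeff_0: "bernoulli_coeff 0 a = 1"
  using bernoulli_coeff_identity[of a 0] by simp

section \<open>Sectors\<close>

text \<open>
  The half-plane description makes convexity and closedness evident. For \<open>\<theta> = 0\<close> it is the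
  condition \<open>0 \<le> Re z\<close> that excludes the negative real axis.
\<close>
lemma sector_iff:
  assumes "0 \<le> \<theta>" "\<theta> < pi / 2"
  shows "z \<in> sector \<theta> \<longleftrightarrow> 0 \<le> Re z \<and> \<bar>Im z\<bar> \<le> tan \<theta> * Re z"
proof
  assume "z \<in> sector \<theta>"
  then obtain r \<alpha> where z: "z = of_real r * cis \<alpha>" "0 \<le> r" "\<bar>\<alpha>\<bar> \<le> \<theta>"
    by (auto simp: sector_def)
  have ca: "0 < cos \<alpha>" using z assms by (intro cos_gt_zero_pi) auto
  have "\<bar>sin \<alpha>\<bar> = \<bar>tan \<alpha>\<bar> * cos \<alpha>" using ca by (simp add: tan_def abs_mult)
  also have "\<bar>tan \<alpha>\<bar> \<le> tan \<theta>"
  proof -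
    have "tan \<alpha> \<le> tan \<theta>" "tan (-\<alpha>) \<le> tan \<theta>"
      using z assms by (auto intro!: tan_mono_le simp del: tan_minus)
    then show ?thesis by simp
  qed
  finally have "\<bar>sin \<alpha>\<bar> \<le> tan \<theta> * cos \<alpha>" using ca by simp
  then have "r * \<bar>sin \<alpha>\<bar> \<le> r * (tan \<theta> * cos \<alpha>)" using z by (intro mult_left_mono) auto
  then show "0 \<le> Re z \<and> \<bar>Im z\<bar> \<le> tan \<theta> * Re z"
    using z ca by (auto simp: abs_mult algebra_simps)
next
  assume *: "0 \<le> Re z \<and> \<bar>Im z\<bar> \<le> tan \<theta> * Re z"
  show "z \<in> sector \<theta>"
  proof (cases "Re z = 0")
    case True
    then have "z = 0" using * by (simp add: complex_eq_iff)
    then show ?thesis using assms unfolding sector_def by (intro CollectI exI[of _ 0]) auto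
  next
    case False
    define \<alpha> where "\<alpha> = arctan (Im z / Re z)"
    have "\<bar>Im z / Re z\<bar> \<le> tan \<theta>" using * False by (simp add: abs_divide divide_le_eq)
    then have "Im z / Re z \<le> tan \<theta>" "tan (-\<theta>) \<le> Im z / Re z"
      unfolding tan_minus by linarith+
    then have "\<alpha> \<le> arctan (tan \<theta>)" "arctan (tan (-\<theta>)) \<le> \<alpha>"
      unfolding \<alpha>_def by (simp_all only: arctan_le_iff)
    then have a: "\<bar>\<alpha>\<bar> \<le> \<theta>" using assms by (simp add: arctan_tan arctan_minus)
    have ca: "0 < cos \<alpha>" using a assms by (intro cos_gt_zero_pi) auto
    have "sin \<alpha> = Im z / Re z * cos \<alpha>"
      using ca tan_arctan[of "Im z / Re z"] by (simp add: \<alpha>_def[symmetric] tan_def field_simps)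
    then have "z = of_real (Re z / cos \<alpha>) * cis \<alpha>"
      using ca False by (simp add: complex_eq_iff)
    then show ?thesis using a * ca unfolding sector_def
      by (intro CollectI exI[of _ "Re z / cos \<alpha>"] exI[of _ \<alpha>]) auto
  qed
qed

lemma zero_in_sector: "0 \<le> \<theta> \<Longrightarrow> 0 \<in> sector \<theta>"
  unfolding sector_def by (intro CollectI exI[of _ 0]) auto

lemma of_real_in_sector: "0 \<le> \<theta> \<Longrightarrow> 0 \<le> r \<Longrightarrow> of_real r \<in> sector \<theta>"
  unfolding sector_def by (intro CollectI exI[of _ r] exI[of _ 0]) auto

lemma scaled_in_sector:
  assumes "z \<in> sector \<theta>" "0 \<le> t" shows "z * of_real t \<in> sector \<theta>"
proof -
  obtain r \<alpha> where "z = of_real r * cis \<alpha>" "0 \<le> r" "\<bar>\<alpha>\<bar> \<le> \<theta>"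
    using assms by (auto simp: sector_def)
  then show ?thesis using assms unfolding sector_def
    by (intro CollectI exI[of _ "r * t"] exI[of _ \<alpha>]) auto
qed

lemma convex_sector:
  assumes "0 \<le> \<theta>" "\<theta> < pi / 2" shows "convex (sector \<theta>)"
proof (rule convexI)
  fix x y :: complex and u v :: real
  assume *: "x \<in> sector \<theta>" "y \<in> sector \<theta>" "0 \<le> u" "0 \<le> v" "u + v = 1"
  have x: "0 \<le> Re x" "\<bar>Im x\<bar> \<le> tan \<theta> * Re x" and y: "0 \<le> Re y" "\<bar>Im y\<bar> \<le> tan \<theta> * Re y"
    using * assms by (auto simp: sector_iff)
  have "\<bar>u * Im x + v * Im y\<bar> \<le> u * \<bar>Im x\<bar> + v * \<bar>Im y\<bar>"
    using * abs_triangle_ineq[of "u * Im x" "v * Im y"] by (simp add: abs_mult)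
  also have "\<dots> \<le> u * (tan \<theta> * Re x) + v * (tan \<theta> * Re y)"
    using * x y by (intro add_mono mult_left_mono) auto
  finally show "u *\<^sub>R x + v *\<^sub>R y \<in> sector \<theta>"
    using * assms x y by (simp add: sector_iff algebra_simps)
qed

lemma closed_sector:
  assumes "0 \<le> \<theta>" "\<theta> < pi / 2" shows "closed (sector \<theta>)"
proof -
  have "sector \<theta> = {z. 0 \<le> Re z} \<inter> {z. \<bar>Im z\<bar> \<le> tan \<theta> * Re z}"
    using assms by (auto simp: sector_iff)
  also have "closed \<dots>"
    by (intro closed_Int closed_Collect_le continuous_intros)
  finally show ?thesis .
qed

lemma norm_le_sector:
  assumes "0 \<le> \<theta>" "\<theta> < pi / 2" "z \<in> sector \<theta>"
  shows "norm z * cos \<theta> \<le> Re z"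
proof -
  obtain r \<alpha> where z: "z = of_real r * cis \<alpha>" "0 \<le> r" "\<bar>\<alpha>\<bar> \<le> \<theta>"
    using assms by (auto simp: sector_def)
  have "cos \<theta> \<le> cos \<bar>\<alpha>\<bar>" using z assms by (intro cos_monotone_0_pi_le) auto
  then have "r * cos \<theta> \<le> r * cos \<alpha>" using z by (intro mult_left_mono) auto
  then show ?thesis using z by (simp add: norm_mult)
qed

section \<open>A summable weight\<close>

text \<open>
  A weight in terms of \<open>\<bar>x\<bar>\<close> instead of \<open>\<bar>x + 1\<bar>\<close>: it is antitone in the modulus, so it can be compared
  along segments and rays, and it is positive everywhere, whereas \<open>\<bar>x + 1\<bar>\<close> vanishes at \<open>-1\<close>.
\<close>
definition weight :: "real \<Rightarrow> real \<Rightarrow> real" where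
  "weight \<epsilon> t = (1 + t) powr (- 1 - \<epsilon>)"

lemma weight_pos: "0 \<le> t \<Longrightarrow> 0 < weight \<epsilon> t"
  by (simp add: weight_def)

lemma weight_mono_exponent: "0 \<le> t \<Longrightarrow> \<epsilon> \<le> \<epsilon>' \<Longrightarrow> weight \<epsilon>' t \<le> weight \<epsilon> t"
  unfolding weight_def by (intro powr_mono) auto

lemma weight_quotient:
  assumes "0 < \<epsilon>" "1 \<le> c" "0 \<le> s" "0 \<le> t" "1 + t \<le> c * (1 + s)"
  shows "weight \<epsilon> s \<le> c powr (1 + \<epsilon>) * weight \<epsilon> t"
proof -
  have "c powr (- 1 - \<epsilon>) * weight \<epsilon> s = (c * (1 + s)) powr (- 1 - \<epsilon>)"
    using assms by (simp add: weight_def powr_mult)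
  also have "\<dots> \<le> weight \<epsilon> t"
    using assms unfolding weight_def by (intro powr_mono2') auto
  finally have "c powr (1 + \<epsilon>) * (c powr (- 1 - \<epsilon>) * weight \<epsilon> s) \<le> c powr (1 + \<epsilon>) * weight \<epsilon> t"
    by (intro mult_left_mono) auto
  moreover have "c powr (1 + \<epsilon>) * c powr (- 1 - \<epsilon>) = 1"
    using assms by (simp flip: powr_add)
  ultimately show ?thesis by (simp add: mult.assoc[symmetric])
qed

text \<open>
  The weights at points that are a bounded number of steps apart are comparable uniformly in the
  step length \<open>u \<le> 1\<close>. This keeps all constants below independent of \<open>w\<close>.
\<close>
lemma weight_shift:
  assumes "0 < \<epsilon>" "0 \<le> u" "u \<le> 1" "0 \<le> t" "0 \<le> c" "\<bar>s - t\<bar> \<le> c"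
  shows "weight \<epsilon> (u * \<bar>s\<bar>) \<le> (1 + c) powr (1 + \<epsilon>) * weight \<epsilon> (u * t)"
proof (rule weight_quotient)
  have "u * t \<le> u * (c + \<bar>s\<bar>)" using assms by (intro mult_left_mono) auto
  also have "\<dots> \<le> c + u * \<bar>s\<bar>" using mult_right_mono[of u 1 c] assms by (simp add: algebra_simps)
  finally have "u * t \<le> c + u * \<bar>s\<bar>" .
  moreover have "0 \<le> c * (u * \<bar>s\<bar>)" using assms by simp
  ultimately show "1 + u * t \<le> (1 + c) * (1 + u * \<bar>s\<bar>)" by (simp add: algebra_simps)
qed (use assms in auto)

lemma weight_primitive:
  assumes "0 < \<epsilon>" "0 < u" "0 \<le> t"
  shows "((\<lambda>t. - ((1 + u * t) powr (-\<epsilon>)) / (\<epsilon> * u)) has_real_derivative weight \<epsilon> (u * t)) (at t)"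
proof -
  have "(1 + u * t) powr (-\<epsilon> - 1) = weight \<epsilon> (u * t)"
    unfolding weight_def by (rule arg_cong[of _ _ "\<lambda>x. _ powr x"]) simp
  then show ?thesis using assms
    by (auto intro!: derivative_eq_intros add_pos_nonneg simp: field_simps)
qed

lemma weight_integral:
  assumes "0 < \<epsilon>" "0 < u" 
  shows "set_integrable lborel {0..} (\<lambda>t. weight \<epsilon> (u * t))"
    "(LINT t:{0..}|lborel. weight \<epsilon> (u * t)) = 1 / (\<epsilon> * u)"
proof -
  define F where "F = (\<lambda>t. - ((1 + u * t) powr (-\<epsilon>)) / (\<epsilon> * u))"
  have D: "(F has_real_derivative weight \<epsilon> (u * t)) (at t)" if "0 \<le> t" for t
    unfolding F_def using that assms by (intro weight_primitive)
  have L: "(F \<longlongrightarrow> 0) at_top"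
  proof -
    have "filterlim (\<lambda>t. 1 + u * t) at_top at_top"
      using assms by (intro filterlim_tendsto_add_at_top[OF tendsto_const]
          filterlim_tendsto_pos_mult_at_top[OF tendsto_const] filterlim_ident) auto
    then have "((\<lambda>t. (1 + u * t) powr (-\<epsilon>)) \<longlongrightarrow> 0) at_top"
      using assms by (intro tendsto_neg_powr) auto
    from tendsto_divide[OF tendsto_minus[OF this] tendsto_const, of "\<epsilon> * u"] show ?thesis
      using assms by (simp add: F_def)
  qed
  have "(\<integral>\<^sup>+t. ennreal (weight \<epsilon> (u * t)) * indicator {0..} t \<partial>lborel) = ennreal (0 - F 0)"
    using D L assms by (intro nn_integral_FTC_atLeast) (auto simp: weight_def intro!: measurable)
  then have "has_bochner_integral lborel (\<lambda>t. indicator {0..} t *\<^sub>R weight \<epsilon> (u * t)) (0 - F 0)"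
    using assms
    by (intro has_bochner_integral_nn_integral)
      (auto simp: weight_def F_def mult.commute intro!: nn_integral_cong split: split_indicator elim!: trans[rotated])
  then show "set_integrable lborel {0..} (\<lambda>t. weight \<epsilon> (u * t))"
    "(LINT t:{0..}|lborel. weight \<epsilon> (u * t)) = 1 / (\<epsilon> * u)"
    by (auto simp: set_integrable_def set_lebesgue_integral_def has_bochner_integral_iff F_def)
qed

lemma weight_antimono: "0 \<le> s \<Longrightarrow> s \<le> t \<Longrightarrow> 0 < \<epsilon> \<Longrightarrow> weight \<epsilon> t \<le> weight \<epsilon> s"
  unfolding weight_def by (intro powr_mono2') auto

text \<open>
  The integral test, with the primitive of \<open>weight_primitive\<close>. Summation costs a factor of order \<open>1 / u\<close>.
\<close>
lemma weight_sum:
  assumes "0 < \<epsilon>" "0 < u" 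
  shows "summable (\<lambda>m. weight \<epsilon> (u * real m))"
    "(\<Sum>m. weight \<epsilon> (u * real m)) \<le> 1 + 1 / (\<epsilon> * u)"
proof -
  define F where "F = (\<lambda>t. - ((1 + u * t) powr (-\<epsilon>)) / (\<epsilon> * u))"
  have D: "(F has_real_derivative weight \<epsilon> (u * t)) (at t)" if "0 \<le> t" for t
    unfolding F_def using that assms by (intro weight_primitive)
  have step: "weight \<epsilon> (u * real (Suc m)) \<le> F (real (Suc m)) - F (real m)" for m
  proof -
    obtain z where z: "real m < z" "z < real (Suc m)"
      "F (real (Suc m)) - F (real m) = (real (Suc m) - real m) * weight \<epsilon> (u * z)"
      using MVT2[of "real m" "real (Suc m)" F "\<lambda>t. weight \<epsilon> (u * t)"] D by auto
    have "weight \<epsilon> (u * real (Suc m)) \<le> weight \<epsilon> (u * z)"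
      using z assms by (intro weight_antimono mult_left_mono mult_nonneg_nonneg) auto
    then show ?thesis using z by simp
  qed
  have part: "(\<Sum>m<n. weight \<epsilon> (u * real m)) \<le> 1 + 1 / (\<epsilon> * u)" for n
  proof (cases n)
    case (Suc k)
    have "(\<Sum>m<k. weight \<epsilon> (u * real (Suc m))) \<le> (\<Sum>m<k. F (real (Suc m)) - F (real m))"
      by (intro sum_mono step)
    also have "\<dots> = F (real k) - F 0" using sum_lessThan_telescope[of "\<lambda>m. F (real m)" k] by simp
    also have "\<dots> \<le> 1 / (\<epsilon> * u)" using assms by (simp add: F_def divide_right_mono)
    finally show ?thesis unfolding Suc sum.lessThan_Suc_shift by (simp add: weight_def)
  qed (use assms in auto)
  show s: "summable (\<lambda>m. weight \<epsilon> (u * real m))"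
    using assms part by (intro summableI_nonneg_bounded[where x = "1 + 1 / (\<epsilon> * u)"] less_imp_le[OF weight_pos]) auto
  show "(\<Sum>m. weight \<epsilon> (u * real m)) \<le> 1 + 1 / (\<epsilon> * u)"
    using part s by (intro suminf_le_const) auto
qed

section \<open>Euler-Maclaurin summation along a ray\<close>

definition remainder_const :: "real \<Rightarrow> nat \<Rightarrow> real" where
  "remainder_const a N = \<bar>a\<bar> ^ Suc N / fact N + (\<Sum>n\<le>Suc N. \<bar>bernoulli_coeff n a\<bar> / fact (Suc N - n))"

lemma remainder_const_nonneg: "0 \<le> remainder_const a N"
  unfolding remainder_const_def by (intro add_nonneg_nonneg sum_nonneg) auto

text \<open>
  One unit interval. The sequence \<open>g\<close> stands for \<open>\<Phi>, f, f', \<dots>\<close>. By \<open>bernoulli_coeff_identity\<close> the Taylor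
  polynomials of both sides agree, so only Taylor remainders of \<open>g 1\<close> at \<open>z + w a\<close> and of \<open>g n\<close>
  at \<open>z + w\<close> are left. The primitive \<open>g 0\<close> is used on the segment to \<open>z + w\<close> only: for negative \<open>a\<close>
  the segment to \<open>z + w a\<close> may leave the sector, where no primitive has been chosen.
\<close>
lemma euler_maclaurin_step:
  fixes g :: "nat \<Rightarrow> complex \<Rightarrow> complex" and z w :: complex and a :: real
  defines "I \<equiv> closed_segment z (z + w)" and "J \<equiv> closed_segment z (z + w * of_real a)"
  assumes I: "\<And>n x. n \<le> Suc N \<Longrightarrow> x \<in> I \<Longrightarrow> (g n has_field_derivative g (Suc n) x) (at x within I)"
    and J: "\<And>n x. n \<le> N \<Longrightarrow> x \<in> J \<Longrightarrow> (g (Suc n) has_field_derivative g (Suc (Suc n)) x) (at x within J)"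
    and B: "\<And>x. x \<in> I \<union> J \<Longrightarrow> norm (g (Suc (Suc N)) x) \<le> B"
  shows "norm (w * g 1 (z + w * of_real a)
      - (\<Sum>n\<le>Suc N. of_real (bernoulli_coeff n a) * w ^ n * (g n (z + w) - g n z)))
    \<le> remainder_const a N * (B * norm w ^ (N + 2))"
proof -
  define \<beta> where "\<beta> = (\<lambda>n. complex_of_real (bernoulli_coeff n a))"
  define r where "r = (\<lambda>n. g n (z + w) - (\<Sum>i\<le>Suc N - n. g (n + i) z * w ^ i / fact i))"
  define q where "q = g 1 (z + w * of_real a) - (\<Sum>i\<le>N. g (Suc i) z * (w * of_real a) ^ i / fact i)"
  have r: "norm (r n) \<le> B * norm w ^ Suc (Suc N - n) / fact (Suc N - n)" if "n \<le> Suc N" for n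
    using complex_Taylor[of I "Suc N - n" "\<lambda>i. g (n + i)" B z "z + w"] I B that
    by (auto simp: I_def r_def)
  have q: "norm q \<le> B * norm (w * of_real a) ^ Suc N / fact N"
    using complex_Taylor[of J "N" "\<lambda>i. g (Suc i)" B z "z + w * of_real a"] J B
    by (auto simp: J_def q_def)
  have main: "(\<Sum>n\<le>Suc N. \<beta> n * w ^ n * ((\<Sum>i\<le>Suc N - n. g (n + i) z * w ^ i / fact i) - g n z))
      = w * (\<Sum>i\<le>N. g (Suc i) z * (w * of_real a) ^ i / fact i)"
  proof -
    define h where "h = (\<lambda>n i. \<beta> n * w ^ (n + i) * g (n + i) z * (if i = 0 then 0 else 1 / fact i))"
    \<comment> \<open>Collect the terms with the same derivative \<open>g (n + i)\<close>; the factor 0 for \<open>i = 0\<close> accounts for the subtracted \<open>g n z\<close>.\<close>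
    have "(\<Sum>n\<le>Suc N. \<beta> n * w ^ n * ((\<Sum>i\<le>Suc N - n. g (n + i) z * w ^ i / fact i) - g n z))
        = (\<Sum>n\<le>Suc N. \<Sum>i\<le>Suc N - n. h n i)"
    proof (intro sum.cong refl)
      fix n
      have "(\<Sum>i\<le>Suc N - n. h n i) = (\<Sum>i<Suc N - n. h n (Suc i))"
        unfolding sum.atMost_shift by (simp add: h_def)
      moreover have "(\<Sum>i\<le>Suc N - n. g (n + i) z * w ^ i / fact i) - g n z
          = (\<Sum>i<Suc N - n. g (n + Suc i) z * w ^ Suc i / fact (Suc i))"
        unfolding sum.atMost_shift by simp
      ultimately show "\<beta> n * w ^ n * ((\<Sum>i\<le>Suc N - n. g (n + i) z * w ^ i / fact i) - g n z)
          = (\<Sum>i\<le>Suc N - n. h n i)"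
        by (simp add: h_def sum_distrib_left power_add mult_ac)
    qed
    also have "\<dots> = (\<Sum>(n, i)\<in>{(i, j). i + j \<le> Suc N}. h n i)"
      by (subst sum.Sigma) (auto intro!: sum.cong)
    also have "\<dots> = (\<Sum>k\<le>Suc N. \<Sum>n\<le>k. h n (k - n))"
      by (rule sum.triangle_reindex_eq)
    also have "\<dots> = (\<Sum>k\<le>N. \<Sum>n\<le>Suc k. h n (Suc k - n))"
      unfolding sum.atMost_Suc_shift[of _ N] by (simp add: h_def)
    also have "\<dots> = (\<Sum>k\<le>N. w ^ Suc k * g (Suc k) z * (\<Sum>n\<le>k. \<beta> n / fact (Suc k - n)))"
      by (intro sum.cong refl) (auto simp: h_def sum_distrib_left mult_ac Suc_diff_le intro!: sum.cong)
    also have "\<dots> = (\<Sum>k\<le>N. w ^ Suc k * g (Suc k) z * (of_real a ^ k / fact k))"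
    proof (intro sum.cong refl arg_cong2[of _ _ _ _ "(*)"])
      fix k
      show "(\<Sum>n\<le>k. \<beta> n / fact (Suc k - n)) = complex_of_real a ^ k / fact k"
        using arg_cong[OF bernoulli_coeff_identity[of a k], of complex_of_real]
        by (simp add: \<beta>_def del: fact_Suc)
    qed
    also have "\<dots> = w * (\<Sum>i\<le>N. g (Suc i) z * (w * of_real a) ^ i / fact i)"
      by (simp add: sum_distrib_left power_mult_distrib mult_ac)
    finally show ?thesis .
  qed
  have "w * g 1 (z + w * of_real a) - (\<Sum>n\<le>Suc N. \<beta> n * w ^ n * (g n (z + w) - g n z))
      = w * q - (\<Sum>n\<le>Suc N. \<beta> n * w ^ n * r n)"
  proof -
    have "(\<Sum>n\<le>Suc N. \<beta> n * w ^ n * (g n (z + w) - g n z))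
        = (\<Sum>n\<le>Suc N. \<beta> n * w ^ n * r n) + w * (\<Sum>i\<le>N. g (Suc i) z * (w * of_real a) ^ i / fact i)"
      unfolding main[symmetric] sum.distrib[symmetric] r_def by (intro sum.cong refl) (simp add: algebra_simps)
    then show ?thesis by (simp add: q_def algebra_simps)
  qed
  also have "norm \<dots> \<le> norm (w * q) + (\<Sum>n\<le>Suc N. norm (\<beta> n * w ^ n * r n))"
    by (intro norm_triangle_le_diff add_mono norm_sum order_refl)
  also have "norm (w * q) \<le> \<bar>a\<bar> ^ Suc N / fact N * (B * norm w ^ (N + 2))"
    using mult_left_mono[OF q, of "norm w"] by (simp add: norm_mult power_mult_distrib mult_ac)
  also have "(\<Sum>n\<le>Suc N. norm (\<beta> n * w ^ n * r n))
      \<le> (\<Sum>n\<le>Suc N. \<bar>bernoulli_coeff n a\<bar> / fact (Suc N - n) * (B * norm w ^ (N + 2)))"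
  proof (intro sum_mono)
    fix n assume "n \<in> {..Suc N}"
    then have n: "n \<le> Suc N" by simp
    have "norm (\<beta> n * w ^ n * r n) \<le> \<bar>bernoulli_coeff n a\<bar> * norm w ^ n * (B * norm w ^ Suc (Suc N - n) / fact (Suc N - n))"
      unfolding norm_mult norm_power using r[OF n] by (intro mult_mono) (auto simp: \<beta>_def)
    also have "\<dots> = \<bar>bernoulli_coeff n a\<bar> / fact (Suc N - n) * (B * (norm w ^ n * norm w ^ Suc (Suc N - n)))"
      by (simp add: mult_ac)
    also have "norm w ^ n * norm w ^ Suc (Suc N - n) = norm w ^ (N + 2)"
      using n by (subst power_add[symmetric]) simp
    finally show "norm (\<beta> n * w ^ n * r n) \<le> \<bar>bernoulli_coeff n a\<bar> / fact (Suc N - n) * (B * norm w ^ (N + 2))" .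
  qed
  finally show ?thesis
    unfolding remainder_const_def \<beta>_def by (simp add: distrib_right sum_distrib_right del: sum.atMost_Suc fact_Suc)
qed

text \<open>
  Rotation of the path of integration, without contour integrals. A primitive \<open>F\<close> differs between the
  points \<open>w m\<close> and \<open>Re w * m\<close> by at most the length of the vertical segment between them, which is
  of order \<open>m\<close>, times the bound for \<open>f\<close> on it, which is of order \<open>m\<close> to the power \<open>-1 - \<epsilon>\<close>. On the
  real axis the limit of \<open>F\<close> is given by the fundamental theorem of calculus.
\<close>
lemma primitive_limit_along_ray:
  fixes f F :: "complex \<Rightarrow> complex"
  assumes \<theta>: "0 \<le> \<theta>" "\<theta> < pi / 2" and w: "w \<in> sector \<theta>" "w \<noteq> 0" and "0 < \<epsilon>"
    and cont: "continuous_on (sector \<theta>) f"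
    and F: "\<And>z. z \<in> sector \<theta> \<Longrightarrow> (F has_field_derivative f z) (at z within sector \<theta>)"
    and bound: "\<And>z. z \<in> sector \<theta> \<Longrightarrow> norm (f z) \<le> K * weight \<epsilon> (norm z)"
  shows "set_integrable lborel {0..} (\<lambda>t. f (of_real t))"
    and "(\<lambda>m. F (w * of_nat m)) \<longlonglongrightarrow> F 0 + (LINT t:{0..}|lborel. f (of_real t))"
proof -
  have K: "0 \<le> K" using bound[OF zero_in_sector] \<theta> by (auto simp: weight_def intro: order_trans[OF norm_ge_zero])
  have cont': "continuous_on {0..} (\<lambda>t. f (of_real t))"
    by (rule continuous_on_compose2[OF cont]) (auto intro!: continuous_intros of_real_in_sector \<theta>)
  have sub: "set_integrable lborel {0..} (\<lambda>t. K * weight \<epsilon> (1 * t))"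
    using \<open>0 < \<epsilon>\<close> by (intro set_integrable_mult_right weight_integral) auto
  show int: "set_integrable lborel {0..} (\<lambda>t. f (of_real t))"
  proof (rule set_integrable_bound[OF sub])
    show "set_borel_measurable lborel {0..} (\<lambda>t. f (of_real t))"
      unfolding set_borel_measurable_def measurable_lborel2
      by (intro borel_measurable_continuous_on_indicator cont') auto
    show "AE x in lborel. x \<in> {0..} \<longrightarrow> norm (f (of_real x)) \<le> norm (K * weight \<epsilon> (1 * x))"
    proof (intro always_eventually allI impI)
      fix x :: real assume "x \<in> {0..}"
      then show "norm (f (of_real x)) \<le> norm (K * weight \<epsilon> (1 * x))"
        using bound[OF of_real_in_sector[OF \<theta>(1)], of x] K weight_pos[of x \<epsilon>] by (simp add: abs_mult)
    qed
  qed
  have Re_pos: "0 < Re w"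
  proof -
    have "norm w * cos \<theta> \<le> Re w" using norm_le_sector \<theta> w by auto
    moreover have "0 < norm w * cos \<theta>" using \<theta> w by (intro mult_pos_pos cos_gt_zero_pi) auto
    ultimately show ?thesis by simp
  qed
  have ftc: "F (of_real T) = F 0 + (LINT t:{0..T}|lborel. f (of_real t))" if "0 \<le> T" for T
  proof -
    have "((\<lambda>t. f (of_real t)) has_integral (F (of_real T) - F (of_real 0))) {0..T}"
    proof (rule fundamental_theorem_of_calculus)
      fix t assume t: "t \<in> {0..T}"
      have "((F \<circ> of_real) has_vector_derivative 1 * f (of_real t)) (at t within {0..T})"
      proof (rule field_vector_diff_chain_within)
        show "(complex_of_real has_vector_derivative 1) (at t within {0..T})"
          by (auto intro!: derivative_eq_intros has_vector_derivative_of_real)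
        show "(F has_field_derivative f (of_real t)) (at (of_real t) within complex_of_real ` {0..T})"
          using t by (intro DERIV_subset[OF F]) (auto intro!: of_real_in_sector \<theta>)
      qed
      then show "((\<lambda>t. F (of_real t)) has_vector_derivative f (of_real t)) (at t within {0..T})"
        by (simp add: o_def)
    qed (use that in auto)
    moreover have "set_integrable lborel {0..T} (\<lambda>t. f (of_real t))"
      by (rule set_integrable_subset[OF int]) auto
    ultimately show ?thesis by (simp add: set_borel_integral_eq_integral integral_unique)
  qed
  have "((\<lambda>T. LINT t:{0..T}|lborel. f (of_real t)) \<longlongrightarrow> (LINT t:{0..}|lborel. f (of_real t))) at_top"
    by (rule tendsto_set_lebesgue_integral_at_top[OF _ int]) auto
  moreover have "filterlim (\<lambda>m. Re w * real m) at_top sequentially"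
    by (intro filterlim_tendsto_pos_mult_at_top[OF tendsto_const] Re_pos filterlim_real_sequentially)
  ultimately have "(\<lambda>m. LINT t:{0..Re w * real m}|lborel. f (of_real t)) \<longlonglongrightarrow> (LINT t:{0..}|lborel. f (of_real t))"
    by (rule filterlim_compose)
  from tendsto_add[OF tendsto_const[of "F 0"] this]
  have lim: "(\<lambda>m. F (of_real (Re w * real m))) \<longlonglongrightarrow> F 0 + (LINT t:{0..}|lborel. f (of_real t))"
    using Re_pos by (subst ftc) auto
  have bd: "norm (F (w * of_nat m) - F (of_real (Re w * real m)))
      \<le> K * norm w / Re w * (1 + Re w * real m) powr (-\<epsilon>)" for m
  proof -
    define x y where "x = complex_of_real (Re w * real m)" and "y = w * of_nat m"
    have mem: "x \<in> sector \<theta>" "y \<in> sector \<theta>"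
      using w Re_pos \<theta> scaled_in_sector[of w \<theta> "real m"] by (auto simp: x_def y_def intro!: of_real_in_sector simp del: of_real_mult)
    then have sub: "closed_segment x y \<subseteq> sector \<theta>"
      using convex_sector[OF \<theta>] by (simp add: closed_segment_subset)
    have "norm (F y - F x) \<le> (K * weight \<epsilon> (Re w * real m)) * norm (y - x)"
    proof (rule field_differentiable_bound[of "closed_segment x y" F f])
      fix z assume z: "z \<in> closed_segment x y"
      show "(F has_field_derivative f z) (at z within closed_segment x y)"
        using z sub by (intro DERIV_subset[OF F]) auto
      from z obtain u where "z = (1 - u) *\<^sub>R x + u *\<^sub>R y" by (auto simp: in_segment)
      then have "Re z = (1 - u) * (Re w * real m) + u * (Re w * real m)" by (simp add: x_def y_def)
      then have "Re z = Re w * real m" by (simp add: algebra_simps)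
      then have "Re w * real m \<le> norm z" using complex_Re_le_cmod[of z] by simp
      then have "weight \<epsilon> (norm z) \<le> weight \<epsilon> (Re w * real m)"
        using Re_pos \<open>0 < \<epsilon>\<close> by (intro weight_antimono) auto
      then show "norm (f z) \<le> K * weight \<epsilon> (Re w * real m)"
        using bound[of z] sub z K by (auto intro: order_trans mult_left_mono)
    qed auto
    also have "(K * weight \<epsilon> (Re w * real m)) * norm (y - x) \<le> (K * weight \<epsilon> (Re w * real m)) * (norm w * real m)"
    proof (rule mult_left_mono)
      have "y - x = (w - of_real (Re w)) * of_nat m" by (simp add: x_def y_def algebra_simps)
      moreover have "norm (w - of_real (Re w)) \<le> norm w" by (simp add: cmod_def)
      ultimately show "norm (y - x) \<le> norm w * real m" by (simp add: norm_mult mult_right_mono)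
      show "0 \<le> K * weight \<epsilon> (Re w * real m)" using K Re_pos by (simp add: weight_pos less_imp_le)
    qed
    also have "weight \<epsilon> (Re w * real m) = (1 + Re w * real m) powr (-\<epsilon>) / (1 + Re w * real m)"
    proof -
      have "weight \<epsilon> (Re w * real m) = (1 + Re w * real m) powr (-\<epsilon> - 1)"
        unfolding weight_def by (rule arg_cong[of _ _ "\<lambda>x. _ powr x"]) simp
      also have "\<dots> = (1 + Re w * real m) powr (-\<epsilon>) / (1 + Re w * real m) powr 1" by (rule powr_diff)
      finally show ?thesis using Re_pos by (simp add: add_pos_nonneg)
    qed
    also have "K * ((1 + Re w * real m) powr (-\<epsilon>) / (1 + Re w * real m)) * (norm w * real m)
        = K * norm w / Re w * (1 + Re w * real m) powr (-\<epsilon>) * (Re w * real m / (1 + Re w * real m))"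
    proof -
      have "K * (P / D) * (n * x) = K * n / r * P * (r * x / D)" if "0 < r" for P D n x r :: real
        using that by (cases "D = 0") (auto simp: field_simps)
      from this[OF Re_pos] show ?thesis .
    qed
    also have "\<dots> \<le> K * norm w / Re w * (1 + Re w * real m) powr (-\<epsilon>) * 1"
      using Re_pos K by (intro mult_left_mono) (auto simp: divide_le_eq add_pos_nonneg)
    finally show ?thesis by (simp add: x_def y_def)
  qed
  have "(\<lambda>m. (1 + Re w * real m) powr (-\<epsilon>)) \<longlonglongrightarrow> 0"
    using Re_pos \<open>0 < \<epsilon>\<close>
    by (intro tendsto_neg_powr filterlim_tendsto_add_at_top[OF tendsto_const]
        filterlim_tendsto_pos_mult_at_top[OF tendsto_const] filterlim_real_sequentially) auto
  from tendsto_mult_right_zero[OF this, of "K * norm w / Re w"]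
  have "(\<lambda>m. F (w * of_nat m) - F (of_real (Re w * real m))) \<longlonglongrightarrow> 0"
    by (rule Lim_null_comparison[rotated]) (use bd in auto)
  from tendsto_add[OF this lim] show "(\<lambda>m. F (w * of_nat m)) \<longlonglongrightarrow> F 0 + (LINT t:{0..}|lborel. f (of_real t))"
    by simp
qed

text \<open>
  The one-variable expansion. The set \<open>T\<close> consists of the sector and the part of the line through \<open>w\<close>
  that is reached from 0 when \<open>a\<close> is negative (\<open>{a..0}\<close> is empty for \<open>a > 0\<close>). The functions are
  given by the sequence of their derivatives, and the constant \<open>C\<close> depends on \<open>a\<close>, \<open>N\<close> and \<open>\<epsilon>\<close> only,
  which is what allows all other coordinates to vary.
\<close>
theorem euler_maclaurin_ray:
  fixes \<phi> :: "nat \<Rightarrow> complex \<Rightarrow> complex" and w :: complex and a \<theta> \<epsilon> K :: real and N :: nat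
  defines "T \<equiv> sector \<theta> \<union> (\<lambda>t. w * of_real t) ` {a..0}"
    and "C \<equiv> \<bar>bernoulli_coeff (Suc N) a\<bar> + remainder_const a N * ((2 + \<bar>a\<bar>) powr (1 + \<epsilon>) * (1 + 1 / \<epsilon>))"
  assumes \<theta>: "0 \<le> \<theta>" "\<theta> < pi / 2" and w: "w \<in> sector \<theta>" "w \<noteq> 0" "norm w \<le> 1" and \<epsilon>: "0 < \<epsilon>"
    and deriv: "\<And>n z. n \<le> N \<Longrightarrow> z \<in> T \<Longrightarrow> (\<phi> n has_field_derivative \<phi> (Suc n) z) (at z)"
    and bound: "\<And>n z. n \<le> Suc N \<Longrightarrow> z \<in> T \<Longrightarrow> norm (\<phi> n z) \<le> K * weight \<epsilon> (norm z)"
  shows "summable (\<lambda>m. \<phi> 0 (w * of_real (real m + a)))"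
    and "norm ((\<Sum>m. \<phi> 0 (w * of_real (real m + a))) - (LINT t:{0..}|lborel. \<phi> 0 (of_real t)) / w
      + (\<Sum>n<N. of_real (bernoulli_coeff (Suc n) a) * w ^ n * \<phi> n 0)) \<le> C * K * norm w ^ N"
proof -
  have K: "0 \<le> K"
    using bound[of 0 0] zero_in_sector[OF \<theta>(1)] by (auto simp: T_def weight_def intro: order_trans[OF norm_ge_zero])
  have ray: "w * of_real t \<in> T" if "min a 0 \<le> t" for t
    using that scaled_in_sector[OF w(1), of t] by (cases "0 \<le> t") (auto simp: T_def)
  have cont: "continuous_on (sector \<theta>) (\<phi> 0)"
    by (rule DERIV_continuous_on[where D = "\<phi> 1"])
      (use deriv[of 0] in \<open>auto simp: T_def intro: has_field_derivative_at_within\<close>)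
  obtain \<Phi> where \<Phi>: "\<And>z. z \<in> sector \<theta> \<Longrightarrow> (\<Phi> has_field_derivative \<phi> 0 z) (at z within sector \<theta>)"
  proof (rule holomorphic_convex_primitive[OF convex_sector[OF \<theta>] finite.emptyI cont])
    fix z assume "z \<in> interior (sector \<theta>) - {}"
    then show "\<phi> 0 field_differentiable at z"
      using deriv[of 0 z] interior_subset by (fastforce simp: field_differentiable_def T_def)
  qed auto
  have lim\<Phi>: "(\<lambda>m. \<Phi> (w * of_nat m)) \<longlonglongrightarrow> \<Phi> 0 + (LINT t:{0..}|lborel. \<phi> 0 (of_real t))"
    by (rule primitive_limit_along_ray(2)[OF \<theta> w(1,2) \<epsilon> cont \<Phi>, where K = K]) (use bound in \<open>auto simp: T_def\<close>)
  \<comment> \<open>The primitive is put in front of the derivatives: the coefficient \<open>\<beta>\<^sub>0 = 1\<close> belongs to the integral.\<close>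
  define g where "g = (\<lambda>n. case n of 0 \<Rightarrow> \<Phi> | Suc k \<Rightarrow> \<phi> k)"
  have g_simps: "g 0 = \<Phi>" "g (Suc k) = \<phi> k" for k by (auto simp: g_def)
  define \<beta> where "\<beta> = (\<lambda>n. complex_of_real (bernoulli_coeff n a))"
  define c where "c = (2 + \<bar>a\<bar>) powr (1 + \<epsilon>)"
  define G where "G = (\<lambda>m::nat. \<Sum>n\<le>Suc N. \<beta> n * w ^ n * g n (w * of_nat m))"
  define R where "R = (\<lambda>m. w * \<phi> 0 (w * of_real (real m + a)) - (G (Suc m) - G m))"
  define W where "W = (\<lambda>m. weight \<epsilon> (norm w * real m))"
  have R_bound: "norm (R m) \<le> remainder_const a N * (K * c * norm w ^ (N + 2)) * W m" for m
  proof -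
    have 1: "w * of_nat m + w * of_real a = w * of_real (real m + a)" "w * of_nat m + w = w * of_nat (Suc m)"
      by (simp_all add: algebra_simps)
    have seg1: "closed_segment (w * of_nat m) (w * of_nat m + w) \<subseteq> sector \<theta>"
      unfolding 1 using scaled_in_sector[OF w(1), of "real m"] scaled_in_sector[OF w(1), of "real (Suc m)"]
      by (intro closed_segment_subset convex_sector \<theta>) auto
    have seg: "\<exists>t. z = w * of_real t \<and> \<bar>t - real m\<bar> \<le> 1 + \<bar>a\<bar> \<and> min a 0 \<le> t"
      if "z \<in> closed_segment (w * of_nat m) (w * of_nat m + w) \<union>
          closed_segment (w * of_nat m) (w * of_nat m + w * of_real a)" for z
    proof -
      note z_in = that
      obtain b where b: "b = 1 \<or> b = a" and "z \<in> closed_segment (w * of_nat m) (w * of_nat m + w * of_real b)"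
      proof (cases "z \<in> closed_segment (w * of_nat m) (w * of_nat m + w)")
        case True then show ?thesis by (intro that[of 1]) auto
      next
        case False with z_in show ?thesis by (intro that[of a]) auto
      qed
      then obtain u where u: "0 \<le> u" "u \<le> 1"
        and z: "z = (1 - u) *\<^sub>R (w * of_nat m) + u *\<^sub>R (w * of_nat m + w * of_real b)"
        unfolding in_segment by blast
      have "\<bar>u * b\<bar> \<le> 1 + \<bar>a\<bar>" using u b mult_mono[of u 1 "\<bar>b\<bar>" "1 + \<bar>a\<bar>"] by (auto simp: abs_mult)
      moreover have "min a 0 \<le> u * b"
        using u b mult_right_mono_neg[of u 1 a] by (cases "0 \<le> a") auto
      moreover have "z = w * of_real (real m + u * b)"
        by (simp add: z scaleR_conv_of_real algebra_simps)
      ultimately show ?thesis by (intro exI[of _ "real m + u * b"]) auto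
    qed
    have "norm (w * g 1 (w * of_nat m + w * of_real a)
      - (\<Sum>n\<le>Suc N. of_real (bernoulli_coeff n a) * w ^ n * (g n (w * of_nat m + w) - g n (w * of_nat m))))
      \<le> remainder_const a N * (K * c * W m * norm w ^ (N + 2))"
    proof (rule euler_maclaurin_step)
      fix n z assume n: "n \<le> Suc N" and z: "z \<in> closed_segment (w * of_nat m) (w * of_nat m + w)"
      show "(g n has_field_derivative g (Suc n) z) (at z within closed_segment (w * of_nat m) (w * of_nat m + w))"
      proof (cases n)
        case 0
        then show ?thesis using z seg1 DERIV_subset[OF \<Phi> seg1] by (auto simp: g_simps)
      next
        case (Suc k)
        moreover have "z \<in> T" using z seg1 by (auto simp: T_def)
        ultimately have "(\<phi> k has_field_derivative \<phi> (Suc k) z) (at z)"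
          using n by (intro deriv) auto
        then show ?thesis unfolding Suc g_simps by (rule has_field_derivative_at_within)
      qed
    next
      fix n z assume n: "n \<le> N" and z: "z \<in> closed_segment (w * of_nat m) (w * of_nat m + w * of_real a)"
      then have "z \<in> T" using seg[of z] ray by blast
      with n have "(\<phi> n has_field_derivative \<phi> (Suc n) z) (at z)" by (intro deriv)
      then show "(g (Suc n) has_field_derivative g (Suc (Suc n)) z)
          (at z within closed_segment (w * of_nat m) (w * of_nat m + w * of_real a))"
        unfolding g_simps by (rule has_field_derivative_at_within)
    next
      fix z assume "z \<in> closed_segment (w * of_nat m) (w * of_nat m + w) \<union>
          closed_segment (w * of_nat m) (w * of_nat m + w * of_real a)"
      from seg[OF this] obtain t where t: "z = w * of_real t" "\<bar>t - real m\<bar> \<le> 1 + \<bar>a\<bar>" "min a 0 \<le> t" by auto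
      have "norm (\<phi> (Suc N) z) \<le> K * weight \<epsilon> (norm w * \<bar>t\<bar>)"
        using bound[of "Suc N" z] ray[OF t(3)] t(1) by (simp add: norm_mult)
      also have "weight \<epsilon> (norm w * \<bar>t\<bar>) \<le> c * W m"
        using weight_shift[of \<epsilon> "norm w" "real m" "1 + \<bar>a\<bar>" t] \<epsilon> w t by (simp add: c_def W_def)
      finally show "norm (g (Suc (Suc N)) z) \<le> K * c * W m"
        using K by (simp add: g_simps mult_left_mono mult.assoc)
    qed
    then show ?thesis
      unfolding 1 by (simp add: R_def G_def g_simps \<beta>_def sum_subtractf algebra_simps del: sum.atMost_Suc of_nat_Suc)
  qed
  have W_sum: "summable W" "suminf W \<le> 1 + 1 / (\<epsilon> * norm w)"
    using weight_sum[of \<epsilon> "norm w"] \<epsilon> w by (auto simp: W_def)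
  have R_sum: "summable (\<lambda>m. norm (R m))"
    by (rule summable_comparison_test'[OF summable_mult[OF W_sum(1)], of 0]) (use R_bound in auto)
  have G_lim: "G \<longlonglongrightarrow> \<Phi> 0 + (LINT t:{0..}|lborel. \<phi> 0 (of_real t))"
  proof -
    have "(\<lambda>m. \<phi> n (w * of_nat m)) \<longlonglongrightarrow> 0" if n: "n \<le> N" for n
    proof (rule Lim_null_comparison)
      show "\<forall>\<^sub>F m in sequentially. norm (\<phi> n (w * of_nat m)) \<le> K * W m"
      proof (intro always_eventually allI)
        fix m
        have "w * of_nat m \<in> T" using ray[of "real m"] by simp
        from bound[OF _ this, of n] n show "norm (\<phi> n (w * of_nat m)) \<le> K * W m"
          by (simp add: W_def norm_mult)
      qed
      show "(\<lambda>m. K * W m) \<longlonglongrightarrow> 0"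
        using tendsto_mult_right_zero[OF summable_LIMSEQ_zero[OF W_sum(1)]] .
    qed
    then have "(\<lambda>m. \<beta> 0 * w ^ 0 * g 0 (w * of_nat m) + (\<Sum>n\<le>N. \<beta> (Suc n) * w ^ Suc n * \<phi> n (w * of_nat m)))
        \<longlonglongrightarrow> \<beta> 0 * w ^ 0 * (\<Phi> 0 + (LINT t:{0..}|lborel. \<phi> 0 (of_real t))) + (\<Sum>n\<le>N. \<beta> (Suc n) * w ^ Suc n * 0)"
      using lim\<Phi> by (intro tendsto_intros) (auto simp: g_simps)
    then show ?thesis
      by (simp add: G_def sum.atMost_Suc_shift g_simps \<beta>_def bernoulli_coeff_0 del: sum.atMost_Suc)
  qed
  have "(\<lambda>m. R m + (G (Suc m) - G m)) sums (suminf R + (\<Phi> 0 + (LINT t:{0..}|lborel. \<phi> 0 (of_real t)) - G 0))"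
    using summable_norm_cancel[OF R_sum] by (intro sums_add telescope_sums G_lim summable_sums)
  moreover have "G 0 = \<Phi> 0 + (\<Sum>n\<le>N. \<beta> (Suc n) * w ^ Suc n * \<phi> n 0)"
    by (simp add: G_def sum.atMost_Suc_shift g_simps \<beta>_def bernoulli_coeff_0 del: sum.atMost_Suc)
  moreover have "R m + (G (Suc m) - G m) = w * \<phi> 0 (w * of_real (real m + a))" for m
    by (simp add: R_def)
  ultimately have "(\<lambda>m. w * \<phi> 0 (w * of_real (real m + a))) sums
      (suminf R + (LINT t:{0..}|lborel. \<phi> 0 (of_real t)) - (\<Sum>n\<le>N. \<beta> (Suc n) * w ^ Suc n * \<phi> n 0))"
    by (simp only:) (simp add: add_diff_eq)
  from sums_divide[OF this, of w]
  have sums: "(\<lambda>m. \<phi> 0 (w * of_real (real m + a))) sums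
      (suminf R / w + (LINT t:{0..}|lborel. \<phi> 0 (of_real t)) / w - (\<Sum>n\<le>N. \<beta> (Suc n) * w ^ n * \<phi> n 0))"
    using w by (simp add: diff_divide_distrib add_divide_distrib sum_divide_distrib mult_ac)
  then show "summable (\<lambda>m. \<phi> 0 (w * of_real (real m + a)))" by (rule sums_summable)
  have "(\<Sum>m. \<phi> 0 (w * of_real (real m + a))) - (LINT t:{0..}|lborel. \<phi> 0 (of_real t)) / w
      + (\<Sum>n<N. \<beta> (Suc n) * w ^ n * \<phi> n 0) = suminf R / w - \<beta> (Suc N) * w ^ N * \<phi> N 0"
    using sums_unique[OF sums, symmetric]
    by (simp only: lessThan_Suc_atMost[symmetric] sum.lessThan_Suc) (simp add: algebra_simps)
  also have "norm \<dots> \<le> norm (suminf R) / norm w + norm (\<beta> (Suc N) * w ^ N * \<phi> N 0)"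
    by (rule order_trans[OF norm_triangle_ineq4]) (simp add: norm_divide)
  also have "norm (suminf R) \<le> remainder_const a N * (K * c * norm w ^ (N + 2)) * (1 + 1 / (\<epsilon> * norm w))"
  proof -
    have "norm (suminf R) \<le> (\<Sum>m. norm (R m))" by (rule summable_norm[OF R_sum])
    also have "\<dots> \<le> (\<Sum>m. remainder_const a N * (K * c * norm w ^ (N + 2)) * W m)"
      by (intro suminf_le R_sum R_bound summable_mult W_sum)
    also have "\<dots> = remainder_const a N * (K * c * norm w ^ (N + 2)) * suminf W"
      by (rule suminf_mult[OF W_sum(1)])
    also have "\<dots> \<le> remainder_const a N * (K * c * norm w ^ (N + 2)) * (1 + 1 / (\<epsilon> * norm w))"
      using W_sum(2) K remainder_const_nonneg[of a N] by (intro mult_left_mono mult_nonneg_nonneg) (auto simp: c_def)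
    finally show ?thesis .
  qed
  \<comment> \<open>The sum of the weights costs one factor \<open>1 / norm w\<close>, the division of the whole identity by \<open>w\<close> another one.\<close>
  also have "remainder_const a N * (K * c * norm w ^ (N + 2)) * (1 + 1 / (\<epsilon> * norm w)) / norm w
      = remainder_const a N * (K * c) * norm w ^ N * (norm w + 1 / \<epsilon>)"
    using w \<epsilon> by (simp add: field_simps power_add power2_eq_square)
  also have "\<dots> \<le> remainder_const a N * (K * c) * norm w ^ N * (1 + 1 / \<epsilon>)"
    using w K remainder_const_nonneg[of a N] by (intro mult_left_mono mult_nonneg_nonneg) (auto simp: c_def)
  \<comment> \<open>The boundary term with index \<open>N\<close> is not part of the expansion; it is itself of the order of the error.\<close>
  also have "norm (\<beta> (Suc N) * w ^ N * \<phi> N 0) \<le> \<bar>bernoulli_coeff (Suc N) a\<bar> * norm w ^ N * K"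
  proof -
    have "norm (\<phi> N 0) \<le> K" using bound[of N 0] zero_in_sector[OF \<theta>(1)] by (auto simp: T_def weight_def)
    then show ?thesis unfolding norm_mult norm_power by (simp add: \<beta>_def mult_left_mono)
  qed
  finally show "norm ((\<Sum>m. \<phi> 0 (w * of_real (real m + a))) - (LINT t:{0..}|lborel. \<phi> 0 (of_real t)) / w
      + (\<Sum>n<N. of_real (bernoulli_coeff (Suc n) a) * w ^ n * \<phi> n 0)) \<le> C * K * norm w ^ N"
    using w by (simp add: C_def c_def \<beta>_def algebra_simps divide_right_mono)
qed

section \<open>Separately holomorphic functions\<close>

text \<open>
  The same expression as in \<open>partial_deriv\<close>, so that slices of a function can be named.
\<close>
definition vec_upd :: "complex ^ 's \<Rightarrow> 's \<Rightarrow> complex \<Rightarrow> complex ^ 's" where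
  "vec_upd x k z = (\<chi> i. if i = k then z else x $ i)"

lemma vec_upd_nth: "vec_upd x k z $ i = (if i = k then z else x $ i)"
  by (simp add: vec_upd_def)

lemma vec_upd_eq_add: "vec_upd x k z = x + axis k (z - x $ k)"
  by (simp add: vec_eq_iff vec_upd_nth axis_def)

lemma vec_upd_same: "vec_upd x k (x $ k) = x"
  by (simp add: vec_upd_eq_add)

lemma vec_upd_twice: "vec_upd (vec_upd x k z) k u = vec_upd x k u"
  by (simp add: vec_eq_iff vec_upd_nth)

lemma norm_axis_complex: "norm (axis k z :: complex ^ 's) = norm z"
proof -
  have "(norm (axis k z $ i))\<^sup>2 = (if i = k then (norm z)\<^sup>2 else 0)" for i
    by (simp add: axis_def)
  then show ?thesis by (simp add: norm_vec_def L2_set_def)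
qed

lemma bounded_linear_axis: "bounded_linear (axis k :: complex \<Rightarrow> complex ^ 's)"
  by (rule bounded_linear_intro[where K = 1]) (simp_all add: norm_axis_complex, simp_all add: vec_eq_iff axis_def)

lemmas has_derivative_axis = bounded_linear_imp_has_derivative[OF bounded_linear_axis]

lemmas continuous_on_axis [continuous_intros] = bounded_linear.continuous_on[OF bounded_linear_axis]

text \<open>
  Continuity together with holomorphy in each variable. Unlike complex Frechet differentiability this
  property is easily seen to pass to partial derivatives, and it provides what the proof needs:
  holomorphic slices for the one-variable theorem, continuity for measurability and for bounds on
  compact sets.
\<close>
definition sep_holomorphic :: "(complex ^ 's \<Rightarrow> complex) \<Rightarrow> (complex ^ 's) set \<Rightarrow> bool" where
  "sep_holomorphic f \<Omega> \<longleftrightarrow> continuous_on \<Omega> f \<and>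
     (\<forall>x\<in>\<Omega>. \<forall>j. (\<lambda>z. f (vec_upd x j z)) field_differentiable (at (x $ j)))"

lemma holomorphic_several_imp_sep_holomorphic:
  assumes "holomorphic_several f \<Omega>" shows "sep_holomorphic f \<Omega>"
  unfolding sep_holomorphic_def
proof (intro conjI ballI allI)
  show "continuous_on \<Omega> f"
    using assms unfolding holomorphic_several_def
    by (intro continuous_at_imp_continuous_on) (auto dest!: bspec intro: has_derivative_continuous)
next
  fix x j assume "x \<in> \<Omega>"
  then have "\<exists>L. (f has_derivative L) (at x) \<and> (\<forall>c v. L (c *s v) = c * L v)"
    using assms by (simp add: holomorphic_several_def)
  then obtain L where L: "(f has_derivative L) (at x)" "\<And>c v. L (c *s v) = c * L v"
    by auto
  have "((\<lambda>z. x + axis j (z - x $ j)) has_derivative (\<lambda>h. axis j h)) (at (x $ j))"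
    by (auto intro!: derivative_eq_intros has_derivative_compose[OF _ has_derivative_axis])
  then have "((\<lambda>z. vec_upd x j z) has_derivative (\<lambda>h. axis j h)) (at (x $ j))"
    by (simp add: vec_upd_eq_add)
  then have "((\<lambda>z. f (vec_upd x j z)) has_derivative (\<lambda>h. L (axis j h))) (at (x $ j))"
    by (rule has_derivative_compose) (simp add: vec_upd_same L)
  moreover have "(\<lambda>h. L (axis j h)) = (*) (L (axis j 1))"
  proof
    fix h :: complex
    have "axis j h = h *s axis j 1" by (simp add: vec_eq_iff axis_def)
    then show "L (axis j h) = L (axis j 1) * h" using L(2)[of h "axis j 1"] by (simp add: mult.commute)
  qed
  ultimately have "((\<lambda>z. f (vec_upd x j z)) has_field_derivative L (axis j 1)) (at (x $ j))"
    by (simp only: has_field_derivative_def)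
  then show "(\<lambda>z. f (vec_upd x j z)) field_differentiable (at (x $ j))"
    unfolding field_differentiable_def by blast
qed

lemma sep_holomorphicD:
  assumes "sep_holomorphic f \<Omega>" "x \<in> \<Omega>"
  shows "(\<lambda>z. f (vec_upd x j z)) field_differentiable (at (x $ j))"
  using assms by (simp add: sep_holomorphic_def)

lemma open_slice: "open \<Omega> \<Longrightarrow> open {z. vec_upd x j z \<in> \<Omega>}"
  unfolding vec_upd_eq_add
proof -
  assume "open \<Omega>"
  moreover have "continuous_on UNIV (\<lambda>z. x + axis j (z - x $ j))" by (intro continuous_intros)
  ultimately show "open {z. x + axis j (z - x $ j) \<in> \<Omega>}"
    using open_vimage[of \<Omega> "\<lambda>z. x + axis j (z - x $ j)"] by (simp add: vimage_def)
qed

lemma sep_holomorphic_slice: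
  assumes "sep_holomorphic f \<Omega>"
  shows "(\<lambda>z. f (vec_upd x j z)) holomorphic_on {z. vec_upd x j z \<in> \<Omega>}"
proof (rule holomorphic_onI)
  fix z assume "z \<in> {z. vec_upd x j z \<in> \<Omega>}"
  then have "(\<lambda>u. f (vec_upd (vec_upd x j z) j u)) field_differentiable (at (vec_upd x j z $ j))"
    using assms by (intro sep_holomorphicD[of f \<Omega>]) auto
  then show "(\<lambda>z. f (vec_upd x j z)) field_differentiable at z within {z. vec_upd x j z \<in> \<Omega>}"
    by (simp add: vec_upd_twice vec_upd_nth field_differentiable_at_within)
qed

lemma has_field_derivative_slice:
  assumes "sep_holomorphic f \<Omega>" "vec_upd x j z \<in> \<Omega>"
  shows "((\<lambda>z. f (vec_upd x j z)) has_field_derivative partial_deriv j f (vec_upd x j z)) (at z)"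
proof -
  have "(\<lambda>u. f (vec_upd (vec_upd x j z) j u)) field_differentiable (at (vec_upd x j z $ j))"
    using assms by (intro sep_holomorphicD[of f \<Omega>]) auto
  then have "(\<lambda>u. f (vec_upd x j u)) field_differentiable (at z)"
    by (simp add: vec_upd_twice vec_upd_nth)
  moreover have "partial_deriv j f (vec_upd x j z) = deriv (\<lambda>u. f (vec_upd x j u)) z"
    unfolding partial_deriv_def vec_upd_def[symmetric] by (simp add: vec_upd_twice vec_upd_nth)
  ultimately show ?thesis by (simp add: field_differentiable_derivI)
qed

text \<open>
  Taylor's formula of first order, with Cauchy's estimate for the second derivative on discs of
  radius \<open>r / 2\<close>. The point is that the bound depends on \<open>\<phi>\<close> only through \<open>M\<close>.
\<close>
lemma difference_quotient_bound:
  fixes \<phi> :: "complex \<Rightarrow> complex"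
  assumes holo: "\<phi> holomorphic_on U" "open U" "cball c r \<subseteq> U" and r: "0 < r"
    and M: "\<And>z. z \<in> cball c r \<Longrightarrow> norm (\<phi> z) \<le> M" and h: "h \<noteq> 0" "norm h \<le> r / 2"
  shows "norm ((\<phi> (c + h) - \<phi> c) / h - deriv \<phi> c) \<le> 8 * M / r\<^sup>2 * norm h"
proof -
  define g where "g = (\<lambda>i. (deriv ^^ i) \<phi>)"
  have U: "cball c (r / 2) \<subseteq> U" using holo r by (auto simp: subset_iff)
  have "norm (g 0 (c + h) - (\<Sum>i\<le>1. g i c * (c + h - c) ^ i / fact i))
      \<le> (8 * M / r\<^sup>2) * norm (c + h - c) ^ Suc 1 / fact 1"
  proof (rule complex_Taylor[of "cball c (r / 2)"])
    fix i :: nat and z assume z: "z \<in> cball c (r / 2)"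
    have hol: "g i holomorphic_on U" unfolding g_def using holo by (intro holomorphic_higher_deriv)
    have "(g i has_field_derivative deriv (g i) z) (at z)"
      using z U by (intro holomorphic_derivI[OF hol \<open>open U\<close>]) auto
    moreover have "deriv (g i) = g (Suc i)" by (simp add: g_def)
    ultimately show "(g i has_field_derivative g (Suc i) z) (at z within cball c (r / 2))"
      by (simp add: has_field_derivative_at_within)
  next
    fix z assume z: "z \<in> cball c (r / 2)"
    have sub: "cball z (r / 2) \<subseteq> cball c r"
    proof
      fix u assume "u \<in> cball z (r / 2)"
      then show "u \<in> cball c r" using z dist_triangle[of c u z] by (simp add: dist_commute)
    qed
    have "norm ((deriv ^^ 2) \<phi> z) \<le> fact 2 * M / (r / 2) ^ 2"
    proof (rule Cauchy_inequality)
      show "\<phi> holomorphic_on ball z (r / 2)"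
        using sub holo ball_subset_cball by (blast intro: holomorphic_on_subset)
      show "continuous_on (cball z (r / 2)) \<phi>"
        using sub holo by (blast intro: holomorphic_on_subset holomorphic_on_imp_continuous_on)
    next
      fix u assume "norm (z - u) = r / 2"
      then have "u \<in> cball z (r / 2)" by (simp add: dist_norm)
      then show "norm (\<phi> u) \<le> M" using sub M by blast
    qed (use r in auto)
    then show "norm (g (Suc 1) z) \<le> 8 * M / r\<^sup>2"
      by (simp add: g_def numeral_2_eq_2 power2_eq_square)
  qed (use r h in \<open>auto simp: dist_norm\<close>)
  then have "norm (\<phi> (c + h) - \<phi> c - deriv \<phi> c * h) \<le> 8 * M / r\<^sup>2 * norm h * norm h"
    by (simp add: g_def diff_diff_add power2_eq_square mult.assoc)
  then have "norm (\<phi> (c + h) - \<phi> c - deriv \<phi> c * h) / norm h \<le> 8 * M / r\<^sup>2 * norm h"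
    using h by (simp add: divide_le_eq)
  moreover have "(\<phi> (c + h) - \<phi> c) / h - deriv \<phi> c = (\<phi> (c + h) - \<phi> c - deriv \<phi> c * h) / h"
    using h by (simp add: field_simps)
  ultimately show ?thesis by (simp add: norm_divide)
qed

text \<open>
  Near \<open>x0\<close> the function is bounded on all slices by the same constant, so the difference quotients
  converge uniformly. Their step \<open>r / 2 / (n + 1)\<close> is at most half the radius of the slices.
\<close>
lemma partial_deriv_uniform_limit:
  fixes x0 :: "complex ^ 's"
  assumes holo: "sep_holomorphic f \<Omega>" and "open \<Omega>" and r: "0 < r" and sub: "cball x0 (2 * r) \<subseteq> \<Omega>"
  shows "uniform_limit (ball x0 r)
    (\<lambda>n x. (f (x + axis k (of_real (r / 2 / real (Suc n)))) - f x) / of_real (r / 2 / real (Suc n)))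
    (partial_deriv k f) sequentially"
proof -
  have "continuous_on (cball x0 (2 * r)) f"
    using holo by (intro continuous_on_subset[OF _ sub]) (simp add: sep_holomorphic_def)
  then have "bounded (f ` cball x0 (2 * r))"
    by (intro compact_imp_bounded compact_continuous_image) auto
  then obtain M where "\<forall>y\<in>f ` cball x0 (2 * r). norm y \<le> M"
    unfolding bounded_iff by blast
  then have M: "\<And>x. x \<in> cball x0 (2 * r) \<Longrightarrow> norm (f x) \<le> M" by simp
  define h where "h = (\<lambda>n. complex_of_real (r / 2 / real (Suc n)))"
  have norm_h: "norm (h n) = r / 2 / real (Suc n)" for n
    unfolding h_def norm_of_real using r by simp
  have h: "h n \<noteq> 0" "norm (h n) \<le> r / 2" for n
  proof -
    have "0 < r / 2 / real (Suc n)" using r by simp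
    then show "h n \<noteq> 0" using norm_h[of n] by (metis less_irrefl norm_zero)
    have "r / 2 \<le> r / 2 * real (Suc n)" using r mult_left_mono[of 1 "real (Suc n)" "r / 2"] by simp
    then show "norm (h n) \<le> r / 2" unfolding norm_h by (subst divide_le_eq) simp
  qed
  have est: "norm ((f (x + axis k (h n)) - f x) / h n - partial_deriv k f x) \<le> 8 * M / r\<^sup>2 * norm (h n)"
    if x: "x \<in> ball x0 r" for x n
  proof -
    have in_ball: "vec_upd x k z \<in> cball x0 (2 * r)" if "z \<in> cball (x $ k) r" for z
    proof -
      have "dist x (vec_upd x k z) \<le> r"
        using that by (simp add: vec_upd_eq_add dist_norm norm_axis_complex norm_minus_commute)
      then show ?thesis using x dist_triangle[of x0 "vec_upd x k z" x] unfolding mem_ball mem_cball by linarith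
    qed
    have "norm (((\<lambda>z. f (vec_upd x k z)) (x $ k + h n) - (\<lambda>z. f (vec_upd x k z)) (x $ k)) / h n
        - deriv (\<lambda>z. f (vec_upd x k z)) (x $ k)) \<le> 8 * M / r\<^sup>2 * norm (h n)"
      by (rule difference_quotient_bound[OF sep_holomorphic_slice[OF holo] open_slice[OF \<open>open \<Omega>\<close>] _ r _ h])
        (use in_ball sub M in auto)
    moreover have "partial_deriv k f x = deriv (\<lambda>z. f (vec_upd x k z)) (x $ k)"
      by (simp add: partial_deriv_def vec_upd_def)
    moreover have "vec_upd x k (x $ k + h n) = x + axis k (h n)" by (simp add: vec_upd_eq_add)
    ultimately show ?thesis by (simp add: vec_upd_same)
  qed
  have "(\<lambda>n. norm (h n)) \<longlonglongrightarrow> 0"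
    using tendsto_mult_right_zero[OF LIMSEQ_inverse_real_of_nat, of "r / 2"]
    by (simp only: norm_h divide_inverse)
  then have "(\<lambda>n. 8 * M / r\<^sup>2 * norm (h n)) \<longlonglongrightarrow> 0"
    by (intro tendsto_mult_right_zero)
  then have "uniform_limit (ball x0 r) (\<lambda>n x. (f (x + axis k (h n)) - f x) / h n) (partial_deriv k f) sequentially"
  proof (intro uniform_limitI)
    fix e :: real assume "0 < e" and lim: "(\<lambda>n. 8 * M / r\<^sup>2 * norm (h n)) \<longlonglongrightarrow> 0"
    then have "\<forall>\<^sub>F n in sequentially. 8 * M / r\<^sup>2 * norm (h n) < e"
      by (intro order_tendstoD(2))
    then show "\<forall>\<^sub>F n in sequentially. \<forall>x\<in>ball x0 r. dist ((f (x + axis k (h n)) - f x) / h n) (partial_deriv k f x) < e"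
    proof eventually_elim
      case (elim n)
      show ?case
      proof
        fix x assume "x \<in> ball x0 r"
        from est[OF this, of n] elim show "dist ((f (x + axis k (h n)) - f x) / h n) (partial_deriv k f x) < e"
          unfolding dist_norm by (rule order_le_less_trans)
      qed
    qed
  qed
  then show ?thesis by (simp add: h_def)
qed

text \<open>
  Difference quotients are continuous and holomorphic in each variable, and both properties
  survive locally uniform limits.
\<close>
lemma sep_holomorphic_partial_deriv:
  fixes f :: "complex ^ 's \<Rightarrow> complex"
  assumes holo: "sep_holomorphic f \<Omega>" and "open \<Omega>"
  shows "sep_holomorphic (partial_deriv k f) \<Omega>"
proof -
  have local: "isCont (partial_deriv k f) x0 \<and>
      (\<forall>j. (\<lambda>z. partial_deriv k f (vec_upd x0 j z)) field_differentiable (at (x0 $ j)))" if "x0 \<in> \<Omega>" for x0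
  proof -
    obtain r0 where "0 < r0" "cball x0 r0 \<subseteq> \<Omega>"
      using \<open>open \<Omega>\<close>[unfolded open_contains_cball, rule_format, of x0] \<open>x0 \<in> \<Omega>\<close> by blast
    then obtain r where r: "0 < r" "cball x0 (2 * r) \<subseteq> \<Omega>" by (intro that[of "r0 / 2"]) auto
    define h where "h = (\<lambda>n. complex_of_real (r / 2 / real (Suc n)))"
    define q where "q = (\<lambda>n x. (f (x + axis k (h n)) - f x) / h n)"
    have h: "h n \<noteq> 0" "norm (h n) \<le> r" for n
    proof -
      have "0 < r / 2 / real (Suc n)" using r by simp
      moreover have norm_h: "norm (h n) = r / 2 / real (Suc n)"
        unfolding h_def norm_of_real using r by simp
      ultimately show "h n \<noteq> 0" by (metis less_irrefl norm_zero)
      have "r / 2 \<le> r * real (Suc n)" using r mult_mono[of "r / 2" r 1 "real (Suc n)"] by simp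
      then show "norm (h n) \<le> r" unfolding norm_h by (subst divide_le_eq) simp
    qed
    have ulim: "uniform_limit (ball x0 r) q (partial_deriv k f) sequentially"
      using partial_deriv_uniform_limit[OF assms r] by (simp add: q_def h_def)
    have mem: "x \<in> \<Omega>" "x + axis k (h n) \<in> \<Omega>" if "x \<in> ball x0 r" for x n
    proof -
      have "dist x (x + axis k (h n)) \<le> r" using h by (simp add: dist_norm norm_axis_complex)
      then have "x + axis k (h n) \<in> cball x0 (2 * r)"
        using that dist_triangle[of x0 "x + axis k (h n)" x] unfolding mem_ball mem_cball by linarith
      moreover have "x \<in> cball x0 (2 * r)" using that r by simp
      ultimately show "x \<in> \<Omega>" "x + axis k (h n) \<in> \<Omega>" using r by blast+
    qed
    have "continuous_on (ball x0 r) (partial_deriv k f)"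
    proof (rule uniform_limit_theorem[OF _ ulim])
      have cf: "continuous_on \<Omega> f" using holo by (simp add: sep_holomorphic_def)
      have "continuous_on (ball x0 r) (q n)" for n
      proof -
        have "continuous_on (ball x0 r) (\<lambda>x. f (x + axis k (h n)))"
          by (rule continuous_on_compose2[OF cf]) (use mem in \<open>auto intro!: continuous_intros\<close>)
        moreover have "continuous_on (ball x0 r) f"
          by (rule continuous_on_subset[OF cf]) (use mem in auto)
        ultimately show ?thesis unfolding q_def using h by (intro continuous_on_divide continuous_on_diff continuous_on_const) auto
      qed
      then show "\<forall>\<^sub>F n in sequentially. continuous_on (ball x0 r) (q n)" by simp
    qed auto
    then have cont: "isCont (partial_deriv k f) x0"
      using r by (simp add: continuous_on_eq_continuous_at)
    have "(\<lambda>z. partial_deriv k f (vec_upd x0 j z)) field_differentiable (at (x0 $ j))" for j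
    proof -
      have ball: "vec_upd x0 j z \<in> ball x0 r" if "z \<in> ball (x0 $ j) r" for z
        using that by (simp add: vec_upd_eq_add dist_norm norm_axis_complex norm_minus_commute)
      have "(\<lambda>z. partial_deriv k f (vec_upd x0 j z)) holomorphic_on ball (x0 $ j) r"
      proof (rule holomorphic_uniform_sequence)
        fix n
        define c where "c = (if j = k then h n else 0)"
        \<comment> \<open>A shift in direction \<open>k\<close> is a translation of the slice variable if \<open>j = k\<close>, and otherwise a change of the base point.\<close>
        have shift: "vec_upd x0 j z + axis k (h n) = vec_upd (x0 + axis k (h n)) j (z + c)" for z
          by (simp add: vec_eq_iff vec_upd_nth axis_def c_def)
        have 1: "(\<lambda>z. f (vec_upd x0 j z)) holomorphic_on ball (x0 $ j) r"
          by (rule holomorphic_on_subset[OF sep_holomorphic_slice[OF holo]]) (use ball mem in auto)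
        have "((\<lambda>z. f (vec_upd (x0 + axis k (h n)) j z)) \<circ> (\<lambda>z. z + c)) holomorphic_on ball (x0 $ j) r"
          by (rule holomorphic_on_compose_gen[OF _ sep_holomorphic_slice[OF holo]])
            (use ball mem in \<open>auto intro!: holomorphic_intros simp flip: shift\<close>)
        then have 2: "(\<lambda>z. f (vec_upd x0 j z + axis k (h n))) holomorphic_on ball (x0 $ j) r"
          by (simp add: o_def shift)
        show "(\<lambda>z. q n (vec_upd x0 j z)) holomorphic_on ball (x0 $ j) r"
          unfolding q_def using h by (intro holomorphic_intros 1 2) auto
      next
        fix z assume "z \<in> ball (x0 $ j) r"
        then obtain d where d: "0 < d" "cball z d \<subseteq> ball (x0 $ j) r"
          using open_ball[of "x0 $ j" r, unfolded open_contains_cball, rule_format] by blast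
        have "uniform_limit (cball z d) (\<lambda>n z. q n (vec_upd x0 j z)) (\<lambda>z. partial_deriv k f (vec_upd x0 j z)) sequentially"
          by (rule uniform_limit_compose'[OF ulim]) (use d ball in auto)
        with d show "\<exists>d>0. cball z d \<subseteq> ball (x0 $ j) r \<and>
            uniform_limit (cball z d) (\<lambda>n z. q n (vec_upd x0 j z)) (\<lambda>z. partial_deriv k f (vec_upd x0 j z)) sequentially"
          by blast
      qed auto
      then show ?thesis using r by (auto intro: holomorphic_on_imp_differentiable_at)
    qed
    with cont show ?thesis by blast
  qed
  then show ?thesis
    unfolding sep_holomorphic_def by (auto intro: continuous_at_imp_continuous_on)
qed

lemma sep_holomorphic_mixed_deriv:
  assumes "sep_holomorphic f \<Omega>" "open \<Omega>"
  shows "sep_holomorphic (mixed_deriv S n f) \<Omega>"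
proof -
  have pow: "sep_holomorphic ((partial_deriv j ^^ p) g) \<Omega>" if "sep_holomorphic g \<Omega>" for j p g
    by (induction p) (auto simp: that sep_holomorphic_partial_deriv assms(2))
  have "sep_holomorphic (foldr (\<lambda>j. partial_deriv j ^^ n j) xs f) \<Omega>" for xs
    by (induction xs) (auto intro: pow assms)
  then show ?thesis by (simp add: mixed_deriv_def)
qed

text \<open>
  The derivatives are composed in increasing order of the indices, the smallest one being outermost.
  Hence a smaller index can be added without interchanging derivatives.
\<close>
lemma mixed_deriv_insert_least:
  fixes S :: "'s::{finite,linorder} set"
  assumes "\<And>j. j \<in> S \<Longrightarrow> k < j"
  shows "mixed_deriv (insert k S) (n(k := p)) f = (partial_deriv k ^^ p) (mixed_deriv S n f)"
proof -
  have "sorted_list_of_set (insert k S) = k # sorted_list_of_set S"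
    using assms by (intro sorted_distinct_set_unique) (auto simp: less_imp_le simp del: sorted_list_of_set_insert_remove)
  moreover have "foldr (\<lambda>j. partial_deriv j ^^ (n(k := p)) j) (sorted_list_of_set S) f
      = foldr (\<lambda>j. partial_deriv j ^^ n j) (sorted_list_of_set S) f"
    using assms by (intro foldr_cong) auto
  ultimately show ?thesis by (simp add: mixed_deriv_def)
qed

text \<open>
  This makes the hypothesis on the decay of derivatives of full multi-order available for derivatives
  in some of the variables.
\<close>
lemma mixed_deriv_extend:
  fixes S :: "'s::{finite,linorder} set"
  shows "mixed_deriv S n f = mixed_deriv UNIV (\<lambda>j. if j \<in> S then n j else 0) f"
proof -
  have "sorted_list_of_set S = filter (\<lambda>j. j \<in> S) (sorted_list_of_set (UNIV :: 's set))"
    by (intro sorted_distinct_set_unique) (auto simp: sorted_wrt_filter)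
  moreover have "foldr (\<lambda>j. partial_deriv j ^^ n j) (filter (\<lambda>j. j \<in> S) xs) f
      = foldr (\<lambda>j. partial_deriv j ^^ (if j \<in> S then n j else 0)) xs f" for xs
    by (induction xs) auto
  ultimately show ?thesis by (simp add: mixed_deriv_def)
qed

section \<open>Uniform bounds\<close>

lemma closed_shifted_sector_prod:
  fixes \<theta> a :: "real ^ 's"
  assumes "\<And>j. 0 \<le> \<theta> $ j \<and> \<theta> $ j < pi / 2"
  shows "closed (shifted_sector_prod \<theta> a \<delta>)"
proof -
  have cl: "closed ({z. z \<in> sector (\<theta> $ j)} \<union> {z. a $ j < 0 \<and> - z \<in> sector (\<theta> $ j) \<and> norm z \<le> \<delta>})" for j
  proof -
    have "closed (uminus -` sector (\<theta> $ j))"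
      using assms by (intro closed_vimage closed_sector continuous_intros) auto
    then have "closed {z. - z \<in> sector (\<theta> $ j)}" by (simp add: vimage_def)
    then show ?thesis
      using closed_sector[of "\<theta> $ j"] assms
      by (intro closed_Un closed_Collect_conj closed_Collect_le closed_Collect_const continuous_intros) auto
  qed
  have "shifted_sector_prod \<theta> a \<delta> = (\<Inter>j. (\<lambda>x. x $ j) -`
      ({z. z \<in> sector (\<theta> $ j)} \<union> {z. a $ j < 0 \<and> - z \<in> sector (\<theta> $ j) \<and> norm z \<le> \<delta>}))"
    by (auto simp: shifted_sector_prod_def)
  also have "closed \<dots>"
    by (intro closed_INT ballI closed_vimage cl continuous_intros)
  finally show ?thesis .
qed

text \<open>
  With \<open>\<delta> \<le> 1 / 2\<close> the shifted sector stays away from \<open>-1\<close>, where \<open>\<bar>x + 1\<bar>\<close> vanishes; therefore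
  \<open>\<bar>x + 1\<bar>\<close> and \<open>1 + \<bar>x\<bar>\<close> are comparable on it.
\<close>
lemma one_add_norm_le:
  assumes "0 \<le> \<theta>" "\<theta> < pi / 2" "\<delta> \<le> 1 / 2"
    and "z \<in> sector \<theta> \<or> norm z \<le> \<delta>"
  shows "1 + norm z \<le> 3 * norm (z + 1)"
  using assms(4)
proof
  assume "z \<in> sector \<theta>"
  then have "0 \<le> Re z" using assms by (simp add: sector_iff)
  then have "1 \<le> norm (z + 1)" using complex_Re_le_cmod[of "z + 1"] by simp
  moreover have "norm z \<le> norm (z + 1) + 1" using norm_triangle_ineq4[of "z + 1" 1] by simp
  ultimately show ?thesis by simp
next
  assume "norm z \<le> \<delta>"
  moreover have "1 \<le> norm (z + 1) + norm z" using norm_triangle_ineq4[of "z + 1" z] by simp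
  ultimately show ?thesis using assms by simp
qed

text \<open>
  Sufficient decay is an asymptotic condition. Where the sum of the moduli is bounded, the closed
  set \<open>shifted_sector_prod \<theta> a \<delta>\<close> is compact, \<open>g\<close> is bounded and the weights are bounded
  below, so a constant takes care of this part. One exponent \<open>\<epsilon>\<close>, the smallest one,
  serves all coordinates.
\<close>
lemma sufficient_decay_bound:
  fixes g :: "complex ^ 's \<Rightarrow> complex" and \<theta> a :: "real ^ 's"
  assumes \<theta>: "\<And>j. 0 \<le> \<theta> $ j \<and> \<theta> $ j < pi / 2" and \<delta>: "\<delta> \<le> 1 / 2"
    and cont: "continuous_on (shifted_sector_prod \<theta> a \<delta>) g"
    and decay: "sufficient_decay (shifted_sector_prod \<theta> a \<delta>) g"
  obtains K \<epsilon> where "0 < \<epsilon>"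
    "\<And>x. x \<in> shifted_sector_prod \<theta> a \<delta> \<Longrightarrow> norm (g x) \<le> K * (\<Prod>j\<in>UNIV. weight \<epsilon> (norm (x $ j)))"
proof -
  define D where "D = shifted_sector_prod \<theta> a \<delta>"
  obtain e c where e: "\<And>j. 0 < e j" and c: "0 < c" and
    ev: "\<forall>\<^sub>F x in inf (filtercomap (\<lambda>x. \<Sum>j\<in>UNIV. norm (x $ j)) at_top) (principal D).
       norm (norm (g x)) \<le> c * norm (\<Prod>j\<in>UNIV. norm (x $ j + 1) powr (- 1 - e j))"
  proof -
    obtain e where e: "\<And>j. 0 < e j" and O: "(\<lambda>x. norm (g x)) \<in>
          O[inf (filtercomap (\<lambda>x. \<Sum>j\<in>UNIV. norm (x $ j)) at_top) (principal D)](
            \<lambda>x. \<Prod>j\<in>UNIV. norm (x $ j + 1) powr (- 1 - e j))"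
      using decay unfolding sufficient_decay_def D_def[symmetric] by auto
    from O show ?thesis by (rule landau_o.bigE) (rule that[OF e])
  qed
  from ev obtain R0 where R0: "\<And>x. x \<in> D \<Longrightarrow> R0 \<le> (\<Sum>j\<in>UNIV. norm (x $ j)) \<Longrightarrow>
      norm (g x) \<le> c * (\<Prod>j\<in>UNIV. norm (x $ j + 1) powr (- 1 - e j))"
    unfolding eventually_inf_principal eventually_filtercomap_at_top_linorder
    by (auto simp: prod_nonneg)
  define R where "R = max R0 0"
  define \<epsilon> where "\<epsilon> = Min (range e)"
  have \<epsilon>: "0 < \<epsilon>" "\<epsilon> \<le> e j" for j using e by (auto simp: \<epsilon>_def)
  define C where "C = c * (\<Prod>j\<in>UNIV. 3 powr (1 + e j))"
  have C: "0 \<le> C" using c by (auto simp: C_def intro!: mult_nonneg_nonneg prod_nonneg)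
  have far: "norm (g x) \<le> C * (\<Prod>j\<in>UNIV. weight \<epsilon> (norm (x $ j)))"
    if x: "x \<in> D" "R0 \<le> (\<Sum>j\<in>UNIV. norm (x $ j))" for x
  proof -
    have "norm (x $ j + 1) powr (- 1 - e j) \<le> 3 powr (1 + e j) * weight \<epsilon> (norm (x $ j))" for j
    proof -
      have "1 + norm (x $ j) \<le> 3 * norm (x $ j + 1)"
        using x \<theta> \<delta> by (intro one_add_norm_le[of "\<theta> $ j" \<delta>]) (auto simp: D_def shifted_sector_prod_def)
      then have "(3 * norm (x $ j + 1)) powr (- 1 - e j) \<le> weight (e j) (norm (x $ j))"
        unfolding weight_def using e[of j] by (intro powr_mono2') (auto simp: add_pos_nonneg)
      also have "\<dots> \<le> weight \<epsilon> (norm (x $ j))" by (intro weight_mono_exponent \<epsilon>) auto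
      finally have "3 powr (1 + e j) * (3 powr (- 1 - e j) * norm (x $ j + 1) powr (- 1 - e j))
          \<le> 3 powr (1 + e j) * weight \<epsilon> (norm (x $ j))"
        by (intro mult_left_mono) (auto simp: powr_mult)
      moreover have "3 powr (1 + e j) * 3 powr (- 1 - e j) = (1 :: real)"
        by (simp flip: powr_add)
      ultimately show ?thesis by (simp flip: mult.assoc)
    qed
    then have "(\<Prod>j\<in>UNIV. norm (x $ j + 1) powr (- 1 - e j))
        \<le> (\<Prod>j\<in>UNIV. 3 powr (1 + e j) * weight \<epsilon> (norm (x $ j)))"
      by (intro prod_mono) auto
    then have "c * (\<Prod>j\<in>UNIV. norm (x $ j + 1) powr (- 1 - e j))
        \<le> C * (\<Prod>j\<in>UNIV. weight \<epsilon> (norm (x $ j)))"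
      using c by (simp add: C_def prod.distrib mult.assoc)
    then show ?thesis using R0[OF x] by linarith
  qed
  have "compact (D \<inter> {x. (\<Sum>j\<in>UNIV. norm (x $ j)) \<le> R})"
  proof -
    have "bounded {x :: complex ^ 's. (\<Sum>j\<in>UNIV. norm (x $ j)) \<le> R}"
      unfolding bounded_iff
    proof (intro exI ballI)
      fix x :: "complex ^ 's" assume "x \<in> {x. (\<Sum>j\<in>UNIV. norm (x $ j)) \<le> R}"
      moreover have "norm x \<le> (\<Sum>j\<in>UNIV. norm (x $ j))" unfolding norm_vec_def by (rule L2_set_le_sum) auto
      ultimately show "norm x \<le> R" by simp
    qed
    moreover have "closed (D \<inter> {x. (\<Sum>j\<in>UNIV. norm (x $ j)) \<le> R})"
      unfolding D_def by (intro closed_Int closed_shifted_sector_prod \<theta> closed_Collect_le continuous_intros)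
    ultimately show ?thesis unfolding compact_eq_bounded_closed by (auto intro: bounded_Int)
  qed
  then have "compact (g ` (D \<inter> {x. (\<Sum>j\<in>UNIV. norm (x $ j)) \<le> R}))"
    by (intro compact_continuous_image continuous_on_subset[OF cont]) (auto simp: D_def)
  then have "bounded (g ` (D \<inter> {x. (\<Sum>j\<in>UNIV. norm (x $ j)) \<le> R}))"
    by (rule compact_imp_bounded)
  then obtain M where "\<forall>y\<in>g ` (D \<inter> {x. (\<Sum>j\<in>UNIV. norm (x $ j)) \<le> R}). norm y \<le> M"
    unfolding bounded_iff by (rule exE)
  then have M: "norm (g x) \<le> M" if "x \<in> D" "(\<Sum>j\<in>UNIV. norm (x $ j)) \<le> R" for x
    using that by simp
  define m where "m = (\<Prod>j\<in>(UNIV :: 's set). weight \<epsilon> R)"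
  have m: "0 < m" unfolding m_def by (intro prod_pos weight_pos ballI) (auto simp: R_def)
  have near: "norm (g x) \<le> \<bar>M\<bar> / m * (\<Prod>j\<in>UNIV. weight \<epsilon> (norm (x $ j)))"
    if x: "x \<in> D" "(\<Sum>j\<in>UNIV. norm (x $ j)) \<le> R" for x
  proof -
    have "norm (x $ j) \<le> R" for j
      using x member_le_sum[of j UNIV "\<lambda>j. norm (x $ j)"] by auto
    then have "m \<le> (\<Prod>j\<in>UNIV. weight \<epsilon> (norm (x $ j)))"
      unfolding m_def
    proof (intro prod_mono conjI)
      fix j
      show "0 \<le> weight \<epsilon> R" by (rule less_imp_le[OF weight_pos]) (simp add: R_def)
      show "weight \<epsilon> R \<le> weight \<epsilon> (norm (x $ j))" using \<epsilon>(1) \<open>norm (x $ j) \<le> R\<close> by (intro weight_antimono) auto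
    qed
    then have "\<bar>M\<bar> / m * m \<le> \<bar>M\<bar> / m * (\<Prod>j\<in>UNIV. weight \<epsilon> (norm (x $ j)))"
      using m by (intro mult_left_mono) auto
    then show ?thesis using M[OF x] m by simp
  qed
  have "norm (g x) \<le> max C (\<bar>M\<bar> / m) * (\<Prod>j\<in>UNIV. weight \<epsilon> (norm (x $ j)))" if "x \<in> D" for x
  proof -
    have P: "0 \<le> (\<Prod>j\<in>UNIV. weight \<epsilon> (norm (x $ j)))" by (intro prod_nonneg less_imp_le[OF weight_pos] ballI) auto
    show ?thesis
    proof (cases "(\<Sum>j\<in>UNIV. norm (x $ j)) \<le> R")
      case True
      show ?thesis by (rule order_trans[OF near[OF that True]]) (intro mult_right_mono P, auto)
    next
      case False
      then have *: "R0 \<le> (\<Sum>j\<in>UNIV. norm (x $ j))" by (simp add: R_def)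
      show ?thesis by (rule order_trans[OF far[OF that *]]) (intro mult_right_mono P, auto)
    qed
  qed
  with \<epsilon>(1) show ?thesis using that by (auto simp: D_def)
qed

lemma uniform_decay_bound:
  fixes g :: "'i \<Rightarrow> complex ^ 's \<Rightarrow> complex" and \<theta> a :: "real ^ 's"
  assumes \<theta>: "\<And>j. 0 \<le> \<theta> $ j \<and> \<theta> $ j < pi / 2" and \<delta>: "\<delta> \<le> 1 / 2" and "finite I"
    and cont: "\<And>i. i \<in> I \<Longrightarrow> continuous_on (shifted_sector_prod \<theta> a \<delta>) (g i)"
    and decay: "\<And>i. i \<in> I \<Longrightarrow> sufficient_decay (shifted_sector_prod \<theta> a \<delta>) (g i)"
  shows "\<exists>K \<epsilon>. 0 \<le> K \<and> 0 < \<epsilon> \<and> (\<forall>i\<in>I. \<forall>x\<in>shifted_sector_prod \<theta> a \<delta>.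
    norm (g i x) \<le> K * (\<Prod>j\<in>UNIV. weight \<epsilon> (norm (x $ j))))"
  using \<open>finite I\<close> cont decay
proof (induction I rule: finite_induct)
  case empty
  show ?case by (intro exI[of _ 1]) auto
next
  case (insert i I)
  then obtain K \<epsilon> where K: "0 \<le> K" "0 < \<epsilon>"
    "\<And>i x. i \<in> I \<Longrightarrow> x \<in> shifted_sector_prod \<theta> a \<delta> \<Longrightarrow> norm (g i x) \<le> K * (\<Prod>j\<in>UNIV. weight \<epsilon> (norm (x $ j)))"
    by auto
  obtain K' \<epsilon>' where K': "0 < \<epsilon>'"
    "\<And>x. x \<in> shifted_sector_prod \<theta> a \<delta> \<Longrightarrow> norm (g i x) \<le> K' * (\<Prod>j\<in>UNIV. weight \<epsilon>' (norm (x $ j)))"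
    using sufficient_decay_bound[OF \<theta> \<delta> insert.prems(1)[OF insertI1] insert.prems(2)[OF insertI1]] by blast
  have mono: "A * (\<Prod>j\<in>UNIV. weight e (norm (x $ j))) \<le> max K \<bar>K'\<bar> * (\<Prod>j\<in>UNIV. weight (min \<epsilon> \<epsilon>') (norm (x $ j)))"
    if "A \<le> max K \<bar>K'\<bar>" "min \<epsilon> \<epsilon>' \<le> e" for A e and x :: "complex ^ 's"
    using that K by (intro mult_mono prod_mono conjI weight_mono_exponent prod_nonneg ballI less_imp_le[OF weight_pos]) auto
  show ?case
  proof (intro exI conjI ballI)
    fix k x assume k: "k \<in> insert i I" and x: "x \<in> shifted_sector_prod \<theta> a \<delta>"
    show "norm (g k x) \<le> max K \<bar>K'\<bar> * (\<Prod>j\<in>UNIV. weight (min \<epsilon> \<epsilon>') (norm (x $ j)))"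
    proof (cases "k \<in> I")
      case True
      show ?thesis by (rule order_trans[OF K(3)[OF True x] mono]) auto
    next
      case False
      then have "k = i" using k by simp
      show ?thesis unfolding \<open>k = i\<close> by (rule order_trans[OF K'(2)[OF x] mono]) auto
    qed
  qed (use K K' in auto)
qed

lemma shifted_sector_prod_mono:
  "\<delta> \<le> \<delta>' \<Longrightarrow> shifted_sector_prod \<theta> a \<delta> \<subseteq> shifted_sector_prod \<theta> a \<delta>'"
  unfolding shifted_sector_prod_def by (fastforce intro: order_trans)

lemma sufficient_decay_subset:
  assumes "sufficient_decay D g" "D' \<subseteq> D" shows "sufficient_decay D' g"
proof -
  have "inf (filtercomap (\<lambda>x. \<Sum>j\<in>UNIV. norm (x $ j)) at_top) (principal D')
      \<le> inf (filtercomap (\<lambda>x. \<Sum>j\<in>UNIV. norm (x $ j)) at_top) (principal D)"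
    using assms(2) by (intro inf_mono) auto
  then show ?thesis using assms(1) unfolding sufficient_decay_def
    by (meson landau_o.big.filter_mono)
qed

text \<open>
  In one variable the points outside the sector lie within \<open>\<delta>\<close> of 0, hence for small \<open>\<delta>\<close> in any open set
  that contains the sector, and they do not affect the decay at infinity. In several variables the other
  coordinates may be large at the same time, and the hypothesis for negative shifts is needed. Any
  such \<open>\<delta>\<close> may be decreased.
\<close>
lemma shifted_domain:
  fixes \<theta> a :: "real ^ 's"
  assumes \<theta>: "\<And>j. 0 \<le> \<theta> $ j \<and> \<theta> $ j < pi / 2" and "open \<Omega>" "sector_prod \<theta> \<subseteq> \<Omega>"
    and decay: "\<And>g. g \<in> \<G> \<Longrightarrow> sufficient_decay (sector_prod \<theta>) g"
    and negative_shift: "CARD('s) \<ge> 2 \<Longrightarrow> \<exists>j. a $ j < 0 \<Longrightarrow>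
          \<exists>\<delta>>0. shifted_sector_prod \<theta> a \<delta> \<subseteq> \<Omega> \<and>
            (\<forall>g\<in>\<G>. sufficient_decay (shifted_sector_prod \<theta> a \<delta>) g)"
  obtains \<delta> where "0 < \<delta>" "\<delta> \<le> 1 / 2" "shifted_sector_prod \<theta> a \<delta> \<subseteq> \<Omega>"
    "\<And>g. g \<in> \<G> \<Longrightarrow> sufficient_decay (shifted_sector_prod \<theta> a \<delta>) g"
proof -
  have "\<exists>\<delta>>0. shifted_sector_prod \<theta> a \<delta> \<subseteq> \<Omega> \<and> (\<forall>g\<in>\<G>. sufficient_decay (shifted_sector_prod \<theta> a \<delta>) g)"
  proof -
    have "CARD('s) \<ge> 2 \<or> CARD('s) = 1"
      using zero_less_card_finite[where 'a = 's] by linarith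
    then consider "\<forall>j. \<not> a $ j < 0" | "CARD('s) \<ge> 2" "\<exists>j. a $ j < 0" | "CARD('s) = 1"
      by blast
    then show ?thesis
    proof cases
      case 1
      then have "shifted_sector_prod \<theta> a 1 = sector_prod \<theta>"
        by (auto simp: shifted_sector_prod_def sector_prod_def)
      then show ?thesis using assms by (intro exI[of _ 1]) auto
    next
      case 2
      then show ?thesis by (rule negative_shift)
    next
      case 3
      then obtain i :: 's where i: "\<And>j. j = i" by (auto simp: card_1_singleton_iff)
      then have U: "(UNIV :: 's set) = {i}" by auto
      have "0 \<in> sector_prod \<theta>" using \<theta> by (simp add: sector_prod_def zero_in_sector)
      then have "0 \<in> \<Omega>" using assms(3) by blast
      then obtain \<delta> where \<delta>: "0 < \<delta>" "cball 0 \<delta> \<subseteq> \<Omega>"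
        using \<open>open \<Omega>\<close>[unfolded open_contains_cball, rule_format] by blast
      have sum: "(\<Sum>j\<in>UNIV. norm (x $ j)) = norm (x $ i)" for x :: "complex ^ 's" by (simp add: U)
      have norm: "norm x = norm (x $ i)" for x :: "complex ^ 's"
        unfolding norm_vec_def by (simp add: U L2_set_def)
      have D: "x \<in> sector_prod \<theta> \<or> norm (x $ i) \<le> \<delta>" if "x \<in> shifted_sector_prod \<theta> a \<delta>" for x
      proof (cases "x $ i \<in> sector (\<theta> $ i)")
        case True
        have "x $ j \<in> sector (\<theta> $ j)" for j using True i[of j] by simp
        then show ?thesis by (simp add: sector_prod_def)
      next
        case False
        then show ?thesis using that by (auto simp: shifted_sector_prod_def)
      qed
      have "sufficient_decay (shifted_sector_prod \<theta> a \<delta>) g" if g: "g \<in> \<G>" for g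
      proof -
        have "inf (filtercomap (\<lambda>x. \<Sum>j\<in>UNIV. norm (x $ j)) at_top) (principal (shifted_sector_prod \<theta> a \<delta>))
            \<le> inf (filtercomap (\<lambda>x. \<Sum>j\<in>UNIV. norm (x $ j)) at_top) (principal (sector_prod \<theta>))"
        proof (rule filter_leI)
          fix P assume "eventually P (inf (filtercomap (\<lambda>x. \<Sum>j\<in>UNIV. norm (x $ j)) at_top) (principal (sector_prod \<theta>)))"
          then obtain R where R: "\<And>x. R \<le> (\<Sum>j\<in>UNIV. norm (x $ j)) \<Longrightarrow> x \<in> sector_prod \<theta> \<Longrightarrow> P x"
            unfolding eventually_inf_principal eventually_filtercomap_at_top_linorder by auto
          have "P x" if "max R (\<delta> + 1) \<le> (\<Sum>j\<in>UNIV. norm (x $ j))" "x \<in> shifted_sector_prod \<theta> a \<delta>" for x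
            using that D[OF that(2)] R[of x] by (auto simp: sum)
          then show "eventually P (inf (filtercomap (\<lambda>x. \<Sum>j\<in>UNIV. norm (x $ j)) at_top) (principal (shifted_sector_prod \<theta> a \<delta>)))"
            unfolding eventually_inf_principal eventually_filtercomap_at_top_linorder by blast
        qed
        then show ?thesis using decay[OF g] unfolding sufficient_decay_def
          by (blast intro: landau_o.big.filter_mono)
      qed
      moreover have "shifted_sector_prod \<theta> a \<delta> \<subseteq> \<Omega>"
      proof
        fix x assume "x \<in> shifted_sector_prod \<theta> a \<delta>"
        from D[OF this] show "x \<in> \<Omega>" using \<delta> assms(3) by (auto simp: subset_iff norm)
      qed
      ultimately show ?thesis using \<delta> by blast
    qed
  qed
  then obtain \<delta> where \<delta>: "0 < \<delta>" "shifted_sector_prod \<theta> a \<delta> \<subseteq> \<Omega>"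
    "\<And>g. g \<in> \<G> \<Longrightarrow> sufficient_decay (shifted_sector_prod \<theta> a \<delta>) g" by blast
  show ?thesis
  proof (rule that[of "min \<delta> (1 / 2)"])
    show "shifted_sector_prod \<theta> a (min \<delta> (1 / 2)) \<subseteq> \<Omega>"
      using shifted_sector_prod_mono[of "min \<delta> (1 / 2)" \<delta>] \<delta> by (auto simp: subset_iff)
    show "sufficient_decay (shifted_sector_prod \<theta> a (min \<delta> (1 / 2))) g" if "g \<in> \<G>" for g
      by (rule sufficient_decay_subset[OF \<delta>(3)[OF that]]) (rule shifted_sector_prod_mono, simp)
  qed (use \<delta> in auto)
qed

section \<open>Counting measure on the real line and mixed products\<close>

text \<open>
  The counting measure of the natural numbers, placed on the reals so that summed and integrated
  coordinates can be factors of the same product measure.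
\<close>
definition nat_measure :: "real measure" where
  "nat_measure = distr (count_space (UNIV :: nat set)) borel real"

lemma sets_nat_measure [measurable_cong, simp]: "sets nat_measure = sets borel"
  by (simp add: nat_measure_def)

lemma space_nat_measure [simp]: "space nat_measure = UNIV"
  by (simp add: nat_measure_def)

lemma sigma_finite_nat_measure: "sigma_finite_measure nat_measure"
proof
  have "emeasure nat_measure {..real n} \<noteq> \<infinity>" for n
  proof -
    have "real -` {..real n} \<inter> UNIV = {..n}" by auto
    then show ?thesis by (simp add: nat_measure_def emeasure_distr)
  qed
  moreover have "(\<Union>n. {..real n}) = UNIV"
    using real_arch_simple by (auto simp: set_eq_iff)
  ultimately show "\<exists>A. countable A \<and> A \<subseteq> sets nat_measure \<and> \<Union>A = space nat_measure \<and>
      (\<forall>a\<in>A. emeasure nat_measure a \<noteq> \<infinity>)"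
    by (intro exI[of _ "range (\<lambda>n. {..real n})"]) auto
qed

lemma integrable_nat_measure:
  fixes f :: "real \<Rightarrow> 'a::{banach, second_countable_topology}"
  assumes "f \<in> borel_measurable borel"
  shows "integrable nat_measure f \<longleftrightarrow> summable (\<lambda>m. norm (f (real m)))"
  unfolding nat_measure_def using assms
  by (simp add: integrable_distr_eq integrable_count_space_nat_iff)

lemma integral_nat_measure:
  fixes f :: "real \<Rightarrow> 'a::{banach, second_countable_topology}"
  assumes "f \<in> borel_measurable borel" "summable (\<lambda>m. norm (f (real m)))"
  shows "integral\<^sup>L nat_measure f = (\<Sum>m. f (real m))"
  unfolding nat_measure_def using assms
  by (subst integral_distr) (auto simp: integral_count_space_nat integrable_count_space_nat_iff)

definition mixed_measure :: "'s set \<Rightarrow> 's \<Rightarrow> real measure" where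
  "mixed_measure A k = (if k \<in> A then lborel else nat_measure)"

lemma sets_mixed_measure [measurable_cong, simp]: "sets (mixed_measure A k) = sets borel"
  by (simp add: mixed_measure_def)

lemma space_mixed_measure [simp]: "space (mixed_measure A k) = UNIV"
  by (simp add: mixed_measure_def)

lemma product_sigma_finite_mixed_measure: "product_sigma_finite (mixed_measure A)"
  unfolding product_sigma_finite_def mixed_measure_def
  using sigma_finite_nat_measure sigma_finite_lborel by auto

text \<open>
  The integrability of the inner integral in \<open>product_integral_insert\<close>, by Tonelli's theorem.
\<close>
lemma (in product_sigma_finite) integrable_product_inner:
  fixes f :: "_ \<Rightarrow> _::{banach, second_countable_topology}"
  assumes I: "finite I" "i \<notin> I" and f: "integrable (Pi\<^sub>M (insert i I) M) f"
  shows "integrable (Pi\<^sub>M I M) (\<lambda>x. \<integral>y. f (x(i := y)) \<partial>M i)"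
proof -
  interpret Mi: sigma_finite_measure "M i" by (rule sigma_finite_measures)
  have f_borel [measurable]: "f \<in> borel_measurable (Pi\<^sub>M (insert i I) M)" using f by simp
  have [measurable]: "(\<lambda>(x, y). x(i := y)) \<in> measurable (Pi\<^sub>M I M \<Otimes>\<^sub>M M i) (Pi\<^sub>M (insert i I) M)"
    by (rule measurable_add_dim)
  have meas: "(\<lambda>(x, y). f (x(i := y))) \<in> borel_measurable (Pi\<^sub>M I M \<Otimes>\<^sub>M M i)"
    using measurable_compose[OF measurable_add_dim f_borel] by (simp add: case_prod_beta')
  show ?thesis
    unfolding integrable_iff_bounded
  proof
    show "(\<lambda>x. \<integral>y. f (x(i := y)) \<partial>M i) \<in> borel_measurable (Pi\<^sub>M I M)"
      by (rule sigma_finite_measure.borel_measurable_lebesgue_integral[OF sigma_finite_measures meas])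
    have "(\<integral>\<^sup>+x. ennreal (norm (\<integral>y. f (x(i := y)) \<partial>M i)) \<partial>Pi\<^sub>M I M)
        \<le> (\<integral>\<^sup>+x. (\<integral>\<^sup>+y. ennreal (norm (f (x(i := y)))) \<partial>M i) \<partial>Pi\<^sub>M I M)"
    proof (rule nn_integral_mono)
      fix x
      show "ennreal (norm (\<integral>y. f (x(i := y)) \<partial>M i)) \<le> (\<integral>\<^sup>+y. ennreal (norm (f (x(i := y)))) \<partial>M i)"
        by (cases "integrable (M i) (\<lambda>y. f (x(i := y)))")
          (auto simp: integral_norm_bound_ennreal not_integrable_integral_eq)
    qed
    also have "\<dots> = (\<integral>\<^sup>+x. ennreal (norm (f x)) \<partial>Pi\<^sub>M (insert i I) M)"
      using I by (subst product_nn_integral_insert) auto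
    also have "\<dots> < \<infinity>" using f by (simp add: integrable_iff_bounded)
    finally show "(\<integral>\<^sup>+x. ennreal (norm (\<integral>y. f (x(i := y)) \<partial>M i)) \<partial>Pi\<^sub>M I M) < \<infinity>" .
  qed
qed

text \<open>
  A product of counting measures is the counting measure of the product; both agree on boxes.
\<close>
lemma PiM_nat_measure:
  "distr (count_space (UNIV :: (nat ^ 's) set)) (Pi\<^sub>M UNIV (\<lambda>_. borel)) (\<lambda>m j. real (m $ j))
    = Pi\<^sub>M (UNIV :: 's::finite set) (\<lambda>_. nat_measure)"
proof -
  interpret product_sigma_finite "\<lambda>_ :: 's. nat_measure"
    unfolding product_sigma_finite_def using sigma_finite_nat_measure by simp
  interpret C: product_sigma_finite "\<lambda>_ :: 's. count_space (UNIV :: nat set)"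
    unfolding product_sigma_finite_def using sigma_finite_measure_count_space by simp
  have bij: "bij_betw vec_nth (UNIV :: (nat ^ 's) set) (UNIV :: ('s \<Rightarrow> nat) set)"
    by (rule bij_betwI[where g = vec_lambda]) auto
  have meas: "(\<lambda>m j. real (m $ j)) \<in> measurable (count_space (UNIV :: (nat ^ 's) set)) (Pi\<^sub>M UNIV (\<lambda>_. borel))"
    by (simp add: space_PiM)
  show ?thesis
  proof (rule PiM_eqI)
    show "sets (distr (count_space (UNIV :: (nat ^ 's) set)) (Pi\<^sub>M UNIV (\<lambda>_. borel)) (\<lambda>m j. real (m $ j)))
        = sets (Pi\<^sub>M UNIV (\<lambda>_. nat_measure))"
      by (simp add: sets_PiM_cong[OF refl sets_nat_measure])
  next
    fix A :: "'s \<Rightarrow> real set" assume A: "\<And>i. i \<in> UNIV \<Longrightarrow> A i \<in> sets nat_measure"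
    then have A': "Pi\<^sub>E UNIV A \<in> sets (Pi\<^sub>M UNIV (\<lambda>_. borel))"
      by (intro sets_PiM_I_finite) auto
    have "emeasure (distr (count_space UNIV) (Pi\<^sub>M UNIV (\<lambda>_. borel)) (\<lambda>m j. real (m $ j))) (Pi\<^sub>E UNIV A)
        = emeasure (count_space (UNIV :: (nat ^ 's) set)) (vec_nth -` (Pi\<^sub>E UNIV (\<lambda>j. real -` A j)))"
      by (subst emeasure_distr[OF meas A']) (auto intro!: arg_cong[of _ _ "emeasure _"] simp: PiE_iff)
    also have "\<dots> = emeasure (distr (count_space UNIV) (count_space UNIV) vec_nth) (Pi\<^sub>E UNIV (\<lambda>j. real -` A j))"
      by (subst emeasure_distr) auto
    also have "\<dots> = emeasure (count_space (UNIV :: ('s \<Rightarrow> nat) set)) (Pi\<^sub>E UNIV (\<lambda>j. real -` A j))"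
      by (simp add: distr_bij_count_space[OF bij])
    also have "count_space (UNIV :: ('s \<Rightarrow> nat) set) = Pi\<^sub>M UNIV (\<lambda>_. count_space UNIV)"
      by (subst count_space_PiM_finite) (auto simp: PiE_UNIV_domain)
    also have "emeasure \<dots> (Pi\<^sub>E UNIV (\<lambda>j. real -` A j)) = (\<Prod>j\<in>UNIV. emeasure (count_space UNIV) (real -` A j))"
      by (rule C.emeasure_PiM) auto
    also have "\<dots> = (\<Prod>j\<in>UNIV. emeasure nat_measure (A j))"
      using A by (intro prod.cong refl) (simp add: nat_measure_def emeasure_distr)
    finally show "emeasure (distr (count_space (UNIV :: (nat ^ 's) set)) (Pi\<^sub>M UNIV (\<lambda>_. borel)) (\<lambda>m j. real (m $ j))) (Pi\<^sub>E UNIV A)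
        = (\<Prod>j\<in>UNIV. emeasure nat_measure (A j))" .
  qed simp
qed

lemma infsum_vec_eq_integral:
  fixes f :: "('s::finite \<Rightarrow> real) \<Rightarrow> complex"
  assumes "integrable (Pi\<^sub>M UNIV (\<lambda>_. nat_measure)) f"
  shows "(\<lambda>m :: nat ^ 's. f (\<lambda>j. real (m $ j))) summable_on UNIV"
    and "(\<Sum>\<^sub>\<infinity>m :: nat ^ 's. f (\<lambda>j. real (m $ j))) = integral\<^sup>L (Pi\<^sub>M UNIV (\<lambda>_. nat_measure)) f"
proof -
  have meas: "(\<lambda>m j. real (m $ j)) \<in> measurable (count_space (UNIV :: (nat ^ 's) set)) (Pi\<^sub>M UNIV (\<lambda>_. borel))"
    by (simp add: space_PiM)
  have eq: "Pi\<^sub>M UNIV (\<lambda>_. nat_measure) =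
      distr (count_space (UNIV :: (nat ^ 's) set)) (Pi\<^sub>M UNIV (\<lambda>_. borel)) (\<lambda>m j. real (m $ j))"
    by (rule PiM_nat_measure[symmetric])
  have f: "f \<in> borel_measurable (Pi\<^sub>M UNIV (\<lambda>_. borel))"
    using borel_measurable_integrable[OF assms] unfolding eq by simp
  have "integrable (count_space (UNIV :: (nat ^ 's) set)) (\<lambda>m. f (\<lambda>j. real (m $ j)))"
    using assms unfolding eq by (simp add: integrable_distr_eq[OF meas f])
  then have abs: "Infinite_Set_Sum.abs_summable_on (\<lambda>m :: nat ^ 's. f (\<lambda>j. real (m $ j))) UNIV"
    by (simp add: Infinite_Set_Sum.abs_summable_on_def)
  then show "(\<lambda>m :: nat ^ 's. f (\<lambda>j. real (m $ j))) summable_on UNIV"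
    by (simp add: abs_summable_equivalent abs_summable_summable)
  show "(\<Sum>\<^sub>\<infinity>m :: nat ^ 's. f (\<lambda>j. real (m $ j))) = integral\<^sup>L (Pi\<^sub>M UNIV (\<lambda>_. nat_measure)) f"
    unfolding infsetsum_infsum[OF abs, symmetric] infsetsum_def eq integral_distr[OF meas f] ..
qed

section \<open>Replacing sums by integrals one coordinate at a time\<close>

lemma sum_PiE_insert:
  assumes "finite S" "k \<notin> S"
  shows "(\<Sum>n\<in>(\<Pi>\<^sub>E j\<in>insert k S. B). g n) = (\<Sum>n\<in>(\<Pi>\<^sub>E j\<in>S. B). \<Sum>p\<in>B. g (n(k := p)))"
proof -
  have "(\<Sum>n\<in>(\<Pi>\<^sub>E j\<in>insert k S. B). g n) = (\<Sum>(p, n)\<in>B \<times> (\<Pi>\<^sub>E j\<in>S. B). g (n(k := p)))"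
    unfolding PiE_insert_eq using inj_combinator[OF assms(2), of "\<lambda>_. B"]
    by (subst sum.reindex) (auto simp: case_prod_beta' o_def)
  also have "\<dots> = (\<Sum>p\<in>B. \<Sum>n\<in>(\<Pi>\<^sub>E j\<in>S. B). g (n(k := p)))"
    by (simp add: sum.cartesian_product)
  also have "\<dots> = (\<Sum>n\<in>(\<Pi>\<^sub>E j\<in>S. B). \<Sum>p\<in>B. g (n(k := p)))"
    by (rule sum.swap)
  finally show ?thesis .
qed

lemma sum_Pow_insert:
  assumes "finite A" "k \<notin> A"
  shows "(\<Sum>S\<in>Pow (insert k A). g S) = (\<Sum>S\<in>Pow A. g S + g (insert k S))"
proof -
  have "(\<Sum>S\<in>Pow (insert k A). g S) = (\<Sum>S\<in>Pow A. g S) + (\<Sum>S\<in>insert k ` Pow A. g S)"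
    unfolding Pow_insert using assms by (intro sum.union_disjoint) auto
  also have "(\<Sum>S\<in>insert k ` Pow A. g S) = (\<Sum>S\<in>Pow A. g (insert k S))"
    using assms by (subst sum.reindex) (auto simp: inj_on_def o_def insert_ident)
  finally show ?thesis by (simp add: sum.distrib)
qed

text \<open>
  The situation after the preparations above: all derivatives up to order \<open>N + 1\<close> in each variable
  have a common bound on the shifted sectors. The expansion contains the orders below \<open>N\<close>; order \<open>N\<close>
  is the first omitted term, and order \<open>N + 1\<close> bounds the Taylor remainder.
\<close>
locale decaying_holomorphic =
  fixes f :: "complex ^ ('s::{finite,linorder}) \<Rightarrow> complex" and \<Omega> :: "(complex ^ ('s::{finite,linorder})) set"
    and \<theta> a :: "real ^ ('s::{finite,linorder})" and \<delta> K \<epsilon> :: real and N :: nat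
  assumes theta: "\<And>j. 0 \<le> \<theta> $ j \<and> \<theta> $ j < pi / 2"
    and open_domain: "open \<Omega>" and sep_holomorphic: "sep_holomorphic f \<Omega>"
    and domain: "shifted_sector_prod \<theta> a \<delta> \<subseteq> \<Omega>"
    and K_nonneg: "0 \<le> K" and eps_pos: "0 < \<epsilon>"
    and deriv_bound: "\<And>n x. (\<And>j. n j \<le> Suc N) \<Longrightarrow> x \<in> shifted_sector_prod \<theta> a \<delta> \<Longrightarrow>
      norm (mixed_deriv UNIV n f x) \<le> K * (\<Prod>j\<in>UNIV. weight \<epsilon> (norm (x $ j)))"
begin

abbreviation "D \<equiv> shifted_sector_prod \<theta> a \<delta>"

lemma mixed_deriv_bound:
  assumes "\<And>j. j \<in> S \<Longrightarrow> n j \<le> Suc N" "x \<in> D"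
  shows "norm (mixed_deriv S n f x) \<le> K * (\<Prod>j\<in>UNIV. weight \<epsilon> (norm (x $ j)))"
  unfolding mixed_deriv_extend[of S n f] using assms by (intro deriv_bound) auto

text \<open>
  For these \<open>w\<close> all points \<open>w (m + a)\<close> lie in the shifted sectors (\<open>shifted_ray_cases\<close>).
\<close>
definition admissible :: "complex \<Rightarrow> bool" where
  "admissible w \<longleftrightarrow> w \<noteq> 0 \<and> norm w \<le> 1 \<and> (\<forall>j. w \<in> sector (\<theta> $ j)) \<and> (\<forall>j. norm w * \<bar>a $ j\<bar> \<le> \<delta>)"

text \<open>
  The point at which the function is evaluated when the coordinates in \<open>S\<close> have been replaced
  by derivatives at 0, those in \<open>A - S\<close> are integrated and all others are summed.
\<close>
definition sample :: "complex \<Rightarrow> 's set \<Rightarrow> 's set \<Rightarrow> ('s \<Rightarrow> real) \<Rightarrow> complex ^ ('s::{finite,linorder})" where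
  "sample w S A t = (\<chi> k. if k \<in> S then 0 else if k \<in> A then of_real (t k) else w * of_real (t k + a $ k))"

lemma shifted_ray_cases:
  assumes "admissible w" "min (a $ k) 0 \<le> t"
  shows "w * of_real t \<in> sector (\<theta> $ k) \<or>
    (a $ k < 0 \<and> - (w * of_real t) \<in> sector (\<theta> $ k) \<and> norm (w * of_real t) \<le> \<delta>)"
proof (cases "0 \<le> t")
  case True
  then show ?thesis using assms scaled_in_sector[of w "\<theta> $ k" t] by (simp add: admissible_def)
next
  case False
  then have "\<bar>t\<bar> \<le> \<bar>a $ k\<bar>" "a $ k < 0" using assms by auto
  moreover from this have "norm w * \<bar>t\<bar> \<le> norm w * \<bar>a $ k\<bar>" by (intro mult_left_mono) auto
  moreover have "norm w * \<bar>a $ k\<bar> \<le> \<delta>" using assms by (simp add: admissible_def)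
  moreover have "w * of_real (- t) \<in> sector (\<theta> $ k)"
    using False assms by (intro scaled_in_sector) (auto simp: admissible_def)
  ultimately show ?thesis by (auto simp: norm_mult)
qed

lemma sample_in_domain:
  assumes "admissible w" "\<And>k. k \<notin> S \<Longrightarrow> 0 \<le> t k"
  shows "sample w S A t \<in> D"
  unfolding shifted_sector_prod_def
proof (intro CollectI allI)
  fix k
  show "sample w S A t $ k \<in> sector (\<theta> $ k) \<or>
    (a $ k < 0 \<and> - (sample w S A t $ k) \<in> sector (\<theta> $ k) \<and> norm (sample w S A t $ k) \<le> \<delta>)"
    using shifted_ray_cases[OF assms(1), of k "t k + a $ k"] assms(2)[of k] theta[of k]
    by (auto simp: sample_def zero_in_sector of_real_in_sector)
qed

definition shift_const :: real where
  "shift_const = (1 + (\<Sum>j\<in>UNIV. \<bar>a $ j\<bar>)) powr (1 + \<epsilon>)"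

lemma shift_const_ge_1: "1 \<le> shift_const"
  unfolding shift_const_def using eps_pos by (intro ge_one_powr_ge_zero) (auto intro: sum_nonneg)

text \<open>
  A product majorant of the integrand. The coordinate \<open>w (t + a)\<close> of a sampled point is compared
  with \<open>\<bar>w\<bar> t\<close> by \<open>weight_shift\<close>; the common constant \<open>shift_const\<close> covers all coordinates.
\<close>
definition majorant :: "complex \<Rightarrow> 's set \<Rightarrow> 's \<Rightarrow> real \<Rightarrow> real" where
  "majorant w A k t = indicator {0..} t * (shift_const * weight \<epsilon> ((if k \<in> A then 1 else norm w) * t))"

lemma majorant_nonneg: "0 \<le> majorant w A k t"
  unfolding majorant_def using shift_const_ge_1
  by (auto simp: indicator_def intro!: mult_nonneg_nonneg less_imp_le[OF weight_pos])

lemma weight_sample: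
  assumes "admissible w" "k \<notin> S" "0 \<le> t k"
  shows "weight \<epsilon> (norm (sample w S A t $ k)) \<le> majorant w A k (t k)"
proof (cases "k \<in> A")
  case True
  then show ?thesis
    using assms mult_right_mono[OF shift_const_ge_1, of "weight \<epsilon> (t k)"] weight_pos[of "t k" \<epsilon>]
    by (simp add: sample_def majorant_def)
next
  case False
  have "weight \<epsilon> (norm w * \<bar>t k + a $ k\<bar>) \<le> (1 + (\<Sum>j\<in>UNIV. \<bar>a $ j\<bar>)) powr (1 + \<epsilon>) * weight \<epsilon> (norm w * t k)"
    using assms eps_pos member_le_sum[of k UNIV "\<lambda>j. \<bar>a $ j\<bar>"]
    by (intro weight_shift) (auto simp: admissible_def intro: sum_nonneg)
  then show ?thesis using False assms by (simp add: sample_def majorant_def shift_const_def norm_mult flip: of_real_add)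
qed

text \<open>
  The coordinates in \<open>S\<close> vanish and have weight 1.
\<close>
lemma prod_weight_sample:
  assumes "admissible w" "\<And>k. k \<notin> S \<Longrightarrow> 0 \<le> t k"
  shows "(\<Prod>k\<in>UNIV. weight \<epsilon> (norm (sample w S A t $ k))) \<le> (\<Prod>k\<in>-S. majorant w A k (t k))"
proof -
  have "(\<Prod>k\<in>UNIV. weight \<epsilon> (norm (sample w S A t $ k)))
      = (\<Prod>k\<in>-S. weight \<epsilon> (norm (sample w S A t $ k)))"
    by (intro prod.mono_neutral_right) (auto simp: sample_def weight_def)
  also have "\<dots> \<le> (\<Prod>k\<in>-S. majorant w A k (t k))"
    using assms by (intro prod_mono conjI weight_sample less_imp_le[OF weight_pos]) auto
  finally show ?thesis .
qed

definition majorant_const :: real where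
  "majorant_const = shift_const * (1 + 1 / \<epsilon>)"

lemma majorant_const_pos: "0 < majorant_const"
  unfolding majorant_const_def using shift_const_ge_1 eps_pos by (intro mult_pos_pos) (auto simp: add_pos_pos)

lemma borel_measurable_majorant [measurable]: "majorant w A k \<in> borel_measurable borel"
  unfolding majorant_def weight_def by measurable

text \<open>
  An integrated coordinate contributes a constant, a summed one a factor of order \<open>1 / \<bar>w\<bar>\<close>.
\<close>
lemma majorant_integral:
  assumes "admissible w"
  shows "integrable (mixed_measure A k) (majorant w A k)"
    and "integral\<^sup>L (mixed_measure A k) (majorant w A k) \<le> majorant_const * (if k \<in> A then 1 else 1 / norm w)"
proof -
  have w: "0 < norm w" "norm w \<le> 1" using assms by (auto simp: admissible_def)
  have "integrable (mixed_measure A k) (majorant w A k) \<and>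
    integral\<^sup>L (mixed_measure A k) (majorant w A k) \<le> majorant_const * (if k \<in> A then 1 else 1 / norm w)"
  proof (cases "k \<in> A")
    case True
    then have eq: "majorant w A k = (\<lambda>t. shift_const * (indicator {0..} t *\<^sub>R weight \<epsilon> (1 * t)))"
      by (auto simp: majorant_def)
    have int: "integrable lborel (\<lambda>t. indicator {0..} t *\<^sub>R weight \<epsilon> (1 * t))"
      "(\<integral>t. indicator {0..} t *\<^sub>R weight \<epsilon> (1 * t) \<partial>lborel) = 1 / \<epsilon>"
      using weight_integral[OF eps_pos, of 1] by (auto simp: set_integrable_def set_lebesgue_integral_def)
    have "integral\<^sup>L lborel (majorant w A k) = shift_const * (1 / \<epsilon>)"
      unfolding eq by (subst integral_mult_right_zero) (simp only: int)
    moreover have "integrable lborel (majorant w A k)"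
      unfolding eq by (intro integrable_mult_right int)
    ultimately show ?thesis
      using True shift_const_ge_1 by (simp add: mixed_measure_def majorant_const_def algebra_simps)
  next
    case False
    have eq: "majorant w A k (real m) = shift_const * weight \<epsilon> (norm w * real m)" for m
      using False by (simp add: majorant_def)
    have norm_eq: "norm (majorant w A k (real m)) = shift_const * weight \<epsilon> (norm w * real m)" for m
      using majorant_nonneg[of w A k "real m"] by (simp add: eq)
    have sum: "summable (\<lambda>m. shift_const * weight \<epsilon> (norm w * real m))"
      by (intro summable_mult weight_sum eps_pos w)
    have sum': "summable (\<lambda>m. norm (majorant w A k (real m)))"
      using sum by (simp only: norm_eq)
    have "integral\<^sup>L nat_measure (majorant w A k) = (\<Sum>m. shift_const * weight \<epsilon> (norm w * real m))"
      by (subst integral_nat_measure[OF borel_measurable_majorant sum']) (simp only: eq)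
    also have "\<dots> = shift_const * (\<Sum>m. weight \<epsilon> (norm w * real m))"
      by (intro suminf_mult weight_sum eps_pos w)
    also have "\<dots> \<le> shift_const * (1 + 1 / (\<epsilon> * norm w))"
      using weight_sum(2)[OF eps_pos w(1)] shift_const_ge_1 by (intro mult_left_mono) auto
    also have "\<dots> \<le> shift_const * ((1 + 1 / \<epsilon>) * (1 / norm w))"
      using w eps_pos shift_const_ge_1 by (intro mult_left_mono) (auto simp: field_simps)
    finally show ?thesis
      using False sum' by (simp add: mixed_measure_def majorant_const_def integrable_nat_measure mult.assoc)
  qed
  then show "integrable (mixed_measure A k) (majorant w A k)"
    and "integral\<^sup>L (mixed_measure A k) (majorant w A k) \<le> majorant_const * (if k \<in> A then 1 else 1 / norm w)"
    by auto
qed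

abbreviation box :: "'s set \<Rightarrow> ('s \<Rightarrow> real) set" where
  "box I \<equiv> (\<Pi>\<^sub>E k\<in>I. {0..})"

lemma integrable_prod_majorant:
  assumes "admissible w"
  shows "integrable (Pi\<^sub>M I (mixed_measure A)) (\<lambda>t. \<Prod>k\<in>I. majorant w A k (t k))"
proof -
  interpret product_sigma_finite "mixed_measure A" by (rule product_sigma_finite_mixed_measure)
  show ?thesis using assms by (intro product_integrable_prod majorant_integral) auto
qed

lemma integral_prod_majorant:
  assumes "admissible w"
  shows "(\<integral>t. (\<Prod>k\<in>I. majorant w A k (t k)) \<partial>Pi\<^sub>M I (mixed_measure A))
    \<le> majorant_const ^ card I / norm w ^ card (I - A)"
proof -
  interpret product_sigma_finite "mixed_measure A" by (rule product_sigma_finite_mixed_measure)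
  have "(\<integral>t. (\<Prod>k\<in>I. majorant w A k (t k)) \<partial>Pi\<^sub>M I (mixed_measure A))
      = (\<Prod>k\<in>I. integral\<^sup>L (mixed_measure A k) (majorant w A k))"
    using assms by (intro product_integral_prod majorant_integral) auto
  also have "\<dots> \<le> (\<Prod>k\<in>I. majorant_const * (if k \<in> A then 1 else 1 / norm w))"
    using assms by (intro prod_mono conjI majorant_integral integral_nonneg_AE) (auto simp: majorant_nonneg)
  also have "\<dots> = majorant_const ^ card I / norm w ^ card (I - A)"
  proof -
    have "(\<Prod>k\<in>I. if k \<in> A then 1 else 1 / norm w) = (\<Prod>k\<in>I - A. 1 / norm w)"
      by (intro prod.mono_neutral_cong_right) auto
    then show ?thesis by (simp add: prod.distrib power_divide)
  qed
  finally show ?thesis .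
qed

definition integrand :: "complex \<Rightarrow> 's set \<Rightarrow> 's set \<Rightarrow> ('s \<Rightarrow> nat) \<Rightarrow> ('s \<Rightarrow> real) \<Rightarrow> complex" where
  "integrand w A S n t = indicator (box (- S)) t *\<^sub>R mixed_deriv S n f (sample w S A t)"

definition sum_integral :: "complex \<Rightarrow> 's set \<Rightarrow> 's set \<Rightarrow> ('s \<Rightarrow> nat) \<Rightarrow> complex" where
  "sum_integral w A S n = integral\<^sup>L (Pi\<^sub>M (- S) (mixed_measure A)) (integrand w A S n)"

lemma borel_measurable_sample:
  "sample w S A \<in> borel_measurable (Pi\<^sub>M (- S) (mixed_measure A))"
proof -
  have comp: "(\<lambda>t. sample w S A t $ k) \<in> borel_measurable (Pi\<^sub>M (- S) (mixed_measure A))" for k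
  proof (cases "k \<in> S")
    case False
    have "(\<lambda>t. t k) \<in> measurable (Pi\<^sub>M (- S) (mixed_measure A)) (mixed_measure A k)"
      using False by (intro measurable_component_singleton) auto
    then have [measurable]: "(\<lambda>t. t k) \<in> borel_measurable (Pi\<^sub>M (- S) (mixed_measure A))"
      by (simp only: measurable_cong_sets[OF refl sets_mixed_measure])
    show ?thesis unfolding sample_def using False by simp
  qed (simp add: sample_def)
  show ?thesis
    unfolding borel_measurable_euclidean_space[of "sample w S A"]
  proof
    fix b :: "complex ^ ('s::{finite,linorder})" assume "b \<in> Basis"
    then obtain k u where b: "b = axis k u" by (auto simp: Basis_vec_def)
    show "(\<lambda>t. sample w S A t \<bullet> b) \<in> borel_measurable (Pi\<^sub>M (- S) (mixed_measure A))"
      unfolding b inner_axis using comp[of k] by simp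
  qed
qed

lemma box_sets: "box I \<in> sets (Pi\<^sub>M I (mixed_measure A))"
  by (intro sets_PiM_I_finite) auto

text \<open>
  Outside \<open>\<Omega>\<close> nothing is known about \<open>f\<close>. The indicator of the box restricts to parameters whose
  sample points lie in \<open>\<Omega>\<close>, so that multiplication by the indicator of \<open>\<Omega>\<close>
  changes nothing.
\<close>
lemma borel_measurable_integrand:
  assumes "admissible w"
  shows "integrand w A S n \<in> borel_measurable (Pi\<^sub>M (- S) (mixed_measure A))"
proof -
  have "continuous_on \<Omega> (mixed_deriv S n f)"
    using sep_holomorphic_mixed_deriv[OF sep_holomorphic open_domain, of S n] by (simp add: sep_holomorphic_def)
  then have "(\<lambda>x. indicator \<Omega> x *\<^sub>R mixed_deriv S n f x) \<in> borel_measurable borel"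
    using open_domain by (intro borel_measurable_continuous_on_indicator) auto
  note meas = measurable_compose[OF borel_measurable_sample this]
  have "(\<lambda>t. indicator (box (- S)) t *\<^sub>R (indicator \<Omega> (sample w S A t) *\<^sub>R mixed_deriv S n f (sample w S A t)))
      \<in> borel_measurable (Pi\<^sub>M (- S) (mixed_measure A))"
    by (rule borel_measurable_scaleR[OF borel_measurable_indicator[OF box_sets] meas])
  also have "(\<lambda>t. indicator (box (- S)) t *\<^sub>R (indicator \<Omega> (sample w S A t) *\<^sub>R mixed_deriv S n f (sample w S A t)))
      = integrand w A S n"
  proof
    fix t
    show "indicator (box (- S)) t *\<^sub>R (indicator \<Omega> (sample w S A t) *\<^sub>R mixed_deriv S n f (sample w S A t))
      = integrand w A S n t"
    proof (cases "t \<in> box (- S)")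
      case True
      then have "0 \<le> t k" if "k \<notin> S" for k using that by (auto simp: PiE_iff)
      then have "sample w S A t \<in> \<Omega>" using sample_in_domain[OF assms, of S t A] domain by blast
      then show ?thesis by (simp add: integrand_def)
    qed (simp add: integrand_def)
  qed
  finally show ?thesis .
qed

lemma integrand_bound:
  assumes "admissible w" "\<And>j. j \<in> S \<Longrightarrow> n j \<le> Suc N"
  shows "norm (integrand w A S n t) \<le> K * (\<Prod>k\<in>-S. majorant w A k (t k))"
proof (cases "t \<in> box (- S)")
  case True
  then have t: "0 \<le> t k" if "k \<notin> S" for k using that by (auto simp: PiE_iff)
  have "norm (integrand w A S n t) \<le> K * (\<Prod>j\<in>UNIV. weight \<epsilon> (norm (sample w S A t $ j)))"
    using mixed_deriv_bound[OF assms(2) sample_in_domain[OF assms(1) t]] True by (simp add: integrand_def)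
  also have "\<dots> \<le> K * (\<Prod>k\<in>-S. majorant w A k (t k))"
    using t by (intro mult_left_mono prod_weight_sample assms K_nonneg) auto
  finally show ?thesis .
next
  case False
  then show ?thesis using K_nonneg
    by (auto simp: integrand_def intro!: mult_nonneg_nonneg prod_nonneg majorant_nonneg)
qed

lemma integrable_integrand:
  assumes "admissible w" "\<And>j. j \<in> S \<Longrightarrow> n j \<le> Suc N"
  shows "integrable (Pi\<^sub>M (- S) (mixed_measure A)) (integrand w A S n)"
proof (rule Bochner_Integration.integrable_bound)
  show "integrable (Pi\<^sub>M (- S) (mixed_measure A)) (\<lambda>t. K * (\<Prod>k\<in>-S. majorant w A k (t k)))"
    by (intro integrable_mult_right integrable_prod_majorant assms)
  show "integrand w A S n \<in> borel_measurable (Pi\<^sub>M (- S) (mixed_measure A))"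
    by (rule borel_measurable_integrand[OF assms(1)])
  show "AE t in Pi\<^sub>M (- S) (mixed_measure A). norm (integrand w A S n t) \<le> norm (K * (\<Prod>k\<in>-S. majorant w A k (t k)))"
  proof (intro always_eventually allI)
    fix t
    show "norm (integrand w A S n t) \<le> norm (K * (\<Prod>k\<in>-S. majorant w A k (t k)))"
      unfolding real_norm_def by (rule order_trans[OF integrand_bound[OF assms] abs_ge_self])
  qed
qed

definition ray_const :: "'s \<Rightarrow> real" where
  "ray_const k = \<bar>bernoulli_coeff (Suc N) (a $ k)\<bar>
    + remainder_const (a $ k) N * ((2 + \<bar>a $ k\<bar>) powr (1 + \<epsilon>) * (1 + 1 / \<epsilon>))"

lemma ray_const_nonneg: "0 \<le> ray_const k"
  unfolding ray_const_def using eps_pos by (intro add_nonneg_nonneg mult_nonneg_nonneg remainder_const_nonneg) auto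

lemma vec_upd_in_domain:
  assumes "x \<in> D"
    "z \<in> sector (\<theta> $ k) \<or> (a $ k < 0 \<and> - z \<in> sector (\<theta> $ k) \<and> norm z \<le> \<delta>)"
  shows "vec_upd x k z \<in> D"
  using assms by (simp add: shifted_sector_prod_def vec_upd_nth)

text \<open>
  The \<open>p\<close>-th derivative of the current integrand as a function of its \<open>k\<close>-th coordinate. Since \<open>k\<close> is
  not among the parameters of the remaining integral, \<open>t k\<close> is reset to 0; the value is overwritten
  by \<open>z\<close>.
\<close>
definition slice ::
    "complex \<Rightarrow> 's set \<Rightarrow> 's set \<Rightarrow> ('s \<Rightarrow> nat) \<Rightarrow> ('s \<Rightarrow> real) \<Rightarrow> 's \<Rightarrow> nat \<Rightarrow> complex \<Rightarrow> complex" where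
  "slice w A S n t k p z =
     mixed_deriv (insert k S) (n(k := p)) f (vec_upd (sample w S A (t(k := 0))) k z)"

text \<open>
  The one-variable theorem for a slice. Its decay bound is the product majorant in the other
  coordinates, which makes the error integrable with respect to them.
\<close>
lemma euler_maclaurin_slice:
  assumes w: "admissible w" and k: "k \<notin> A" "S \<subseteq> A" "\<And>j. j \<in> A \<Longrightarrow> k < j"
    and n: "\<And>j. j \<in> S \<Longrightarrow> n j \<le> Suc N" and t: "\<And>j. j \<notin> insert k S \<Longrightarrow> 0 \<le> t j"
  shows "norm ((\<Sum>m. slice w A S n t k 0 (w * of_real (real m + a $ k))) - (LINT y:{0..}|lborel. slice w A S n t k 0 (of_real y)) / w
      + (\<Sum>p<N. of_real (bernoulli_coeff (Suc p) (a $ k)) * w ^ p * slice w A S n t k p 0))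
    \<le> ray_const k * (K * (\<Prod>j\<in>-insert k S. majorant w A j (t j))) * norm w ^ N"
  unfolding ray_const_def
proof (rule euler_maclaurin_ray(2)[where \<theta> = "\<theta> $ k"])
  define x where "x = sample w S A (t(k := 0))"
  have x: "x \<in> D" unfolding x_def using t by (intro sample_in_domain w) auto
  have mem: "vec_upd x k z \<in> D"
    if "z \<in> sector (\<theta> $ k) \<union> (\<lambda>t. w * of_real t) ` {a $ k..0}" for z
  proof (rule vec_upd_in_domain[OF x])
    show "z \<in> sector (\<theta> $ k) \<or> (a $ k < 0 \<and> - z \<in> sector (\<theta> $ k) \<and> norm z \<le> \<delta>)"
      using that
    proof
      assume "z \<in> (\<lambda>t. w * of_real t) ` {a $ k..0}"
      then obtain u where u: "z = w * of_real u" "u \<in> {a $ k..0}" by (rule imageE)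
      then have "min (a $ k) 0 \<le> u" by simp
      from shifted_ray_cases[OF w this] show ?thesis by (simp only: u)
    qed simp
  qed
  have least: "k < j" if "j \<in> S" for j using k that by auto
  {
    fix p z assume z: "z \<in> sector (\<theta> $ k) \<union> (\<lambda>t. w * of_real t) ` {a $ k..0}"
    have "((\<lambda>z. mixed_deriv (insert k S) (n(k := p)) f (vec_upd x k z)) has_field_derivative
        partial_deriv k (mixed_deriv (insert k S) (n(k := p)) f) (vec_upd x k z)) (at z)"
      using mem[OF z] domain
      by (intro has_field_derivative_slice[of _ \<Omega>] sep_holomorphic_mixed_deriv sep_holomorphic open_domain) auto
    then show "(slice w A S n t k p has_field_derivative slice w A S n t k (Suc p) z) (at z)"
      by (simp add: slice_def[abs_def] x_def mixed_deriv_insert_least[OF least])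
  next
    fix p z assume p: "p \<le> Suc N" and z: "z \<in> sector (\<theta> $ k) \<union> (\<lambda>t. w * of_real t) ` {a $ k..0}"
    have "norm (slice w A S n t k p z) \<le> K * (\<Prod>j\<in>UNIV. weight \<epsilon> (norm (vec_upd x k z $ j)))"
      unfolding slice_def x_def[symmetric] using n p by (intro mixed_deriv_bound mem z) auto
    also have "(\<Prod>j\<in>UNIV. weight \<epsilon> (norm (vec_upd x k z $ j)))
        = weight \<epsilon> (norm z) * (\<Prod>j\<in>UNIV - {k}. weight \<epsilon> (norm (x $ j)))"
      by (subst prod.remove[of UNIV k]) (auto simp: vec_upd_nth intro!: prod.cong)
    also have "(\<Prod>j\<in>UNIV - {k}. weight \<epsilon> (norm (x $ j))) = (\<Prod>j\<in>-insert k S. weight \<epsilon> (norm (x $ j)))"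
      by (intro prod.mono_neutral_right) (auto simp: x_def sample_def weight_def)
    also have "K * (weight \<epsilon> (norm z) * (\<Prod>j\<in>-insert k S. weight \<epsilon> (norm (x $ j))))
        \<le> K * (weight \<epsilon> (norm z) * (\<Prod>j\<in>-insert k S. majorant w A j (t j)))"
    proof (intro mult_left_mono prod_mono conjI K_nonneg less_imp_le[OF weight_pos])
      fix j assume "j \<in> - insert k S"
      then show "weight \<epsilon> (norm (x $ j)) \<le> majorant w A j (t j)"
        using weight_sample[OF w, of j S "t(k := 0)" A] t[of j] by (simp add: x_def)
    qed auto
    finally show "norm (slice w A S n t k p z) \<le> K * (\<Prod>j\<in>-insert k S. majorant w A j (t j)) * weight \<epsilon> (norm z)"
      by (simp add: mult_ac)
  }
qed (use theta w eps_pos in \<open>auto simp: admissible_def\<close>)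

text \<open>
  The summed, the integrated and the differentiated version of coordinate \<open>k\<close> are the same slice,
  evaluated at \<open>w (y + a)\<close>, at \<open>y\<close> and, with its derivatives, at 0.
\<close>
lemma integrand_slice:
  assumes w: "admissible w" and k: "k \<notin> A" "S \<subseteq> A" "\<And>j. j \<in> A \<Longrightarrow> k < j"
    and t: "t \<in> extensional (- insert k S)"
  shows "integrand w A S n (t(k := y))
      = indicator (box (- insert k S)) t *\<^sub>R (indicator {0..} y *\<^sub>R slice w A S n t k 0 (w * of_real (y + a $ k)))"
    and "integrand w (insert k A) S n (t(k := y))
      = indicator (box (- insert k S)) t *\<^sub>R (indicator {0..} y *\<^sub>R slice w A S n t k 0 (of_real y))"
    and "integrand w (insert k A) (insert k S) (n(k := p)) t
      = indicator (box (- insert k S)) t *\<^sub>R slice w A S n t k p 0"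
proof -
  have kS: "k \<notin> S" "- S = insert k (- insert k S)" using k by auto
  have least: "k < j" if "j \<in> S" for j using k that by auto
  have box: "indicator (box (- S)) (t(k := y)) = (indicator (box (- insert k S)) t * indicator {0..} y :: real)"
    using t kS by (auto simp: indicator_def PiE_iff extensional_def)
  have 0: "mixed_deriv (insert k S) (n(k := 0)) f = mixed_deriv S n f"
    by (simp add: mixed_deriv_insert_least[OF least])
  have 1: "sample w S A (t(k := y)) = vec_upd (sample w S A (t(k := 0))) k (w * of_real (y + a $ k))"
    "sample w S (insert k A) (t(k := y)) = vec_upd (sample w S A (t(k := 0))) k (of_real y)"
    "sample w (insert k S) (insert k A) t = vec_upd (sample w S A (t(k := 0))) k 0"
    using kS k by (auto simp: vec_eq_iff vec_upd_nth sample_def)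
  show "integrand w A S n (t(k := y))
      = indicator (box (- insert k S)) t *\<^sub>R (indicator {0..} y *\<^sub>R slice w A S n t k 0 (w * of_real (y + a $ k)))"
    unfolding integrand_def box slice_def 0 1 by simp
  show "integrand w (insert k A) S n (t(k := y))
      = indicator (box (- insert k S)) t *\<^sub>R (indicator {0..} y *\<^sub>R slice w A S n t k 0 (of_real y))"
    unfolding integrand_def box slice_def 0 1 by simp
  show "integrand w (insert k A) (insert k S) (n(k := p)) t
      = indicator (box (- insert k S)) t *\<^sub>R slice w A S n t k p 0"
    unfolding integrand_def slice_def 1 by simp
qed

lemma inner_integral_slice:
  assumes w: "admissible w" and k: "k \<notin> A" "S \<subseteq> A" "\<And>j. j \<in> A \<Longrightarrow> k < j"
    and n: "\<And>j. j \<in> S \<Longrightarrow> n j \<le> Suc N" and t: "t \<in> extensional (- insert k S)"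
  shows "(\<integral>y. integrand w A S n (t(k := y)) \<partial>mixed_measure A k)
      = indicator (box (- insert k S)) t *\<^sub>R (\<Sum>m. slice w A S n t k 0 (w * of_real (real m + a $ k)))"
    and "(\<integral>y. integrand w (insert k A) S n (t(k := y)) \<partial>mixed_measure (insert k A) k)
      = indicator (box (- insert k S)) t *\<^sub>R (LINT y:{0..}|lborel. slice w A S n t k 0 (of_real y))"
proof -
  have kS: "- S = insert k (- insert k S)" using k by auto
  have upd: "(\<lambda>y. t(k := y)) \<in> measurable (mixed_measure A k) (Pi\<^sub>M (- S) (mixed_measure A))"
    unfolding kS using t by (intro measurable_component_update) (auto simp: space_PiM PiE_def)
  have meas: "(\<lambda>y. integrand w A S n (t(k := y))) \<in> borel_measurable borel"
    using measurable_compose[OF upd borel_measurable_integrand[OF w, of A S n]]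
    by (simp only: measurable_cong_sets[OF sets_mixed_measure refl])
  have mm: "mixed_measure A k = nat_measure" "mixed_measure (insert k A) k = lborel"
    using k by (auto simp: mixed_measure_def)
  have slice_eq: "integrand w A S n (t(k := y)) = indicator (box (- insert k S)) t *\<^sub>R
      (indicator {0..} y *\<^sub>R slice w A S n t k 0 (w * of_real (y + a $ k)))" for y
    by (rule integrand_slice(1)[OF w k t])
  have slice_eq': "integrand w (insert k A) S n (t(k := y)) = indicator (box (- insert k S)) t *\<^sub>R
      (indicator {0..} y *\<^sub>R slice w A S n t k 0 (of_real y))" for y
    by (rule integrand_slice(2)[OF w k t])
  have "summable (\<lambda>m. norm (integrand w A S n (t(k := real m))))"
  proof (rule summable_comparison_test')
    have "integrable nat_measure (majorant w A k)" using majorant_integral(1)[OF w, of A k] by (simp add: mm)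
    then have "summable (\<lambda>m. norm (majorant w A k (real m)))" by (simp add: integrable_nat_measure)
    then show "summable (\<lambda>m. K * (\<Prod>j\<in>-insert k S. majorant w A j (t j)) * norm (majorant w A k (real m)))"
      by (rule summable_mult)
    fix m
    have "norm (integrand w A S n (t(k := real m))) \<le> K * (\<Prod>j\<in>-S. majorant w A j ((t(k := real m)) j))"
      by (rule integrand_bound[OF w n])
    also have "(\<Prod>j\<in>-S. majorant w A j ((t(k := real m)) j))
        = majorant w A k (real m) * (\<Prod>j\<in>-insert k S. majorant w A j (t j))"
      unfolding kS by (subst prod.insert) (auto intro!: prod.cong)
    finally show "norm (norm (integrand w A S n (t(k := real m))))
        \<le> K * (\<Prod>j\<in>-insert k S. majorant w A j (t j)) * norm (majorant w A k (real m))"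
      using majorant_nonneg[of w A k "real m"] by (simp add: mult_ac del: fun_upd_apply)
  qed
  from integral_nat_measure[OF meas this]
  have "(\<integral>y. integrand w A S n (t(k := y)) \<partial>nat_measure) = (\<Sum>m. integrand w A S n (t(k := real m)))" .
  also have "\<dots> = indicator (box (- insert k S)) t *\<^sub>R (\<Sum>m. slice w A S n t k 0 (w * of_real (real m + a $ k)))"
    unfolding slice_eq
    by (cases "t \<in> box (- insert k S)") auto
  finally show "(\<integral>y. integrand w A S n (t(k := y)) \<partial>mixed_measure A k)
      = indicator (box (- insert k S)) t *\<^sub>R (\<Sum>m. slice w A S n t k 0 (w * of_real (real m + a $ k)))"
    by (simp only: mm)
  show "(\<integral>y. integrand w (insert k A) S n (t(k := y)) \<partial>mixed_measure (insert k A) k)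
      = indicator (box (- insert k S)) t *\<^sub>R (LINT y:{0..}|lborel. slice w A S n t k 0 (of_real y))"
    unfolding slice_eq' mm set_lebesgue_integral_def by (cases "t \<in> box (- insert k S)") simp_all
qed

text \<open>
  Fubini's theorem in the coordinate \<open>k\<close>. The three mixtures become integrals over the same remaining
  coordinates, and the difference of their inner integrals is bounded by \<open>euler_maclaurin_slice\<close>.
  Of the remaining coordinates only those outside \<open>insert k A\<close> are summed and cost \<open>1 / \<bar>w\<bar>\<close>.
\<close>
lemma replace_coordinate:
  assumes w: "admissible w" and k: "k \<notin> A" "S \<subseteq> A" "\<And>j. j \<in> A \<Longrightarrow> k < j"
    and n: "\<And>j. j \<in> S \<Longrightarrow> n j \<le> N"
  shows "norm (sum_integral w A S n - sum_integral w (insert k A) S n / w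
      + (\<Sum>p<N. of_real (bernoulli_coeff (Suc p) (a $ k)) * w ^ p * sum_integral w (insert k A) (insert k S) (n(k := p))))
    \<le> ray_const k * K * majorant_const ^ card (- insert k S) * norm w ^ N / norm w ^ card (- insert k A)"
proof -
  define I where "I = - insert k S"
  define P where "P = Pi\<^sub>M I (mixed_measure A)"
  have I: "finite I" "k \<notin> I" "- S = insert k I" using k by (auto simp: I_def)
  have P': "Pi\<^sub>M I (mixed_measure (insert k A)) = P"
    unfolding P_def by (intro PiM_cong refl) (auto simp: mixed_measure_def I_def)
  have n': "n j \<le> Suc N" if "j \<in> S" for j using n[OF that] by simp
  interpret PA: product_sigma_finite "mixed_measure A" by (rule product_sigma_finite_mixed_measure)
  interpret PB: product_sigma_finite "mixed_measure (insert k A)" by (rule product_sigma_finite_mixed_measure)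
  define EA where "EA = (\<lambda>t. \<integral>y. integrand w A S n (t(k := y)) \<partial>mixed_measure A k)"
  define EB where "EB = (\<lambda>t. \<integral>y. integrand w (insert k A) S n (t(k := y)) \<partial>mixed_measure (insert k A) k)"
  define EC where "EC = (\<lambda>p. integrand w (insert k A) (insert k S) (n(k := p)))"
  have iA: "integrable (Pi\<^sub>M (insert k I) (mixed_measure A)) (integrand w A S n)"
    using integrable_integrand[OF w n'] unfolding I(3)[symmetric] .
  have iB: "integrable (Pi\<^sub>M (insert k I) (mixed_measure (insert k A))) (integrand w (insert k A) S n)"
    using integrable_integrand[OF w n'] unfolding I(3)[symmetric] .
  have A: "integrable P EA" "sum_integral w A S n = integral\<^sup>L P EA"
    unfolding P_def EA_def sum_integral_def I(3)
    by (rule PA.integrable_product_inner[OF I(1,2) iA], rule PA.product_integral_insert[OF I(1,2) iA])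
  have B: "integrable P EB" "sum_integral w (insert k A) S n = integral\<^sup>L P EB"
    unfolding P'[symmetric] EB_def sum_integral_def I(3)
    by (rule PB.integrable_product_inner[OF I(1,2) iB], rule PB.product_integral_insert[OF I(1,2) iB])
  have C: "integrable P (EC p)" "sum_integral w (insert k A) (insert k S) (n(k := p)) = integral\<^sup>L P (EC p)"
    if "p < N" for p
  proof -
    show "integrable P (EC p)"
      unfolding P'[symmetric] EC_def I_def using that n' by (intro integrable_integrand w) auto
    show "sum_integral w (insert k A) (insert k S) (n(k := p)) = integral\<^sup>L P (EC p)"
      by (simp only: sum_integral_def P'[symmetric] EC_def I_def)
  qed
  define E where "E = (\<lambda>t. EA t - EB t / w + (\<Sum>p<N. of_real (bernoulli_coeff (Suc p) (a $ k)) * w ^ p * EC p t))"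
  have int_sum: "integrable P (\<lambda>t. \<Sum>p<N. of_real (bernoulli_coeff (Suc p) (a $ k)) * w ^ p * EC p t)"
    by (intro Bochner_Integration.integrable_sum integrable_mult_right C) auto
  have int_E: "integrable P E"
    unfolding E_def using A B int_sum
    by (intro Bochner_Integration.integrable_add Bochner_Integration.integrable_diff integrable_divide)
  have "integral\<^sup>L P E = integral\<^sup>L P EA - integral\<^sup>L P EB / w
      + (\<Sum>p<N. of_real (bernoulli_coeff (Suc p) (a $ k)) * w ^ p * integral\<^sup>L P (EC p))"
  proof -
    have "integral\<^sup>L P E = (\<integral>t. EA t - EB t / w \<partial>P)
        + (\<integral>t. (\<Sum>p<N. of_real (bernoulli_coeff (Suc p) (a $ k)) * w ^ p * EC p t) \<partial>P)"
      unfolding E_def using A B int_sum by (intro Bochner_Integration.integral_add) auto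
    also have "(\<integral>t. EA t - EB t / w \<partial>P) = integral\<^sup>L P EA - integral\<^sup>L P EB / w"
      using A B by (subst Bochner_Integration.integral_diff) auto
    also have "(\<integral>t. (\<Sum>p<N. of_real (bernoulli_coeff (Suc p) (a $ k)) * w ^ p * EC p t) \<partial>P)
        = (\<Sum>p<N. of_real (bernoulli_coeff (Suc p) (a $ k)) * w ^ p * integral\<^sup>L P (EC p))"
      using C by (subst Bochner_Integration.integral_sum) auto
    finally show ?thesis .
  qed
  then have "sum_integral w A S n - sum_integral w (insert k A) S n / w
      + (\<Sum>p<N. of_real (bernoulli_coeff (Suc p) (a $ k)) * w ^ p * sum_integral w (insert k A) (insert k S) (n(k := p)))
      = integral\<^sup>L P E"
    using C by (simp add: A B)
  also have "norm \<dots> \<le> (\<integral>t. norm (E t) \<partial>P)" by (rule integral_norm_bound)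
  also have "\<dots> \<le> (\<integral>t. ray_const k * K * norm w ^ N * (\<Prod>j\<in>I. majorant w A j (t j)) \<partial>P)"
  proof (rule integral_mono)
    show "integrable P (\<lambda>t. norm (E t))" by (rule integrable_norm[OF int_E])
    show "integrable P (\<lambda>t. ray_const k * K * norm w ^ N * (\<Prod>j\<in>I. majorant w A j (t j)))"
      unfolding P_def by (intro integrable_mult_right integrable_prod_majorant w)
  next
    fix t assume "t \<in> space P"
    then have t: "t \<in> extensional (- insert k S)" by (simp add: P_def I_def space_PiM PiE_def)
    have E: "E t = indicator (box (- insert k S)) t *\<^sub>R
        ((\<Sum>m. slice w A S n t k 0 (w * of_real (real m + a $ k))) - (LINT y:{0..}|lborel. slice w A S n t k 0 (of_real y)) / w
          + (\<Sum>p<N. of_real (bernoulli_coeff (Suc p) (a $ k)) * w ^ p * slice w A S n t k p 0))"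
    proof -
      have 1: "EA t = indicator (box (- insert k S)) t *\<^sub>R (\<Sum>m. slice w A S n t k 0 (w * of_real (real m + a $ k)))"
        unfolding EA_def by (rule inner_integral_slice(1)[OF w k n' t])
      have 2: "EB t = indicator (box (- insert k S)) t *\<^sub>R (LINT y:{0..}|lborel. slice w A S n t k 0 (of_real y))"
        unfolding EB_def by (rule inner_integral_slice(2)[OF w k n' t])
      have 3: "EC p t = indicator (box (- insert k S)) t *\<^sub>R slice w A S n t k p 0" for p
        unfolding EC_def by (rule integrand_slice(3)[OF w k t])
      show ?thesis unfolding E_def 1 2 3 by (cases "t \<in> box (- insert k S)") auto
    qed
    show "norm (E t) \<le> ray_const k * K * norm w ^ N * (\<Prod>j\<in>I. majorant w A j (t j))"
    proof (cases "t \<in> box (- insert k S)")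
      case True
      then have nonneg: "0 \<le> t j" if "j \<notin> insert k S" for j using that by (auto simp: PiE_iff)
      have "norm ((\<Sum>m. slice w A S n t k 0 (w * of_real (real m + a $ k))) - (LINT y:{0..}|lborel. slice w A S n t k 0 (of_real y)) / w
          + (\<Sum>p<N. of_real (bernoulli_coeff (Suc p) (a $ k)) * w ^ p * slice w A S n t k p 0))
        \<le> ray_const k * (K * (\<Prod>j\<in>-insert k S. majorant w A j (t j))) * norm w ^ N"
        by (rule euler_maclaurin_slice[OF w k n' nonneg])
      then show ?thesis
        using True unfolding E I_def by (simp add: mult_ac)
    next
      case False
      then show ?thesis unfolding E using ray_const_nonneg K_nonneg
        by (auto intro!: mult_nonneg_nonneg prod_nonneg majorant_nonneg)
    qed
  qed
  also have "\<dots> = ray_const k * K * norm w ^ N * (\<integral>t. (\<Prod>j\<in>I. majorant w A j (t j)) \<partial>P)"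
    by simp
  also have "\<dots> \<le> ray_const k * K * norm w ^ N * (majorant_const ^ card I / norm w ^ card (I - A))"
    unfolding P_def using ray_const_nonneg K_nonneg
    by (intro mult_left_mono integral_prod_majorant w mult_nonneg_nonneg) auto
  also have "I - A = - insert k A" using k by (auto simp: I_def)
  finally show ?thesis by (simp add: I_def mult_ac del: fun_upd_apply)
qed

section \<open>Interpolation between the sum and its expansion\<close>

text \<open>
  Every integrated coordinate carries a factor \<open>1 / w\<close> and every coordinate in \<open>S\<close> a Bernoulli
  coefficient with a minus sign.
\<close>
definition coef :: "complex \<Rightarrow> 's set \<Rightarrow> 's set \<Rightarrow> ('s \<Rightarrow> nat) \<Rightarrow> complex" where
  "coef w A S n = (-1) ^ card S / w ^ (card A - card S) *
     (\<Prod>j\<in>S. of_real (bernoulli_coeff (Suc (n j)) (a $ j)) * w ^ n j)"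

text \<open>
  This interpolates between the sum over all \<open>m\<close> (for \<open>A = {}\<close>, \<open>expansion_empty\<close>) and the right-hand
  side of the asymptotic formula (for \<open>A = UNIV\<close>, \<open>expansion_UNIV\<close>).
\<close>
definition expansion :: "complex \<Rightarrow> 's set \<Rightarrow> complex" where
  "expansion w A = (\<Sum>S\<in>Pow A. \<Sum>n\<in>(\<Pi>\<^sub>E j\<in>S. {..<N}). coef w A S n * sum_integral w A S n)"

lemma coef_insert:
  assumes "k \<notin> A" "S \<subseteq> A"
  shows "coef w (insert k A) S n = coef w A S n / w"
    and "coef w (insert k A) (insert k S) (n(k := p))
      = - (coef w A S n * (of_real (bernoulli_coeff (Suc p) (a $ k)) * w ^ p))"
proof -
  have card: "card S \<le> card A" using assms by (intro card_mono) auto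
  have k: "k \<notin> S" using assms by auto
  show "coef w (insert k A) S n = coef w A S n / w"
    using assms card by (simp add: coef_def Suc_diff_le)
  have "(\<Prod>j\<in>insert k S. complex_of_real (bernoulli_coeff (Suc ((n(k := p)) j)) (a $ j)) * w ^ (n(k := p)) j)
      = of_real (bernoulli_coeff (Suc p) (a $ k)) * w ^ p
        * (\<Prod>j\<in>S. of_real (bernoulli_coeff (Suc (n j)) (a $ j)) * w ^ n j)"
  proof -
    have "(\<Prod>j\<in>S. complex_of_real (bernoulli_coeff (Suc ((n(k := p)) j)) (a $ j)) * w ^ (n(k := p)) j)
        = (\<Prod>j\<in>S. of_real (bernoulli_coeff (Suc (n j)) (a $ j)) * w ^ n j)"
      using k by (intro prod.cong refl) auto
    then show ?thesis using k by (subst prod.insert) auto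
  qed
  then show "coef w (insert k A) (insert k S) (n(k := p))
      = - (coef w A S n * (of_real (bernoulli_coeff (Suc p) (a $ k)) * w ^ p))"
    using assms k by (simp add: coef_def del: fun_upd_apply)
qed

lemma norm_coef_le:
  assumes w: "admissible w"
  shows "norm (coef w A S n) \<le> (\<Prod>j\<in>S. \<bar>bernoulli_coeff (Suc (n j)) (a $ j)\<bar>) / norm w ^ card A"
proof -
  have w: "0 < norm w" "norm w \<le> 1" using w by (auto simp: admissible_def)
  have "norm (coef w A S n) = (\<Prod>j\<in>S. \<bar>bernoulli_coeff (Suc (n j)) (a $ j)\<bar> * norm w ^ n j) / norm w ^ (card A - card S)"
    by (simp add: coef_def norm_mult norm_divide norm_power prod_norm[symmetric])
  also have "\<dots> \<le> (\<Prod>j\<in>S. \<bar>bernoulli_coeff (Suc (n j)) (a $ j)\<bar>) / norm w ^ card A"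
  proof (rule frac_le)
    show "(\<Prod>j\<in>S. \<bar>bernoulli_coeff (Suc (n j)) (a $ j)\<bar> * norm w ^ n j) \<le> (\<Prod>j\<in>S. \<bar>bernoulli_coeff (Suc (n j)) (a $ j)\<bar>)"
      using w by (intro prod_mono) (auto intro!: mult_left_le power_le_one)
    show "norm w ^ card A \<le> norm w ^ (card A - card S)"
      using w by (intro power_decreasing) auto
  qed (use w in \<open>auto intro!: prod_nonneg\<close>)
  finally show ?thesis .
qed

text \<open>
  The subsets of \<open>insert k A\<close> are the subsets \<open>S\<close> of \<open>A\<close> and the sets \<open>insert k S\<close>. The former
  contribute the integral in the coordinate \<open>k\<close>, the latter its boundary terms.
\<close>
lemma expansion_insert:
  assumes "k \<notin> A"
  shows "expansion w A - expansion w (insert k A) =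
    (\<Sum>S\<in>Pow A. \<Sum>n\<in>(\<Pi>\<^sub>E j\<in>S. {..<N}). coef w A S n *
      (sum_integral w A S n - sum_integral w (insert k A) S n / w
        + (\<Sum>p<N. of_real (bernoulli_coeff (Suc p) (a $ k)) * w ^ p
            * sum_integral w (insert k A) (insert k S) (n(k := p)))))"
proof -
  have "expansion w (insert k A) =
      (\<Sum>S\<in>Pow A. \<Sum>n\<in>(\<Pi>\<^sub>E j\<in>S. {..<N}). coef w A S n *
        (sum_integral w (insert k A) S n / w
          - (\<Sum>p<N. of_real (bernoulli_coeff (Suc p) (a $ k)) * w ^ p
              * sum_integral w (insert k A) (insert k S) (n(k := p)))))"
    unfolding expansion_def sum_Pow_insert[OF finite assms]
  proof (intro sum.cong refl)
    fix S assume "S \<in> Pow A"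
    then have S: "S \<subseteq> A" "k \<notin> S" using assms by auto
    show "(\<Sum>n\<in>(\<Pi>\<^sub>E j\<in>S. {..<N}). coef w (insert k A) S n * sum_integral w (insert k A) S n)
        + (\<Sum>n\<in>(\<Pi>\<^sub>E j\<in>insert k S. {..<N}). coef w (insert k A) (insert k S) n * sum_integral w (insert k A) (insert k S) n)
      = (\<Sum>n\<in>(\<Pi>\<^sub>E j\<in>S. {..<N}). coef w A S n *
        (sum_integral w (insert k A) S n / w
          - (\<Sum>p<N. of_real (bernoulli_coeff (Suc p) (a $ k)) * w ^ p
              * sum_integral w (insert k A) (insert k S) (n(k := p)))))"
      unfolding sum_PiE_insert[OF finite S(2)] coef_insert[OF assms S(1)] sum.distrib[symmetric]
      by (intro sum.cong refl) (simp add: sum_negf sum_distrib_left right_diff_distrib mult_ac del: fun_upd_apply)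
  qed
  then show ?thesis
    unfolding expansion_def
    by (simp add: sum_subtractf[symmetric] right_diff_distrib[symmetric] diff_diff_eq2 diff_add_eq[symmetric] del: fun_upd_apply)
qed

text \<open>
  The coefficient costs at most \<open>1 / \<bar>w\<bar>\<close> for each coordinate in \<open>A\<close>, the coordinates that are still
  summed as much, and coordinate \<open>k\<close> nothing: this gives \<open>CARD('s) - 1\<close> factors in total.
\<close>
lemma expansion_insert_bound:
  assumes k: "k \<notin> A" "\<And>j. j \<in> A \<Longrightarrow> k < j"
  shows "\<exists>C\<ge>0. \<forall>w. admissible w \<longrightarrow>
    norm (expansion w A - expansion w (insert k A)) \<le> C * (norm w ^ N / norm w ^ (CARD('s) - 1))"
proof -
  define C where "C = (\<Sum>S\<in>Pow A. \<Sum>n\<in>(\<Pi>\<^sub>E j\<in>S. {..<N}).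
    (\<Prod>j\<in>S. \<bar>bernoulli_coeff (Suc (n j)) (a $ j)\<bar>) * (ray_const k * K * majorant_const ^ card (- insert k S)))"
  have "0 \<le> C"
    unfolding C_def using ray_const_nonneg K_nonneg majorant_const_pos
    by (intro sum_nonneg mult_nonneg_nonneg prod_nonneg) auto
  moreover have "norm (expansion w A - expansion w (insert k A)) \<le> C * (norm w ^ N / norm w ^ (CARD('s) - 1))"
    if w: "admissible w" for w
  proof -
    have card: "card A + card (- insert k A) = CARD('s) - 1"
    proof -
      have "card (- insert k A) = CARD('s) - card (insert k A)" by (simp add: Compl_eq_Diff_UNIV card_Diff_subset)
      moreover have "card (insert k A) \<le> CARD('s)" by (intro card_mono) auto
      ultimately show ?thesis using k(1) by simp
    qed
    have "norm (expansion w A - expansion w (insert k A)) \<le>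
      (\<Sum>S\<in>Pow A. \<Sum>n\<in>(\<Pi>\<^sub>E j\<in>S. {..<N}).
        (\<Prod>j\<in>S. \<bar>bernoulli_coeff (Suc (n j)) (a $ j)\<bar>) / norm w ^ card A *
        (ray_const k * K * majorant_const ^ card (- insert k S) * norm w ^ N / norm w ^ card (- insert k A)))"
      unfolding expansion_insert[OF k(1)]
    proof (intro sum_norm_le)
      fix S n assume "S \<in> Pow A" and n: "n \<in> (\<Pi>\<^sub>E j\<in>S. {..<N})"
      then have S: "S \<subseteq> A" by simp
      have n': "n j \<le> N" if "j \<in> S" for j using n that by (auto simp: PiE_iff less_imp_le)
      show "norm (coef w A S n *
          (sum_integral w A S n - sum_integral w (insert k A) S n / w
            + (\<Sum>p<N. of_real (bernoulli_coeff (Suc p) (a $ k)) * w ^ p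
                * sum_integral w (insert k A) (insert k S) (n(k := p)))))
        \<le> (\<Prod>j\<in>S. \<bar>bernoulli_coeff (Suc (n j)) (a $ j)\<bar>) / norm w ^ card A *
          (ray_const k * K * majorant_const ^ card (- insert k S) * norm w ^ N / norm w ^ card (- insert k A))"
        unfolding norm_mult
      proof (rule mult_mono)
        show "norm (coef w A S n) \<le> (\<Prod>j\<in>S. \<bar>bernoulli_coeff (Suc (n j)) (a $ j)\<bar>) / norm w ^ card A"
          by (rule norm_coef_le[OF w])
        show "norm (sum_integral w A S n - sum_integral w (insert k A) S n / w
            + (\<Sum>p<N. of_real (bernoulli_coeff (Suc p) (a $ k)) * w ^ p
                * sum_integral w (insert k A) (insert k S) (n(k := p))))
          \<le> ray_const k * K * majorant_const ^ card (- insert k S) * norm w ^ N / norm w ^ card (- insert k A)"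
          by (rule replace_coordinate[OF w k(1) S k(2) n'])
      qed (auto intro!: divide_nonneg_nonneg prod_nonneg)
    qed
    also have "\<dots> = (\<Sum>S\<in>Pow A. \<Sum>n\<in>(\<Pi>\<^sub>E j\<in>S. {..<N}).
        (\<Prod>j\<in>S. \<bar>bernoulli_coeff (Suc (n j)) (a $ j)\<bar>) * (ray_const k * K * majorant_const ^ card (- insert k S))
          * (norm w ^ N / norm w ^ (CARD('s) - 1)))"
      unfolding card[symmetric] power_add by (intro sum.cong refl) (simp add: mult_ac)
    also have "\<dots> = C * (norm w ^ N / norm w ^ (CARD('s) - 1))"
      unfolding C_def sum_distrib_right ..
    finally show ?thesis .
  qed
  ultimately show ?thesis by blast
qed

text \<open>
  The induction adds the elements of \<open>A\<close> in decreasing order, as \<open>expansion_insert_bound\<close>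
  requires.
\<close>
lemma expansion_diff_bound:
  "\<exists>C\<ge>0. \<forall>w. admissible w \<longrightarrow>
    norm (expansion w {} - expansion w A) \<le> C * (norm w ^ N / norm w ^ (CARD('s) - 1))"
  using finite[of A]
proof (induction A rule: finite_linorder_min_induct)
  case empty
  show ?case by (intro exI[of _ 0]) auto
next
  case (insert k A)
  obtain C where C: "0 \<le> C" "\<And>w. admissible w \<Longrightarrow>
      norm (expansion w {} - expansion w A) \<le> C * (norm w ^ N / norm w ^ (CARD('s) - 1))"
    using insert.IH by blast
  have k: "k \<notin> A" "\<And>j. j \<in> A \<Longrightarrow> k < j" using insert.hyps by auto
  obtain C' where C': "0 \<le> C'" "\<And>w. admissible w \<Longrightarrow>
      norm (expansion w A - expansion w (insert k A)) \<le> C' * (norm w ^ N / norm w ^ (CARD('s) - 1))"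
    using expansion_insert_bound[OF k] by blast
  show ?case
  proof (intro exI conjI allI impI)
    show "0 \<le> C + C'" using C C' by simp
    fix w assume w: "admissible w"
    have "norm (expansion w {} - expansion w (insert k A))
        \<le> norm (expansion w {} - expansion w A) + norm (expansion w A - expansion w (insert k A))"
      using norm_triangle_ineq[of "expansion w {} - expansion w A" "expansion w A - expansion w (insert k A)"] by simp
    then show "norm (expansion w {} - expansion w (insert k A)) \<le> (C + C') * (norm w ^ N / norm w ^ (CARD('s) - 1))"
      unfolding distrib_right using C(2)[OF w] C'(2)[OF w] by linarith
  qed
qed

lemma expansion_empty:
  assumes w: "admissible w"
  shows "(\<lambda>m :: (nat, 's) vec. f (\<chi> j. w * of_real (of_nat (m $ j) + a $ j))) summable_on UNIV"
    and "(\<Sum>\<^sub>\<infinity>m :: (nat, 's) vec. f (\<chi> j. w * of_real (of_nat (m $ j) + a $ j))) = expansion w {}"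
proof -
  define n where "n = (\<lambda>_ :: 's. undefined :: nat)"
  have mm: "mixed_measure {} = (\<lambda>_ :: 's. nat_measure)" by (auto simp: mixed_measure_def)
  from mm have P: "Pi\<^sub>M (- {}) (mixed_measure {}) = Pi\<^sub>M (UNIV :: 's set) (\<lambda>_. nat_measure)" by simp
  have int: "integrable (Pi\<^sub>M UNIV (\<lambda>_. nat_measure)) (integrand w {} {} n)"
    using integrable_integrand[OF w, of "{}" n "{}"] unfolding P by simp
  have eq: "integrand w {} {} n (\<lambda>j. real (m $ j)) = f (\<chi> j. w * of_real (of_nat (m $ j) + a $ j))" for m
    by (simp add: integrand_def mixed_deriv_def sample_def PiE_iff)
  show "(\<lambda>m :: (nat, 's) vec. f (\<chi> j. w * of_real (of_nat (m $ j) + a $ j))) summable_on UNIV"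
    using infsum_vec_eq_integral(1)[OF int] unfolding eq .
  show "(\<Sum>\<^sub>\<infinity>m :: (nat, 's) vec. f (\<chi> j. w * of_real (of_nat (m $ j) + a $ j))) = expansion w {}"
    using infsum_vec_eq_integral(2)[OF int] unfolding eq
    by (simp add: expansion_def coef_def sum_integral_def mm n_def)
qed

lemma sample_UNIV: "sample w S UNIV t = (\<chi> k. if k \<in> S then 0 else of_real (t k))"
  by (simp add: sample_def vec_eq_iff)

lemma integral_UNIV:
  "sum_integral w UNIV S n = (LINT x : (\<Pi>\<^sub>E k\<in>- S. {0..}) | Pi\<^sub>M (- S) (\<lambda>_. lborel).
     mixed_deriv S n f (\<chi> k. if k \<in> S then 0 else of_real (x k)))"
proof -
  have "mixed_measure UNIV = (\<lambda>_ :: 's. lborel)" by (auto simp: mixed_measure_def)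
  then show ?thesis
    by (simp add: sum_integral_def set_lebesgue_integral_def integrand_def[abs_def] sample_UNIV)
qed

lemma set_integrable_integrand_UNIV:
  assumes "admissible w" "\<And>j. j \<in> S \<Longrightarrow> n j \<le> Suc N"
  shows "set_integrable (Pi\<^sub>M (- S) (\<lambda>_. lborel)) (\<Pi>\<^sub>E k\<in>- S. {0..})
     (\<lambda>x. mixed_deriv S n f (\<chi> k. if k \<in> S then 0 else of_real (x k)))"
proof -
  have "mixed_measure UNIV = (\<lambda>_ :: 's. lborel)" by (auto simp: mixed_measure_def)
  moreover have "integrable (Pi\<^sub>M (- S) (mixed_measure UNIV)) (integrand w UNIV S n)"
    by (rule integrable_integrand[OF assms])
  ultimately show ?thesis
    by (simp add: set_integrable_def integrand_def[abs_def] sample_UNIV)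
qed

text \<open>
  For \<open>S = UNIV\<close> the integral is over the empty product, whose space has a single point, so it is the
  value of the derivative at 0; this term is stated separately.
\<close>
lemma expansion_UNIV:
  "expansion w UNIV = (-1) ^ CARD('s) *
     (\<Sum>n \<in> (\<Pi>\<^sub>E j\<in>UNIV. {..<N}). mixed_deriv UNIV n f 0 *
        (\<Prod>j\<in>UNIV. of_real (bernoulli_poly (n j + 1) (a $ j) / fact (n j + 1)) * w ^ n j)) +
   (\<Sum>S | S \<subset> UNIV. (-1) ^ card S / w ^ (CARD('s) - card S) *
     (\<Sum>n \<in> (\<Pi>\<^sub>E j\<in>S. {..<N}).
        (LINT x : (\<Pi>\<^sub>E k\<in>- S. {0..}) | Pi\<^sub>M (- S) (\<lambda>_. lborel).
           mixed_deriv S n f (\<chi> k. if k \<in> S then 0 else of_real (x k))) *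
        (\<Prod>j\<in>S. of_real (bernoulli_poly (n j + 1) (a $ j) / fact (n j + 1)) * w ^ n j)))"
proof -
  define T where "T = (\<lambda>S. (-1) ^ card S / w ^ (CARD('s) - card S) *
     (\<Sum>n \<in> (\<Pi>\<^sub>E j\<in>S. {..<N}). sum_integral w UNIV S n *
        (\<Prod>j\<in>S. of_real (bernoulli_poly (n j + 1) (a $ j) / fact (n j + 1)) * w ^ n j)))"
  have summand: "(\<Sum>n\<in>(\<Pi>\<^sub>E j\<in>S. {..<N}). coef w UNIV S n * sum_integral w UNIV S n) = T S" for S
    unfolding T_def sum_distrib_left
    by (intro sum.cong refl) (simp add: coef_def bernoulli_coeff_def mult_ac)
  have "expansion w UNIV = (\<Sum>S\<in>Pow UNIV. T S)"
    unfolding expansion_def summand ..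
  also have "Pow UNIV = insert UNIV {S :: 's set. S \<subset> UNIV}" by auto
  also have "(\<Sum>S\<in>\<dots>. T S) = T UNIV + (\<Sum>S | S \<subset> UNIV. T S)"
    by (subst sum.insert) auto
  also have "T UNIV = (-1) ^ CARD('s) *
     (\<Sum>n \<in> (\<Pi>\<^sub>E j\<in>UNIV. {..<N}). mixed_deriv UNIV n f 0 *
        (\<Prod>j\<in>UNIV. of_real (bernoulli_poly (n j + 1) (a $ j) / fact (n j + 1)) * w ^ n j))"
  proof -
    have "sum_integral w UNIV UNIV n = mixed_deriv UNIV n f 0" for n
    proof -
      have "(\<chi> k. 0) = (0 :: complex ^ ('s::{finite,linorder}))" by (simp add: vec_eq_iff)
      then show ?thesis
        by (simp add: sum_integral_def integrand_def sample_UNIV PiM_empty lebesgue_integral_count_space_finite)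
    qed
    then show ?thesis by (simp add: T_def)
  qed
  finally show ?thesis
    unfolding T_def integral_UNIV .
qed

lemma admissibleI:
  assumes "0 < \<delta>" "w \<noteq> 0" "norm w \<le> min 1 (\<delta> / (1 + (\<Sum>j\<in>UNIV. \<bar>a $ j\<bar>)))" "\<And>j. w \<in> sector (\<theta> $ j)"
  shows "admissible w"
  unfolding admissible_def
proof (intro conjI allI)
  fix j
  have pos: "0 < 1 + (\<Sum>j\<in>UNIV. \<bar>a $ j\<bar>)" by (intro add_pos_nonneg sum_nonneg) auto
  have "norm w * \<bar>a $ j\<bar> \<le> norm w * (1 + (\<Sum>j\<in>UNIV. \<bar>a $ j\<bar>))"
    using member_le_sum[of j UNIV "\<lambda>j. \<bar>a $ j\<bar>"] by (intro mult_left_mono) auto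
  also have "\<dots> \<le> \<delta>" using assms(3) pos by (simp add: le_divide_eq)
  finally show "norm w * \<bar>a $ j\<bar> \<le> \<delta>" .
qed (use assms in auto)

end

theorem theorem1p4:
  fixes f :: "complex ^ ('s::{finite,linorder}) \<Rightarrow> complex"
    and \<Omega> :: "(complex ^ ('s::{finite,linorder})) set"
    and \<theta> a :: "real ^ ('s::{finite,linorder})"
    and N :: nat
  assumes theta: "\<And>j. 0 \<le> \<theta> $ j \<and> \<theta> $ j < pi / 2"
    and domain: "open \<Omega>" "connected \<Omega>" "sector_prod \<theta> \<subseteq> \<Omega>"
    and holo: "holomorphic_several f \<Omega>"
    and decay: "\<And>n. sufficient_decay (sector_prod \<theta>) (mixed_deriv UNIV n f)"
    and negative_shift: "CARD('s) \<ge> 2 \<Longrightarrow> \<exists>j. a $ j < 0 \<Longrightarrow>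
          \<exists>\<delta>>0. shifted_sector_prod \<theta> a \<delta> \<subseteq> \<Omega> \<and>
            (\<forall>n. sufficient_decay (shifted_sector_prod \<theta> a \<delta>) (mixed_deriv UNIV n f))"
  shows
    "(\<forall>\<^sub>F w in at 0 within (\<Inter>j. sector (\<theta> $ j)).
        (\<lambda>m :: (nat, 's) vec. f (\<chi> j. w * of_real (of_nat (m $ j) + a $ j))) summable_on UNIV) \<and>
     (\<forall>S n. S \<subset> UNIV \<longrightarrow> n \<in> (\<Pi>\<^sub>E j\<in>S. {..<N}) \<longrightarrow>
        set_integrable (Pi\<^sub>M (- S) (\<lambda>_. lborel)) (\<Pi>\<^sub>E k\<in>- S. {0..})
          (\<lambda>x. mixed_deriv S n f (\<chi> k. if k \<in> S then 0 else of_real (x k)))) \<and>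
     (\<lambda>w. (\<Sum>\<^sub>\<infinity>m :: (nat, 's) vec. f (\<chi> j. w * of_real (of_nat (m $ j) + a $ j))) -
        ((-1) ^ CARD('s) *
           (\<Sum>n \<in> (\<Pi>\<^sub>E j\<in>UNIV. {..<N}). mixed_deriv UNIV n f 0 *
              (\<Prod>j\<in>UNIV. of_real (bernoulli_poly (n j + 1) (a $ j) / fact (n j + 1)) * w ^ n j)) +
         (\<Sum>S | S \<subset> UNIV. (-1) ^ card S / w ^ (CARD('s) - card S) *
           (\<Sum>n \<in> (\<Pi>\<^sub>E j\<in>S. {..<N}).
              (LINT x : (\<Pi>\<^sub>E k\<in>- S. {0..}) | Pi\<^sub>M (- S) (\<lambda>_. lborel).
                 mixed_deriv S n f (\<chi> k. if k \<in> S then 0 else of_real (x k))) *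
              (\<Prod>j\<in>S. of_real (bernoulli_poly (n j + 1) (a $ j) / fact (n j + 1)) * w ^ n j)))))
      \<in> O[at 0 within (\<Inter>j. sector (\<theta> $ j))](\<lambda>w. w powi (int N - int CARD('s) + 1))"
proof -
  let ?F = "at 0 within (\<Inter>j. sector (\<theta> $ j))"
  have sep: "sep_holomorphic f \<Omega>" by (rule holomorphic_several_imp_sep_holomorphic[OF holo])
  \<comment> \<open>The hypothesis for negative shifts, now in every dimension.\<close>
  obtain \<delta> where \<delta>: "0 < \<delta>" "\<delta> \<le> 1 / 2" "shifted_sector_prod \<theta> a \<delta> \<subseteq> \<Omega>"
    and decay': "\<And>g. g \<in> range (\<lambda>n. mixed_deriv UNIV n f) \<Longrightarrow>
      sufficient_decay (shifted_sector_prod \<theta> a \<delta>) g"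
  proof (rule shifted_domain[OF theta domain(1,3), where \<G> = "range (\<lambda>n. mixed_deriv UNIV n f)" and a = a])
    show "sufficient_decay (sector_prod \<theta>) g" if "g \<in> range (\<lambda>n. mixed_deriv UNIV n f)" for g
      using that decay by auto
    show "\<exists>\<delta>>0. shifted_sector_prod \<theta> a \<delta> \<subseteq> \<Omega> \<and>
        (\<forall>g\<in>range (\<lambda>n. mixed_deriv UNIV n f). sufficient_decay (shifted_sector_prod \<theta> a \<delta>) g)"
      if "CARD('s) \<ge> 2" "\<exists>j. a $ j < 0"
      using negative_shift[OF that] by simp
  qed (rule that)
  define I :: "('s \<Rightarrow> nat) set" where "I = (\<Pi>\<^sub>E j\<in>UNIV. {..Suc N})"
  have "\<exists>K \<epsilon>. 0 \<le> K \<and> 0 < \<epsilon> \<and> (\<forall>n\<in>I. \<forall>x\<in>shifted_sector_prod \<theta> a \<delta>.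
      norm (mixed_deriv UNIV n f x) \<le> K * (\<Prod>j\<in>UNIV. weight \<epsilon> (norm (x $ j))))"
  proof (rule uniform_decay_bound[OF theta \<delta>(2)])
    show "finite I" unfolding I_def by (intro finite_PiE) auto
    fix n
    show "continuous_on (shifted_sector_prod \<theta> a \<delta>) (mixed_deriv UNIV n f)"
      using sep_holomorphic_mixed_deriv[OF sep domain(1), of UNIV n]
      by (intro continuous_on_subset[OF _ \<delta>(3)]) (simp add: sep_holomorphic_def)
    show "sufficient_decay (shifted_sector_prod \<theta> a \<delta>) (mixed_deriv UNIV n f)"
      by (rule decay') simp
  qed
  then obtain K \<epsilon> where K: "0 \<le> K" "0 < \<epsilon>" "\<And>n x. n \<in> I \<Longrightarrow> x \<in> shifted_sector_prod \<theta> a \<delta> \<Longrightarrow>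
      norm (mixed_deriv UNIV n f x) \<le> K * (\<Prod>j\<in>UNIV. weight \<epsilon> (norm (x $ j)))"
    by blast
  interpret decaying_holomorphic f \<Omega> \<theta> a \<delta> K \<epsilon> N
    by unfold_locales (use theta domain sep \<delta> K in \<open>auto simp: I_def PiE_iff\<close>)
  define r where "r = min 1 (\<delta> / (1 + (\<Sum>j\<in>UNIV. \<bar>a $ j\<bar>)))"
  have r: "0 < r"
    using \<delta>(1) by (auto simp: r_def intro!: divide_pos_pos add_pos_nonneg sum_nonneg)
  have ev: "\<forall>\<^sub>F w in ?F. admissible w"
    unfolding eventually_at
    by (intro exI[of _ r] conjI r) (auto intro!: admissibleI \<delta>(1) simp flip: r_def)
  \<comment> \<open>The integrals in the expansion do not depend on \<open>w\<close>, so one admissible \<open>w\<close> gives their existence.\<close>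
  have real_admissible: "admissible (of_real r)"
    using r theta by (intro admissibleI \<delta>(1)) (auto simp flip: r_def intro: of_real_in_sector)
  obtain C where C: "\<And>w. admissible w \<Longrightarrow>
      norm (expansion w {} - expansion w UNIV) \<le> C * (norm w ^ N / norm w ^ (CARD('s) - 1))"
    using expansion_diff_bound[of UNIV] by blast
  show ?thesis
  proof (intro conjI allI impI)
    show "\<forall>\<^sub>F w in ?F. (\<lambda>m :: (nat, 's) vec. f (\<chi> j. w * of_real (of_nat (m $ j) + a $ j))) summable_on UNIV"
      using ev by eventually_elim (rule expansion_empty)
  next
    fix S :: "'s set" and n :: "'s \<Rightarrow> nat"
    assume "n \<in> (\<Pi>\<^sub>E j\<in>S. {..<N})"
    then show "set_integrable (Pi\<^sub>M (- S) (\<lambda>_. lborel)) (\<Pi>\<^sub>E k\<in>- S. {0..})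
        (\<lambda>x. mixed_deriv S n f (\<chi> k. if k \<in> S then 0 else of_real (x k)))"
      by (intro set_integrable_integrand_UNIV[OF real_admissible]) (auto simp: PiE_iff dest!: bspec)
  next
    show "(\<lambda>w. (\<Sum>\<^sub>\<infinity>m :: (nat, 's) vec. f (\<chi> j. w * of_real (of_nat (m $ j) + a $ j))) -
        ((-1) ^ CARD('s) *
           (\<Sum>n \<in> (\<Pi>\<^sub>E j\<in>UNIV. {..<N}). mixed_deriv UNIV n f 0 *
              (\<Prod>j\<in>UNIV. of_real (bernoulli_poly (n j + 1) (a $ j) / fact (n j + 1)) * w ^ n j)) +
         (\<Sum>S | S \<subset> UNIV. (-1) ^ card S / w ^ (CARD('s) - card S) *
           (\<Sum>n \<in> (\<Pi>\<^sub>E j\<in>S. {..<N}).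
              (LINT x : (\<Pi>\<^sub>E k\<in>- S. {0..}) | Pi\<^sub>M (- S) (\<lambda>_. lborel).
                 mixed_deriv S n f (\<chi> k. if k \<in> S then 0 else of_real (x k))) *
              (\<Prod>j\<in>S. of_real (bernoulli_poly (n j + 1) (a $ j) / fact (n j + 1)) * w ^ n j)))))
      \<in> O[?F](\<lambda>w. w powi (int N - int CARD('s) + 1))"
      unfolding expansion_UNIV[symmetric]
    proof (rule landau_o.bigI[where c = "max C 1"])
      show "\<forall>\<^sub>F w in ?F. norm ((\<Sum>\<^sub>\<infinity>m :: (nat, 's) vec. f (\<chi> j. w * of_real (of_nat (m $ j) + a $ j))) - expansion w UNIV)
          \<le> max C 1 * norm (w powi (int N - int CARD('s) + 1))"
        using ev
      proof eventually_elim
        case (elim w)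
        have w: "w \<noteq> 0" using elim by (simp add: admissible_def)
        have exponent: "int N - int CARD('s) + 1 = int N - int (CARD('s) - 1)"
          using zero_less_card_finite[where 'a = 's] by (simp add: of_nat_diff)
        have "w powi (int N - int CARD('s) + 1) = w powi int N / w powi int (CARD('s) - 1)"
          unfolding exponent using w by (intro power_int_diff) simp
        then have "norm (w powi (int N - int CARD('s) + 1)) = norm w ^ N / norm w ^ (CARD('s) - 1)"
          by (simp only: power_int_of_nat norm_divide norm_power)
        then show ?case
          unfolding expansion_empty(2)[OF elim]
          using C[OF elim] mult_right_mono[of C "max C 1" "norm w ^ N / norm w ^ (CARD('s) - 1)"] by simp
      qed
    qed simp
  qed
qed

end
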